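(* Let $V$ be a complex vector space of finite dimension $N$ with a nondegenerate symmetric bilinear form, and let $n=\lfloor N/2\rfloor$. The incarnation functor $\mathbf F\colon\mathcal{SB}(N,\sigma_N2^n;\kappa_N)\to\mathrm G(V)\text{-mod}$ is full.
   Context: **Representation theory.** Work over $\mathbb C$. $\Phi_V$ is the form on $V$; $[n]=\{1,\dots,n\}$; $\sigma_N=(-1)^{\binom n2+nN}$, $\kappa_N=(-1)^{nN}$. $\mathrm{Cl}=T(V)/(vw+wv-2\Phi_V(v,w):v,w\in V)$ is the Clifford algebra, $\mathbb Z/2$-graded with $V$ odd; $\iota$ is the antiautomorphism of $\mathrm{Cl}$ that is the identity on $V$. $\mathrm{Pin}(V)$ is the group of homogeneous invertible $g\in\mathrm{Cl}$ with $gVg^{-1}=V$ and $g\iota(g)=1$; $\mathrm{Spin}(V)=\mathrm{Pin}(V)\cap\mathrm{Cl}_{\bar0}$. $\mathrm G(V)=\mathrm{Pin}(V)$ if $N$ is even and $\mathrm G(V)=\mathrm{Spin}(V)$ if $N$ is odd. $\mathrm G(V)$-mod is the monoidal category of finite-dimensional modules of the algebraic group $\mathrm G(V)$. The vector module is $V$ with $g\cdot v=gvg^{-1}$. Fix an orthonormal basis $e_1,\dots,e_N$ of $V$ and put $\psi_j=\frac12(e_{2j-1}+\sqrt{-1}e_{2j})$, $\psi_j^\dagger=\frac12(e_{2j-1}-\sqrt{-1}e_{2j})$, $1\le j\le n$. The spin module is $S=\Lambda(\mathrm{span}\{\psi_1^\dagger,\dots,\psi_n^\dagger\})$, with basis $x_I=\psi_{i_1}^\dagger\wedge\dots\wedge\psi_{i_k}^\dagger$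 for $I=\{i_1<\dots<i_k\}\subseteq[n]$; $\mathrm{Cl}$ acts by $\psi_i^\dagger x_I=\psi_i^\dagger\wedge x_I$, $\psi_ix_I=(-1)^{|\{j\in I:j<i\}|}x_{I\setminus\{i\}}$ if $i\in I$ and $0$ otherwise, and, if $N$ is odd, $e_Nx_I=\varepsilon(-1)^{|I|}x_I$ for a fixed choice $\varepsilon\in\{\pm1\}$; $\mathrm G(V)\subseteq\mathrm{Cl}^\times$ acts on $S$ by restriction. $\Phi_S$ is the bilinear form on $S$ with $\Phi_S(x_I,x_J)=(-1)^{\binom{|I|}2+nN|I|+|\{(i,j)\in I\times J:\,i>j\}|}$ if $J=[n]\setminus I$ and $0$ otherwise. For $U\in\{S,V\}$ with basis $B_U$, the left dual basis $\{x^\vee\}$ is defined by $\Phi_U(x^\vee,y)=\delta_{x,y}$, and $\Phi_U^\vee\colon\mathbb C\to U\otimes U$, $1\mapsto\sum_{x\in B_U}x\otimes x^\vee$. **Spin Brauer category.** For a commutative ring $\Bbbk$ (here $\mathbb C$), $d,D\in\Bbbk$, $\kappa\in\{\pm1\}$, $\mathcal{SB}(d,D;\kappa)$ is the strict $\Bbbk$-linear monoidal category (unit object $\mathbf 1$) with generating objects $\mathsf S,\mathsf V$; generating morphisms, for $\mathsf X,\mathsf Y\in\{\mathsf S,\mathsf V\}$, $\cap_{\mathsf X}\colon\mathsf X\otimes\mathsf X\to\mathbf 1$, $\cup_{\mathsf X}\colon\mathbf 1\to\mathsf X\otimes\mathsf X$, $s_{\mathsf X,\mathsf Y}\colon\mathsf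 X\otimes\mathsf Y\to\mathsf Y\otimes\mathsf X$, and $\mu\colon\mathsf V\otimes\mathsf S\to\mathsf S$; and relations, for all $\mathsf X,\mathsf Y,\mathsf Z\in\{\mathsf S,\mathsf V\}$: (1) $s_{\mathsf Y,\mathsf X}s_{\mathsf X,\mathsf Y}=1$; $(s_{\mathsf Y,\mathsf Z}\otimes1_{\mathsf X})(1_{\mathsf Y}\otimes s_{\mathsf X,\mathsf Z})(s_{\mathsf X,\mathsf Y}\otimes1_{\mathsf Z})=(1_{\mathsf Z}\otimes s_{\mathsf X,\mathsf Y})(s_{\mathsf X,\mathsf Z}\otimes1_{\mathsf Y})(1_{\mathsf X}\otimes s_{\mathsf Y,\mathsf Z})$; $(1_{\mathsf X}\otimes\cap_{\mathsf X})(\cup_{\mathsf X}\otimes1_{\mathsf X})=1_{\mathsf X}=(\cap_{\mathsf X}\otimes1_{\mathsf X})(1_{\mathsf X}\otimes\cup_{\mathsf X})$; $\cap_{\mathsf X}s_{\mathsf X,\mathsf X}=\cap_{\mathsf X}$; $(1_{\mathsf Y}\otimes\cap_{\mathsf X})(s_{\mathsf X,\mathsf Y}\otimes1_{\mathsf X})=(\cap_{\mathsf X}\otimes1_{\mathsf Y})(1_{\mathsf X}\otimes s_{\mathsf Y,\mathsf X})$; (2) $s_{\mathsf S,\mathsf X}(\mu\otimes1_{\mathsf X})=(1_{\mathsf X}\otimes\mu)(s_{\mathsf V,\mathsf X}\otimes1_{\mathsf S})(1_{\mathsf V}\otimes s_{\mathsf S,\mathsf X})$; (3) $(\cap_{\mathsf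 S}\otimes1_{\mathsf S\otimes\mathsf V})(1_{\mathsf S}\otimes\mu\otimes1_{\mathsf S\otimes\mathsf V})(1_{\mathsf S\otimes\mathsf V}\otimes\cup_{\mathsf S}\otimes1_{\mathsf V})(1_{\mathsf S}\otimes\cup_{\mathsf V})=(1_{\mathsf S\otimes\mathsf V}\otimes\cap_{\mathsf S})(1_{\mathsf S\otimes\mathsf V}\otimes\mu\otimes1_{\mathsf S})(1_{\mathsf S}\otimes\cup_{\mathsf V}\otimes1_{\mathsf S\otimes\mathsf S})(\cup_{\mathsf S}\otimes1_{\mathsf S})$ as morphisms $\mathsf S\to\mathsf S\otimes\mathsf V$; (4) $\mu\, s_{\mathsf S,\mathsf V}=\kappa\,(\cap_{\mathsf S}\otimes1_{\mathsf S})(1_{\mathsf S}\otimes\mu\otimes1_{\mathsf S})(1_{\mathsf S\otimes\mathsf V}\otimes\cup_{\mathsf S})$; (5) $\mu(1_{\mathsf V}\otimes\mu)+\mu(1_{\mathsf V}\otimes\mu)(s_{\mathsf V,\mathsf V}\otimes1_{\mathsf S})=2\,\cap_{\mathsf V}\otimes1_{\mathsf S}$; (6) $\cap_{\mathsf V}\cup_{\mathsf V}=d\,1_{\mathbf 1}$, $\cap_{\mathsf S}\cup_{\mathsf S}=D\,1_{\mathbf 1}$. **Incarnation functor.** $\mathbf F$ is the $\mathbb C$-linear monoidal functor with $\mathsf S\mapsto S$, $\mathsf V\mapsto V$, $\cap_{\mathsf S}\mapsto\Phi_S$, $\cap_{\mathsf V}\mapsto\Phi_V$, $\cup_{\mathsf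 S}\mapsto\Phi_S^\vee$, $\cup_{\mathsf V}\mapsto\Phi_V^\vee$, $\mu\mapsto(v\otimes x\mapsto vx)$, $s_{\mathsf S,\mathsf S}\mapsto\sigma_N\,\mathrm{flip}$, and the other three $s_{\mathsf X,\mathsf Y}\mapsto\mathrm{flip}$, where $\mathrm{flip}(u\otimes w)=w\otimes u$. *)

theory Defs
  imports Complex_Main "HOL-Algebra.QuotRing"
begin

section \<open>Strict linear monoidal categories, functors, fullness\<close>

text \<open>Composition and tensor product of morphisms take the objects involved as explicit
  arguments: \<open>Comp C X Y Z g f\<close> composes \<open>f : X \<rightarrow> Y\<close> with \<open>g : Y \<rightarrow> Z\<close>, and
  \<open>TMor C X Y X' Y' f g\<close> is \<open>f \<otimes> g\<close> for \<open>f : X \<rightarrow> Y\<close>, \<open>g : X' \<rightarrow> Y'\<close>.\<close>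

record ('o, 'm, 'k) lin_mon_cat =
  Obj :: "'o set"
  Hom :: "'o \<Rightarrow> 'o \<Rightarrow> 'm set"
  Ident :: "'o \<Rightarrow> 'm"
  Comp :: "'o \<Rightarrow> 'o \<Rightarrow> 'o \<Rightarrow> 'm \<Rightarrow> 'm \<Rightarrow> 'm"
  Plus :: "'m \<Rightarrow> 'm \<Rightarrow> 'm"
  Scale :: "'k \<Rightarrow> 'm \<Rightarrow> 'm"
  Unit :: "'o"
  TObj :: "'o \<Rightarrow> 'o \<Rightarrow> 'o"
  TMor :: "'o \<Rightarrow> 'o \<Rightarrow> 'o \<Rightarrow> 'o \<Rightarrow> 'm \<Rightarrow> 'm \<Rightarrow> 'm"

definition linear_monoidal_functor ::
  "('o, 'm, 'k) lin_mon_cat \<Rightarrow> ('p, 'l, 'k) lin_mon_cat \<Rightarrow> ('o \<Rightarrow> 'p) \<Rightarrow> ('o \<Rightarrow> 'o \<Rightarrow> 'm \<Rightarrow> 'l) \<Rightarrow> bool"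
  where
  "linear_monoidal_functor C D Fo Fm \<longleftrightarrow>
     (\<forall>X\<in>Obj C. Fo X \<in> Obj D) \<and>
     (\<forall>X\<in>Obj C. \<forall>Y\<in>Obj C. \<forall>f\<in>Hom C X Y. Fm X Y f \<in> Hom D (Fo X) (Fo Y)) \<and>
     (\<forall>X\<in>Obj C. Fm X X (Ident C X) = Ident D (Fo X)) \<and>
     (\<forall>X\<in>Obj C. \<forall>Y\<in>Obj C. \<forall>Z\<in>Obj C. \<forall>f\<in>Hom C X Y. \<forall>g\<in>Hom C Y Z.
        Fm X Z (Comp C X Y Z g f) = Comp D (Fo X) (Fo Y) (Fo Z) (Fm Y Z g) (Fm X Y f)) \<and>
     (\<forall>X\<in>Obj C. \<forall>Y\<in>Obj C. \<forall>f\<in>Hom C X Y. \<forall>g\<in>Hom C X Y.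
        Fm X Y (Plus C f g) = Plus D (Fm X Y f) (Fm X Y g)) \<and>
     (\<forall>X\<in>Obj C. \<forall>Y\<in>Obj C. \<forall>f\<in>Hom C X Y. \<forall>c.
        Fm X Y (Scale C c f) = Scale D c (Fm X Y f)) \<and>
     Fo (Unit C) = Unit D \<and>
     (\<forall>X\<in>Obj C. \<forall>Y\<in>Obj C. Fo (TObj C X Y) = TObj D (Fo X) (Fo Y)) \<and>
     (\<forall>X\<in>Obj C. \<forall>Y\<in>Obj C. \<forall>X'\<in>Obj C. \<forall>Y'\<in>Obj C. \<forall>f\<in>Hom C X Y. \<forall>g\<in>Hom C X' Y'.
        Fm (TObj C X X') (TObj C Y Y') (TMor C X Y X' Y' f g) =
        TMor D (Fo X) (Fo Y) (Fo X') (Fo Y') (Fm X Y f) (Fm X' Y' g))"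

definition full_functor ::
  "('o, 'm, 'k) lin_mon_cat \<Rightarrow> ('p, 'l, 'k) lin_mon_cat \<Rightarrow> ('o \<Rightarrow> 'p) \<Rightarrow> ('o \<Rightarrow> 'o \<Rightarrow> 'm \<Rightarrow> 'l) \<Rightarrow> bool"
  where
  "full_functor C D Fo Fm \<longleftrightarrow>
     (\<forall>X\<in>Obj C. \<forall>Y\<in>Obj C. Fm X Y ` Hom C X Y = Hom D (Fo X) (Fo Y))"


section \<open>The spin Brauer category\<close>

datatype colour = \<SS> | \<VV>

text \<open>Formal \<open>'k\<close>-linear string diagrams. The objects are the words in the two generators, with
  concatenation as tensor product; \<open>Strand X\<close> is the identity of the word \<open>X\<close>.\<close>

datatype 'k diagram =
    Strand "colour list"
  | Cap colour
  | Cup colour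
  | Cross colour colour
  | Mu
  | Vert "'k diagram" "'k diagram"  (infixr \<open>\<circ>\<^sub>d\<close> 70)
  | Horiz "'k diagram" "'k diagram"  (infixr \<open>\<otimes>\<^sub>d\<close> 75)
  | ZeroD "colour list" "colour list"
  | PlusD "'k diagram" "'k diagram"  (infixl \<open>+\<^sub>d\<close> 65)
  | ScaleD 'k "'k diagram"  (infixr \<open>*\<^sub>d\<close> 68)

primrec src :: "'k diagram \<Rightarrow> colour list" where
  "src (Strand X) = X"
| "src (Cap x) = [x, x]"
| "src (Cup x) = []"
| "src (Cross x y) = [x, y]"
| "src Mu = [\<VV>, \<SS>]"
| "src (g \<circ>\<^sub>d f) = src f"
| "src (f \<otimes>\<^sub>d g) = src f @ src g"
| "src (ZeroD X Y) = X"
| "src (f +\<^sub>d g) = src f"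
| "src (c *\<^sub>d f) = src f"

primrec tgt :: "'k diagram \<Rightarrow> colour list" where
  "tgt (Strand X) = X"
| "tgt (Cap x) = []"
| "tgt (Cup x) = [x, x]"
| "tgt (Cross x y) = [y, x]"
| "tgt Mu = [\<SS>]"
| "tgt (g \<circ>\<^sub>d f) = tgt g"
| "tgt (f \<otimes>\<^sub>d g) = tgt f @ tgt g"
| "tgt (ZeroD X Y) = Y"
| "tgt (f +\<^sub>d g) = tgt f"
| "tgt (c *\<^sub>d f) = tgt f"

primrec wf_diagram :: "'k diagram \<Rightarrow> bool" where
  "wf_diagram (Strand X) = True"
| "wf_diagram (Cap x) = True"
| "wf_diagram (Cup x) = True"
| "wf_diagram (Cross x y) = True"
| "wf_diagram Mu = True"
| "wf_diagram (g \<circ>\<^sub>d f) = (wf_diagram g \<and> wf_diagram f \<and> src g = tgt f)"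
| "wf_diagram (f \<otimes>\<^sub>d g) = (wf_diagram f \<and> wf_diagram g)"
| "wf_diagram (ZeroD X Y) = True"
| "wf_diagram (f +\<^sub>d g) = (wf_diagram f \<and> wf_diagram g \<and> src f = src g \<and> tgt f = tgt g)"
| "wf_diagram (c *\<^sub>d f) = wf_diagram f"

definition diagrams :: "colour list \<Rightarrow> colour list \<Rightarrow> 'k diagram set" where
  "diagrams X Y = {f. wf_diagram f \<and> src f = X \<and> tgt f = Y}"

inductive sb_rel :: "'k::comm_ring_1 \<Rightarrow> 'k \<Rightarrow> 'k \<Rightarrow> 'k diagram \<Rightarrow> 'k diagram \<Rightarrow> bool"
  for d D \<kappa> where
  sym_inv: "sb_rel d D \<kappa> (Cross y x \<circ>\<^sub>d Cross x y) (Strand [x, y])"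
| braid: "sb_rel d D \<kappa>
    ((Cross y z \<otimes>\<^sub>d Strand [x]) \<circ>\<^sub>d (Strand [y] \<otimes>\<^sub>d Cross x z) \<circ>\<^sub>d (Cross x y \<otimes>\<^sub>d Strand [z]))
    ((Strand [z] \<otimes>\<^sub>d Cross x y) \<circ>\<^sub>d (Cross x z \<otimes>\<^sub>d Strand [y]) \<circ>\<^sub>d (Strand [x] \<otimes>\<^sub>d Cross y z))"
| zigzag_left: "sb_rel d D \<kappa>
    ((Strand [x] \<otimes>\<^sub>d Cap x) \<circ>\<^sub>d (Cup x \<otimes>\<^sub>d Strand [x])) (Strand [x])"
| zigzag_right: "sb_rel d D \<kappa>
    ((Cap x \<otimes>\<^sub>d Strand [x]) \<circ>\<^sub>d (Strand [x] \<otimes>\<^sub>d Cup x)) (Strand [x])"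
| cap_cross: "sb_rel d D \<kappa> (Cap x \<circ>\<^sub>d Cross x x) (Cap x)"
| cap_slide: "sb_rel d D \<kappa>
    ((Strand [y] \<otimes>\<^sub>d Cap x) \<circ>\<^sub>d (Cross x y \<otimes>\<^sub>d Strand [x]))
    ((Cap x \<otimes>\<^sub>d Strand [y]) \<circ>\<^sub>d (Strand [x] \<otimes>\<^sub>d Cross y x))"
| mu_cross: "sb_rel d D \<kappa>
    (Cross \<SS> x \<circ>\<^sub>d (Mu \<otimes>\<^sub>d Strand [x]))
    ((Strand [x] \<otimes>\<^sub>d Mu) \<circ>\<^sub>d (Cross \<VV> x \<otimes>\<^sub>d Strand [\<SS>]) \<circ>\<^sub>d (Strand [\<VV>] \<otimes>\<^sub>d Cross \<SS> x))"
| mu_rotate: "sb_rel d D \<kappa>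
    ((Cap \<SS> \<otimes>\<^sub>d Strand [\<SS>, \<VV>]) \<circ>\<^sub>d (Strand [\<SS>] \<otimes>\<^sub>d Mu \<otimes>\<^sub>d Strand [\<SS>, \<VV>]) \<circ>\<^sub>d
     (Strand [\<SS>, \<VV>] \<otimes>\<^sub>d Cup \<SS> \<otimes>\<^sub>d Strand [\<VV>]) \<circ>\<^sub>d (Strand [\<SS>] \<otimes>\<^sub>d Cup \<VV>))
    ((Strand [\<SS>, \<VV>] \<otimes>\<^sub>d Cap \<SS>) \<circ>\<^sub>d (Strand [\<SS>, \<VV>] \<otimes>\<^sub>d Mu \<otimes>\<^sub>d Strand [\<SS>]) \<circ>\<^sub>d
     (Strand [\<SS>] \<otimes>\<^sub>d Cup \<VV> \<otimes>\<^sub>d Strand [\<SS>, \<SS>]) \<circ>\<^sub>d (Cup \<SS> \<otimes>\<^sub>d Strand [\<SS>]))"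
| mu_flip: "sb_rel d D \<kappa>
    (Mu \<circ>\<^sub>d Cross \<SS> \<VV>)
    (\<kappa> *\<^sub>d ((Cap \<SS> \<otimes>\<^sub>d Strand [\<SS>]) \<circ>\<^sub>d (Strand [\<SS>] \<otimes>\<^sub>d Mu \<otimes>\<^sub>d Strand [\<SS>]) \<circ>\<^sub>d
           (Strand [\<SS>, \<VV>] \<otimes>\<^sub>d Cup \<SS>)))"
| clifford: "sb_rel d D \<kappa>
    ((Mu \<circ>\<^sub>d (Strand [\<VV>] \<otimes>\<^sub>d Mu)) +\<^sub>d
     (Mu \<circ>\<^sub>d (Strand [\<VV>] \<otimes>\<^sub>d Mu) \<circ>\<^sub>d (Cross \<VV> \<VV> \<otimes>\<^sub>d Strand [\<SS>])))
    (2 *\<^sub>d (Cap \<VV> \<otimes>\<^sub>d Strand [\<SS>]))"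
| dim_V: "sb_rel d D \<kappa> (Cap \<VV> \<circ>\<^sub>d Cup \<VV>) (d *\<^sub>d Strand [])"
| dim_S: "sb_rel d D \<kappa> (Cap \<SS> \<circ>\<^sub>d Cup \<SS>) (D *\<^sub>d Strand [])"

text \<open>The congruence on well-formed diagrams generated by the defining relations and the axioms of a
  strict \<open>'k\<close>-linear monoidal category. The premises keep both sides well-formed of the same type,
  so that no two diagrams get identified through an ill-typed intermediate term.\<close>

inductive sb_eq :: "'k::comm_ring_1 \<Rightarrow> 'k \<Rightarrow> 'k \<Rightarrow> 'k diagram \<Rightarrow> 'k diagram \<Rightarrow> bool"
  for d D \<kappa> where
  rel: "sb_rel d D \<kappa> f g \<Longrightarrow> sb_eq d D \<kappa> f g"
| refl: "wf_diagram f \<Longrightarrow> sb_eq d D \<kappa> f f"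
| sym: "sb_eq d D \<kappa> f g \<Longrightarrow> sb_eq d D \<kappa> g f"
| trans: "sb_eq d D \<kappa> f g \<Longrightarrow> sb_eq d D \<kappa> g h \<Longrightarrow> sb_eq d D \<kappa> f h"
| vert_cong: "sb_eq d D \<kappa> g g' \<Longrightarrow> sb_eq d D \<kappa> f f' \<Longrightarrow> src g = tgt f \<Longrightarrow>
    sb_eq d D \<kappa> (g \<circ>\<^sub>d f) (g' \<circ>\<^sub>d f')"
| horiz_cong: "sb_eq d D \<kappa> f f' \<Longrightarrow> sb_eq d D \<kappa> g g' \<Longrightarrow> sb_eq d D \<kappa> (f \<otimes>\<^sub>d g) (f' \<otimes>\<^sub>d g')"
| plus_cong: "sb_eq d D \<kappa> f f' \<Longrightarrow> sb_eq d D \<kappa> g g' \<Longrightarrow> src f = src g \<Longrightarrow> tgt f = tgt g \<Longrightarrow>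
    sb_eq d D \<kappa> (f +\<^sub>d g) (f' +\<^sub>d g')"
| scale_cong: "sb_eq d D \<kappa> f f' \<Longrightarrow> sb_eq d D \<kappa> (c *\<^sub>d f) (c *\<^sub>d f')"
| vert_assoc: "wf_diagram (h \<circ>\<^sub>d g \<circ>\<^sub>d f) \<Longrightarrow> sb_eq d D \<kappa> ((h \<circ>\<^sub>d g) \<circ>\<^sub>d f) (h \<circ>\<^sub>d g \<circ>\<^sub>d f)"
| vert_id_left: "wf_diagram f \<Longrightarrow> sb_eq d D \<kappa> (Strand (tgt f) \<circ>\<^sub>d f) f"
| vert_id_right: "wf_diagram f \<Longrightarrow> sb_eq d D \<kappa> (f \<circ>\<^sub>d Strand (src f)) f"
| horiz_assoc: "wf_diagram (f \<otimes>\<^sub>d g \<otimes>\<^sub>d h) \<Longrightarrow> sb_eq d D \<kappa> ((f \<otimes>\<^sub>d g) \<otimes>\<^sub>d h) (f \<otimes>\<^sub>d g \<otimes>\<^sub>d h)"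
| horiz_unit_left: "wf_diagram f \<Longrightarrow> sb_eq d D \<kappa> (Strand [] \<otimes>\<^sub>d f) f"
| horiz_unit_right: "wf_diagram f \<Longrightarrow> sb_eq d D \<kappa> (f \<otimes>\<^sub>d Strand []) f"
| horiz_id: "sb_eq d D \<kappa> (Strand X \<otimes>\<^sub>d Strand Y) (Strand (X @ Y))"
| interchange: "wf_diagram (g \<circ>\<^sub>d f) \<Longrightarrow> wf_diagram (g' \<circ>\<^sub>d f') \<Longrightarrow>
    sb_eq d D \<kappa> ((g \<otimes>\<^sub>d g') \<circ>\<^sub>d (f \<otimes>\<^sub>d f')) ((g \<circ>\<^sub>d f) \<otimes>\<^sub>d (g' \<circ>\<^sub>d f'))"
| plus_assoc: "wf_diagram (f +\<^sub>d g +\<^sub>d h) \<Longrightarrow> sb_eq d D \<kappa> (f +\<^sub>d g +\<^sub>d h) (f +\<^sub>d (g +\<^sub>d h))"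
| plus_comm: "wf_diagram (f +\<^sub>d g) \<Longrightarrow> sb_eq d D \<kappa> (f +\<^sub>d g) (g +\<^sub>d f)"
| plus_zero: "wf_diagram f \<Longrightarrow> sb_eq d D \<kappa> (f +\<^sub>d ZeroD (src f) (tgt f)) f"
| scale_zero: "wf_diagram f \<Longrightarrow> sb_eq d D \<kappa> (0 *\<^sub>d f) (ZeroD (src f) (tgt f))"
| scale_one: "wf_diagram f \<Longrightarrow> sb_eq d D \<kappa> (1 *\<^sub>d f) f"
| scale_scale: "wf_diagram f \<Longrightarrow> sb_eq d D \<kappa> (a *\<^sub>d b *\<^sub>d f) ((a * b) *\<^sub>d f)"
| scale_add: "wf_diagram f \<Longrightarrow> sb_eq d D \<kappa> ((a + b) *\<^sub>d f) (a *\<^sub>d f +\<^sub>d b *\<^sub>d f)"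
| scale_plus: "wf_diagram (f +\<^sub>d g) \<Longrightarrow> sb_eq d D \<kappa> (a *\<^sub>d (f +\<^sub>d g)) (a *\<^sub>d f +\<^sub>d a *\<^sub>d g)"
| vert_plus_left: "wf_diagram ((g +\<^sub>d g') \<circ>\<^sub>d f) \<Longrightarrow>
    sb_eq d D \<kappa> ((g +\<^sub>d g') \<circ>\<^sub>d f) ((g \<circ>\<^sub>d f) +\<^sub>d (g' \<circ>\<^sub>d f))"
| vert_plus_right: "wf_diagram (g \<circ>\<^sub>d (f +\<^sub>d f')) \<Longrightarrow>
    sb_eq d D \<kappa> (g \<circ>\<^sub>d (f +\<^sub>d f')) ((g \<circ>\<^sub>d f) +\<^sub>d (g \<circ>\<^sub>d f'))"
| vert_scale_left: "wf_diagram (g \<circ>\<^sub>d f) \<Longrightarrow> sb_eq d D \<kappa> ((a *\<^sub>d g) \<circ>\<^sub>d f) (a *\<^sub>d (g \<circ>\<^sub>d f))"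
| vert_scale_right: "wf_diagram (g \<circ>\<^sub>d f) \<Longrightarrow> sb_eq d D \<kappa> (g \<circ>\<^sub>d (a *\<^sub>d f)) (a *\<^sub>d (g \<circ>\<^sub>d f))"
| horiz_plus_left: "wf_diagram ((g +\<^sub>d g') \<otimes>\<^sub>d f) \<Longrightarrow>
    sb_eq d D \<kappa> ((g +\<^sub>d g') \<otimes>\<^sub>d f) ((g \<otimes>\<^sub>d f) +\<^sub>d (g' \<otimes>\<^sub>d f))"
| horiz_plus_right: "wf_diagram (g \<otimes>\<^sub>d (f +\<^sub>d f')) \<Longrightarrow>
    sb_eq d D \<kappa> (g \<otimes>\<^sub>d (f +\<^sub>d f')) ((g \<otimes>\<^sub>d f) +\<^sub>d (g \<otimes>\<^sub>d f'))"
| horiz_scale_left: "wf_diagram (g \<otimes>\<^sub>d f) \<Longrightarrow> sb_eq d D \<kappa> ((a *\<^sub>d g) \<otimes>\<^sub>d f) (a *\<^sub>d (g \<otimes>\<^sub>d f))"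
| horiz_scale_right: "wf_diagram (g \<otimes>\<^sub>d f) \<Longrightarrow> sb_eq d D \<kappa> (g \<otimes>\<^sub>d (a *\<^sub>d f)) (a *\<^sub>d (g \<otimes>\<^sub>d f))"

lemma sb_rel_typed:
  "sb_rel d D \<kappa> f g \<Longrightarrow> wf_diagram f \<and> wf_diagram g \<and> src f = src g \<and> tgt f = tgt g"
  by (induction rule: sb_rel.induct) auto

lemma sb_eq_typed:
  "sb_eq d D \<kappa> f g \<Longrightarrow> wf_diagram f \<and> wf_diagram g \<and> src f = src g \<and> tgt f = tgt g"
  by (induction rule: sb_eq.induct) (auto dest: sb_rel_typed)

definition sb_class :: "'k::comm_ring_1 \<Rightarrow> 'k \<Rightarrow> 'k \<Rightarrow> 'k diagram \<Rightarrow> 'k diagram set" where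
  "sb_class d D \<kappa> f = {g. sb_eq d D \<kappa> f g}"

definition spin_brauer :: "'k::comm_ring_1 \<Rightarrow> 'k \<Rightarrow> 'k \<Rightarrow> (colour list, 'k diagram set, 'k) lin_mon_cat"
  where
  "spin_brauer d D \<kappa> = \<lparr>
     Obj = UNIV,
     Hom = (\<lambda>X Y. sb_class d D \<kappa> ` diagrams X Y),
     Ident = (\<lambda>X. sb_class d D \<kappa> (Strand X)),
     Comp = (\<lambda>X Y Z G F. \<Union>g\<in>G. \<Union>f\<in>F. sb_class d D \<kappa> (g \<circ>\<^sub>d f)),
     Plus = (\<lambda>F G. \<Union>f\<in>F. \<Union>g\<in>G. sb_class d D \<kappa> (f +\<^sub>d g)),
     Scale = (\<lambda>c F. \<Union>f\<in>F. sb_class d D \<kappa> (c *\<^sub>d f)),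
     Unit = [],
     TObj = (@),
     TMor = (\<lambda>X Y X' Y' F G. \<Union>f\<in>F. \<Union>g\<in>G. sb_class d D \<kappa> (f \<otimes>\<^sub>d g))\<rparr>"


section \<open>Matrices over arbitrary index sets\<close>

text \<open>\<open>A i j\<close> is the entry in row \<open>i\<close> and column \<open>j\<close>; a matrix in \<open>mats I J\<close> represents the linear
  map from \<open>\<complex>\<^sup>J\<close> to \<open>\<complex>\<^sup>I\<close> that sends the basis vector \<open>j\<close> to the sum of all \<open>A i j\<close> times the basis
  vector \<open>i\<close>.\<close>

type_synonym ('i, 'j) cmat = "'i \<Rightarrow> 'j \<Rightarrow> complex"

definition mats :: "'i set \<Rightarrow> 'j set \<Rightarrow> ('i, 'j) cmat set" where
  "mats I J = {A. \<forall>i j. A i j \<noteq> 0 \<longrightarrow> i \<in> I \<and> j \<in> J}"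

definition mat_of :: "'i set \<Rightarrow> 'j set \<Rightarrow> ('i, 'j) cmat \<Rightarrow> ('i, 'j) cmat" where
  "mat_of I J A = (\<lambda>i j. if i \<in> I \<and> j \<in> J then A i j else 0)"

definition mat_one :: "'i set \<Rightarrow> ('i, 'i) cmat" where
  "mat_one I = mat_of I I (\<lambda>i j. of_bool (i = j))"

definition mat_mul :: "'j set \<Rightarrow> ('i, 'j) cmat \<Rightarrow> ('j, 'k) cmat \<Rightarrow> ('i, 'k) cmat" where
  "mat_mul J A B = (\<lambda>i k. \<Sum>j\<in>J. A i j * B j k)"

definition mat_add :: "('i, 'j) cmat \<Rightarrow> ('i, 'j) cmat \<Rightarrow> ('i, 'j) cmat" where
  "mat_add A B = (\<lambda>i j. A i j + B i j)"

definition mat_scale :: "complex \<Rightarrow> ('i, 'j) cmat \<Rightarrow> ('i, 'j) cmat" where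
  "mat_scale c A = (\<lambda>i j. c * A i j)"

text \<open>Kronecker product: rows and columns are indexed by lists, and \<open>p\<close>, \<open>q\<close> are the lengths of the
  row and column indices of the first factor.\<close>

definition mat_tensor :: "nat \<Rightarrow> nat \<Rightarrow> ('b list, 'b list) cmat \<Rightarrow> ('b list, 'b list) cmat \<Rightarrow>
    ('b list, 'b list) cmat" where
  "mat_tensor p q A B = (\<lambda>i j. A (take p i) (take q j) * B (drop p i) (drop q j))"


section \<open>Finite-dimensional modules of an algebraic group\<close>

text \<open>The group \<open>G\<close> is a Zariski closed subgroup of the units of a finite-dimensional algebra \<open>R\<close>,
  with \<open>\<eta> : \<complex> \<rightarrow> R\<close> the scalars. A regular function on \<open>G\<close> is the restriction of a polynomial
  function on the vector space \<open>R\<close>.\<close>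

definition linear_functional :: "('a, 'r) ring_scheme \<Rightarrow> (complex \<Rightarrow> 'a) \<Rightarrow> ('a \<Rightarrow> complex) \<Rightarrow> bool" where
  "linear_functional R \<eta> L \<longleftrightarrow>
     (\<forall>a\<in>carrier R. \<forall>b\<in>carrier R. L (a \<oplus>\<^bsub>R\<^esub> b) = L a + L b) \<and>
     (\<forall>c. \<forall>a\<in>carrier R. L (\<eta> c \<otimes>\<^bsub>R\<^esub> a) = c * L a)"

inductive polynomial_function :: "('a, 'r) ring_scheme \<Rightarrow> (complex \<Rightarrow> 'a) \<Rightarrow> ('a \<Rightarrow> complex) \<Rightarrow> bool"
  for R \<eta> where
  "polynomial_function R \<eta> (\<lambda>_. c)"
| "linear_functional R \<eta> L \<Longrightarrow> polynomial_function R \<eta> L"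
| "polynomial_function R \<eta> p \<Longrightarrow> polynomial_function R \<eta> q \<Longrightarrow> polynomial_function R \<eta> (\<lambda>a. p a + q a)"
| "polynomial_function R \<eta> p \<Longrightarrow> polynomial_function R \<eta> q \<Longrightarrow> polynomial_function R \<eta> (\<lambda>a. p a * q a)"

definition regular_function ::
  "('a, 'r) ring_scheme \<Rightarrow> (complex \<Rightarrow> 'a) \<Rightarrow> 'a set \<Rightarrow> ('a \<Rightarrow> complex) \<Rightarrow> bool" where
  "regular_function R \<eta> G f \<longleftrightarrow> (\<exists>p. polynomial_function R \<eta> p \<and> (\<forall>g\<in>G. f g = p g))"

text \<open>To have a strict tensor product inside one type, every module comes with a basis: an object
  \<open>([I\<^sub>1, \<dots>, I\<^sub>k], \<rho>)\<close> has as underlying vector space the tensor product of the spaces with bases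
  \<open>I\<^sub>1, \<dots>, I\<^sub>k\<close>, so that its basis is the set of tuples \<open>listset [I\<^sub>1, \<dots>, I\<^sub>k]\<close>, and \<open>\<rho> g\<close> is the
  matrix of \<open>g\<close>. If the type \<open>'b\<close> of labels is infinite, each finite-dimensional module is
  isomorphic to one of these (with \<open>k = 1\<close>).\<close>

type_synonym ('a, 'b) based_module = "'b set list \<times> ('a \<Rightarrow> ('b list, 'b list) cmat)"

definition based_modules ::
  "('a, 'r) ring_scheme \<Rightarrow> (complex \<Rightarrow> 'a) \<Rightarrow> 'a set \<Rightarrow> ('a, 'b) based_module set" where
  "based_modules R \<eta> G = {(Is, \<rho>).
     (\<forall>I\<in>set Is. finite I) \<and>
     (\<forall>g\<in>G. \<rho> g \<in> mats (listset Is) (listset Is)) \<and>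
     \<rho> \<one>\<^bsub>R\<^esub> = mat_one (listset Is) \<and>
     (\<forall>g\<in>G. \<forall>h\<in>G. \<rho> (g \<otimes>\<^bsub>R\<^esub> h) = mat_mul (listset Is) (\<rho> g) (\<rho> h)) \<and>
     (\<forall>i\<in>listset Is. \<forall>j\<in>listset Is. regular_function R \<eta> G (\<lambda>g. \<rho> g i j))}"

definition module_homs :: "'a set \<Rightarrow> ('a, 'b) based_module \<Rightarrow> ('a, 'b) based_module \<Rightarrow>
    ('b list, 'b list) cmat set" where
  "module_homs G M M' = {A \<in> mats (listset (fst M')) (listset (fst M)). \<forall>g\<in>G.
     mat_mul (listset (fst M)) A (snd M g) = mat_mul (listset (fst M')) (snd M' g) A}"

definition module_tensor ::
  "('a, 'b) based_module \<Rightarrow> ('a, 'b) based_module \<Rightarrow> ('a, 'b) based_module" where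
  "module_tensor M M' = (fst M @ fst M',
     \<lambda>g. mat_tensor (length (fst M)) (length (fst M)) (snd M g) (snd M' g))"

definition trivial_module :: "('a, 'b) based_module" where
  "trivial_module = ([], \<lambda>_. mat_one {[]})"

definition module_category :: "('a, 'r) ring_scheme \<Rightarrow> (complex \<Rightarrow> 'a) \<Rightarrow> 'a set \<Rightarrow>
    (('a, 'b) based_module, ('b list, 'b list) cmat, complex) lin_mon_cat" where
  "module_category R \<eta> G = \<lparr>
     Obj = based_modules R \<eta> G,
     Hom = module_homs G,
     Ident = (\<lambda>M. mat_one (listset (fst M))),
     Comp = (\<lambda>L M N. mat_mul (listset (fst M))),
     Plus = mat_add,
     Scale = mat_scale,
     Unit = trivial_module,
     TObj = module_tensor,
     TMor = (\<lambda>L M L' M'. mat_tensor (length (fst M)) (length (fst L)))\<rparr>"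


section \<open>Quadratic spaces and Clifford algebras\<close>

locale quadratic_space = vector_space scale
  for scale :: "complex \<Rightarrow> 'v::ab_group_add \<Rightarrow> 'v" +
  fixes \<Phi> :: "'v \<Rightarrow> 'v \<Rightarrow> complex"
  assumes finite_dimensional: "\<exists>B. finite B \<and> span B = UNIV"
    and form_add_left: "\<Phi> (u + v) w = \<Phi> u w + \<Phi> v w"
    and form_scale_left: "\<Phi> (scale c v) w = c * \<Phi> v w"
    and form_symmetric: "\<Phi> v w = \<Phi> w v"
    and form_nondegenerate: "(\<And>w. \<Phi> v w = 0) \<Longrightarrow> v = 0"
begin

definition orthonormal_basis :: "nat \<Rightarrow> (nat \<Rightarrow> 'v) \<Rightarrow> bool" where
  "orthonormal_basis N e \<longleftrightarrow>
     inj_on e {1..N} \<and> independent (e ` {1..N}) \<and> span (e ` {1..N}) = UNIV \<and>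
     (\<forall>i\<in>{1..N}. \<forall>j\<in>{1..N}. \<Phi> (e i) (e j) = of_bool (i = j))"

end

text \<open>The free unital algebra on the set of all vectors. The tensor algebra \<open>T(V)\<close> is its quotient
  by the relations that make \<open>v \<mapsto> monomial [v]\<close> linear. The Clifford algebra, a quotient of
  \<open>T(V)\<close>, is therefore obtained by dividing out the linearity and the Clifford relations at once.\<close>

definition free_algebra :: "('v list \<Rightarrow> complex) ring" where
  "free_algebra = \<lparr>
     carrier = {f. finite {w. f w \<noteq> 0}},
     mult = (\<lambda>f g w. \<Sum>k\<le>length w. f (take k w) * g (drop k w)),
     one = (\<lambda>w. of_bool (w = [])),
     zero = (\<lambda>w. 0),
     add = (\<lambda>f g w. f w + g w)\<rparr>"

definition monomial :: "'v list \<Rightarrow> ('v list \<Rightarrow> complex)" where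
  "monomial w = (\<lambda>u. of_bool (u = w))"

text \<open>The spin data: the space \<open>V\<close> (the type \<open>'v\<close> with scalar multiplication and form), its dimension
  \<open>N\<close>, an orthonormal basis \<open>e 1, \<dots>, e N\<close> and, for odd \<open>N\<close>, the sign \<open>\<epsilon>\<close>. The locale only
  abbreviates parameters; it makes no assumptions.\<close>

locale spin_data =
  fixes scale :: "complex \<Rightarrow> 'v::ab_group_add \<Rightarrow> 'v"
    and \<Phi> :: "'v \<Rightarrow> 'v \<Rightarrow> complex"
    and N :: nat
    and e :: "nat \<Rightarrow> 'v"
    and \<epsilon> :: complex
begin

definition clifford_relations :: "('v list \<Rightarrow> complex) set" where
  "clifford_relations =
     {\<lambda>u. monomial [v + w] u - monomial [v] u - monomial [w] u |v w. True} \<union>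
     {\<lambda>u. monomial [scale c v] u - c * monomial [v] u |c v. True} \<union>
     {\<lambda>u. monomial [v, w] u + monomial [w, v] u - 2 * \<Phi> v w * monomial [] u |v w. True}"

definition clifford_ideal :: "('v list \<Rightarrow> complex) set" where
  "clifford_ideal = Idl\<^bsub>free_algebra\<^esub> clifford_relations"

definition Cl :: "('v list \<Rightarrow> complex) set ring" where
  "Cl = free_algebra Quot clifford_ideal"

definition cl_of :: "('v list \<Rightarrow> complex) \<Rightarrow> ('v list \<Rightarrow> complex) set" where
  "cl_of f = clifford_ideal +>\<^bsub>free_algebra\<^esub> f"

definition cl_scalar :: "complex \<Rightarrow> ('v list \<Rightarrow> complex) set" where
  "cl_scalar c = cl_of (\<lambda>u. c * monomial [] u)"

definition cl_vec :: "'v \<Rightarrow> ('v list \<Rightarrow> complex) set" where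
  "cl_vec v = cl_of (monomial [v])"

definition cl_even :: "('v list \<Rightarrow> complex) set set" where
  "cl_even = cl_of ` {f \<in> carrier free_algebra. \<forall>w. f w \<noteq> 0 \<longrightarrow> even (length w)}"

definition cl_odd :: "('v list \<Rightarrow> complex) set set" where
  "cl_odd = cl_of ` {f \<in> carrier free_algebra. \<forall>w. f w \<noteq> 0 \<longrightarrow> odd (length w)}"

text \<open>The antiautomorphism \<open>\<iota>\<close> is induced by the reversal of words. Reversal maps the ideal onto
  itself, so the elementwise image of a coset is a coset.\<close>

definition cl_rev :: "('v list \<Rightarrow> complex) set \<Rightarrow> ('v list \<Rightarrow> complex) set" where
  "cl_rev a = (\<lambda>f. f \<circ> rev) ` a"

definition Pin :: "('v list \<Rightarrow> complex) set set" where
  "Pin = {g \<in> Units Cl. g \<in> cl_even \<union> cl_odd \<and>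
     (\<lambda>x. g \<otimes>\<^bsub>Cl\<^esub> x \<otimes>\<^bsub>Cl\<^esub> inv\<^bsub>Cl\<^esub> g) ` range cl_vec = range cl_vec \<and>
     g \<otimes>\<^bsub>Cl\<^esub> cl_rev g = \<one>\<^bsub>Cl\<^esub>}"

definition Spin :: "('v list \<Rightarrow> complex) set set" where
  "Spin = Pin \<inter> cl_even"

definition GV :: "('v list \<Rightarrow> complex) set set" where
  "GV = (if even N then Pin else Spin)"


subsection \<open>The vector and the spin module\<close>

abbreviation n :: nat where "n \<equiv> N div 2"

definition \<sigma> :: complex where "\<sigma> = (-1) ^ ((n choose 2) + n * N)"

definition \<kappa> :: complex where "\<kappa> = (-1) ^ (n * N)"

definition vec_act :: "('v list \<Rightarrow> complex) set \<Rightarrow> 'v \<Rightarrow> 'v" where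
  "vec_act g v = (THE w. cl_vec w = g \<otimes>\<^bsub>Cl\<^esub> cl_vec v \<otimes>\<^bsub>Cl\<^esub> inv\<^bsub>Cl\<^esub> g)"

definition \<psi> :: "nat \<Rightarrow> 'v" where
  "\<psi> j = scale (1/2) (e (2 * j - 1) + scale \<i> (e (2 * j)))"

definition \<psi>_dag :: "nat \<Rightarrow> 'v" where
  "\<psi>_dag j = scale (1/2) (e (2 * j - 1) - scale \<i> (e (2 * j)))"

text \<open>Matrices with respect to the basis \<open>x\<^sub>I\<close>, \<open>I \<subseteq> [n]\<close>, of the spin module: \<open>A J I\<close> is the
  coefficient of \<open>x\<^sub>J\<close> in the image of \<open>x\<^sub>I\<close>. The wedge product of \<open>\<psi>_dag i\<close> with \<open>x\<^sub>I\<close> is zero if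
  \<open>i \<in> I\<close>; otherwise sorting the factors gives the sign below.\<close>

definition creation :: "nat \<Rightarrow> (nat set, nat set) cmat" where
  "creation i = (\<lambda>J I. if i \<notin> I \<and> J = insert i I then (-1) ^ card {j\<in>I. j < i} else 0)"

definition annihilation :: "nat \<Rightarrow> (nat set, nat set) cmat" where
  "annihilation i = (\<lambda>J I. if i \<in> I \<and> J = I - {i} then (-1) ^ card {j\<in>I. j < i} else 0)"

definition parity_op :: "(nat set, nat set) cmat" where
  "parity_op = (\<lambda>J I. if J = I then \<epsilon> * (-1) ^ card I else 0)"

text \<open>\<open>\<psi> j\<close> and \<open>\<psi>_dag j\<close> are isotropic with \<open>\<Phi> (\<psi> j) (\<psi>_dag j) = 1/2\<close>, so the coefficients of \<open>v\<close>
  at \<open>\<psi> j\<close> and \<open>\<psi>_dag j\<close> are \<open>2 \<Phi> (\<psi>_dag j) v\<close> and \<open>2 \<Phi> (\<psi> j) v\<close>.\<close>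

definition spin_vec :: "'v \<Rightarrow> (nat set, nat set) cmat" where
  "spin_vec v = mat_of (Pow {1..n}) (Pow {1..n}) (\<lambda>J I.
     (\<Sum>j=1..n. 2 * \<Phi> (\<psi>_dag j) v * annihilation j J I + 2 * \<Phi> (\<psi> j) v * creation j J I) +
     (if odd N then \<Phi> (e N) v * parity_op J I else 0))"

primrec spin_word :: "'v list \<Rightarrow> (nat set, nat set) cmat" where
  "spin_word [] = mat_one (Pow {1..n})"
| "spin_word (v # w) = mat_mul (Pow {1..n}) (spin_vec v) (spin_word w)"

definition spin_free :: "('v list \<Rightarrow> complex) \<Rightarrow> (nat set, nat set) cmat" where
  "spin_free f = (\<lambda>J I. \<Sum>w\<in>{w. f w \<noteq> 0}. f w * spin_word w J I)"

text \<open>The Clifford relations act by zero, so \<open>spin_free\<close> is constant on cosets.\<close>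

definition spin_act :: "('v list \<Rightarrow> complex) set \<Rightarrow> (nat set, nat set) cmat" where
  "spin_act a = the_elem (spin_free ` a)"

definition spin_form :: "nat set \<Rightarrow> nat set \<Rightarrow> complex" where
  "spin_form I J =
     (if J = {1..n} - I
      then (-1) ^ ((card I choose 2) + n * N * card I + card {(i, j). i \<in> I \<and> j \<in> J \<and> i > j})
      else 0)"

end


section \<open>The incarnation functor\<close>

text \<open>Labels for the basis vectors \<open>x\<^sub>I\<close> and \<open>e i\<close>.\<close>

datatype label = SpinL "nat set" | VecL nat

context spin_data
begin

definition basis :: "colour \<Rightarrow> label set" where
  "basis x = (case x of \<SS> \<Rightarrow> SpinL ` Pow {1..n} | \<VV> \<Rightarrow> VecL ` {1..N})"

definition label_form :: "label \<Rightarrow> label \<Rightarrow> complex" where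
  "label_form x y = (case (x, y) of
     (SpinL I, SpinL J) \<Rightarrow> spin_form I J
   | (VecL i, VecL j) \<Rightarrow> \<Phi> (e i) (e j)
   | _ \<Rightarrow> 0)"

text \<open>\<open>left_dual B x\<close> is the coefficient function of the left dual basis vector of \<open>x \<in> B\<close>.\<close>

definition left_dual :: "label set \<Rightarrow> label \<Rightarrow> label \<Rightarrow> complex" where
  "left_dual B x = (THE c. (\<forall>z. z \<notin> B \<longrightarrow> c z = 0) \<and>
     (\<forall>y\<in>B. (\<Sum>z\<in>B. c z * label_form z y) = of_bool (x = y)))"

definition S_module :: "(('v list \<Rightarrow> complex) set, label) based_module" where
  "S_module = ([basis \<SS>], \<lambda>g. mat_of (listset [basis \<SS>]) (listset [basis \<SS>])
     (\<lambda>y x. case (hd y, hd x) of (SpinL J, SpinL I) \<Rightarrow> spin_act g J I | _ \<Rightarrow> 0))"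

text \<open>As \<open>e\<close> is orthonormal, \<open>\<Phi> (e i) v\<close> is the coefficient of \<open>v\<close> at \<open>e i\<close>.\<close>

definition V_module :: "(('v list \<Rightarrow> complex) set, label) based_module" where
  "V_module = ([basis \<VV>], \<lambda>g. mat_of (listset [basis \<VV>]) (listset [basis \<VV>])
     (\<lambda>y x. case (hd y, hd x) of (VecL i, VecL j) \<Rightarrow> \<Phi> (e i) (vec_act g (e j)) | _ \<Rightarrow> 0))"

definition G_mod :: "((('v list \<Rightarrow> complex) set, label) based_module,
    (label list, label list) cmat, complex) lin_mon_cat" where
  "G_mod = module_category Cl cl_scalar GV"

primrec inc_obj :: "colour list \<Rightarrow> (('v list \<Rightarrow> complex) set, label) based_module" where
  "inc_obj [] = trivial_module"
| "inc_obj (x # X) = module_tensor (case x of \<SS> \<Rightarrow> S_module | \<VV> \<Rightarrow> V_module) (inc_obj X)"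

definition word_basis :: "colour list \<Rightarrow> label list set" where
  "word_basis X = listset (map basis X)"

primrec inc_diagram :: "complex diagram \<Rightarrow> (label list, label list) cmat" where
  "inc_diagram (Strand X) = mat_one (word_basis X)"
| "inc_diagram (Cap x) =
     mat_of {[]} (word_basis [x, x]) (\<lambda>_ u. label_form (u ! 0) (u ! 1))"
| "inc_diagram (Cup x) =
     mat_of (word_basis [x, x]) {[]} (\<lambda>u _. left_dual (basis x) (u ! 0) (u ! 1))"
| "inc_diagram (Cross x y) =
     mat_of (word_basis [y, x]) (word_basis [x, y]) (\<lambda>u' u.
       if u' = [u ! 1, u ! 0] then (if x = \<SS> \<and> y = \<SS> then \<sigma> else 1) else 0)"
| "inc_diagram Mu =
     mat_of (word_basis [\<SS>]) (word_basis [\<VV>, \<SS>]) (\<lambda>u' u.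
       case (u' ! 0, u ! 0, u ! 1) of
         (SpinL J, VecL i, SpinL I) \<Rightarrow> spin_vec (e i) J I
       | _ \<Rightarrow> 0)"
| "inc_diagram (g \<circ>\<^sub>d f) = mat_mul (word_basis (tgt f)) (inc_diagram g) (inc_diagram f)"
| "inc_diagram (f \<otimes>\<^sub>d g) =
     mat_tensor (length (tgt f)) (length (src f)) (inc_diagram f) (inc_diagram g)"
| "inc_diagram (ZeroD X Y) = (\<lambda>_ _. 0)"
| "inc_diagram (f +\<^sub>d g) = mat_add (inc_diagram f) (inc_diagram g)"
| "inc_diagram (c *\<^sub>d f) = mat_scale c (inc_diagram f)"

text \<open>A morphism of the spin Brauer category is a class of diagrams, on which \<open>inc_diagram\<close> takes
  a single value.\<close>

definition inc_mor ::
  "colour list \<Rightarrow> colour list \<Rightarrow> complex diagram set \<Rightarrow> (label list, label list) cmat" where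
  "inc_mor X Y F = the_elem (inc_diagram ` F)"

definition SB :: "(colour list, complex diagram set, complex) lin_mon_cat" where
  "SB = spin_brauer (of_nat N) (\<sigma> * 2 ^ n) \<kappa>"

end

end

(*
  Functoriality is a check on bases: each e_k acts on S by x_I |-> (phase) x_(I Delta F), the form
  pairs x_I with x_([n] - I) by a sign that is a product over I, and both relations and equivariance
  become identities of finite sums.

  Fullness. Bending inputs by caps and cups reduces it to invariants of words in S and V. The element
  -1 kills words with an odd number of S. Two factors S are eliminated by a Fierz identity: conjugating
  cup o cap by all products of gamma matrices on one factor and summing gives a scalar (Schur), and the
  sum over the products of length k factors through the k-th tensor power of V. For a power of V,
  differentiating the invariance under the elements e_i (cos t e_i + sin t e_j) shows, modulo
  contractions, that the transpositions with a fixed slot add up to -(N - 1) on an invariant w. If w is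
  alternating in a maximal number k of slots among the unrealized invariants, counting gives
  m = k (k + 1 - N), so m = k = N and w is a multiple of the volume form. For even N that is not
  invariant under e_1; for odd N it is the antisymmetrized trace of a product of gamma matrices.
*)

theory Submission
  imports Defs "HOL-Combinatorics.Permutations"
begin

section \<open>Matrices as operators on coefficient functions\<close>

text \<open>The Fierz layers need no antisymmetrizers. Summing the conjugations by the single e_i is
  a diagram with one more strand V, and it sends layer k to a combination of layers k + 1 and k - 1;
  so every layer is obtained from layer 0, the cup after the cap, by solving for layer k + 1. For
  powers of V only products of two unit vectors are differentiated. They lie in Spin(V), so the
  argument is the same for both parities of N, and the parity enters through the volume form alone.
  The count has three sources. Summing the slot identity over the k alternating slots gives k (N -
  1), the transpositions among these slots give - k (k - 1), and the other slots give m - k, because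
  by maximality of k antisymmetrizing one further slot yields a realized tensor. Alternation in more
  than N slots forces w = 0, and for k < N the total k (N - 1 - k) + m is positive. For odd N the
  restriction to Spin(V) secures the invariance of the form on S: the adjoint of a product of r
  vectors is its reversal times \<kappa> to the power r, and \<kappa> can be -1 only for odd
  N.\<close>

definition app :: "'j set \<Rightarrow> ('i, 'j) cmat \<Rightarrow> ('j \<Rightarrow> complex) \<Rightarrow> 'i \<Rightarrow> complex" where
  "app J A w = (\<lambda>i. \<Sum>j\<in>J. A i j * w j)"

lemma app_cong:
  assumes "\<And>j. j \<in> J \<Longrightarrow> w j = w' j"
  shows "app J A w = app J A w'"
  using assms by (auto simp: app_def intro!: ext sum.cong)

lemma app_mul: "app K (mat_mul J A B) w = app J A (app K B w)"
  unfolding app_def mat_mul_def sum_distrib_left sum_distrib_right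
  by (subst sum.swap) (simp add: mult.assoc)

lemma app_one: "finite I \<Longrightarrow> i \<in> I \<Longrightarrow> app I (mat_one I) w i = w i"
  by (simp add: app_def mat_one_def mat_of_def of_bool_def if_distrib[where f = "\<lambda>x. x * _"] cong: if_cong)

lemma app_add: "app J (mat_add A B) w i = app J A w i + app J B w i"
  by (simp add: app_def mat_add_def sum.distrib algebra_simps)

lemma app_scale: "app J (mat_scale c A) w i = c * app J A w i"
  by (simp add: app_def mat_scale_def sum_distrib_left algebra_simps)

lemma app_lin: "app J A (\<lambda>j. a * w j + b * w' j) i = a * app J A w i + b * app J A w' i"
  by (simp add: app_def sum_distrib_left sum.distrib algebra_simps)

lemma app_sum: "app J A (\<lambda>j. \<Sum>k\<in>K. w k j) i = (\<Sum>k\<in>K. app J A (w k) i)"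
  unfolding app_def sum_distrib_left by (rule sum.swap)

lemma app_smult: "app J A (\<lambda>j. a * w j) i = a * app J A w i"
  by (simp add: app_def sum_distrib_left algebra_simps)

lemma app_zero: "app J A (\<lambda>_. 0) i = 0"
  by (simp add: app_def)

text \<open>Indicator functions of single columns recover the entries. Identities of diagrams are
  therefore checked as identities of finite sums in an arbitrary argument \<open>w\<close>.\<close>

lemma mat_eqI:
  assumes "A \<in> mats I J" "B \<in> mats I J" "finite J"
    and "\<And>w i. i \<in> I \<Longrightarrow> app J A w i = app J B w i"
  shows "A = B"
proof (intro ext)
  fix i j
  show "A i j = B i j"
  proof (cases "i \<in> I \<and> j \<in> J")
    case True
    then show ?thesis
      using assms(4)[of i "\<lambda>x. of_bool (x = j)"] assms(3)
      by (simp add: app_def of_bool_def if_distrib[where f = "\<lambda>x. _ * x"] cong: if_cong)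
  next
    case False
    then show ?thesis using assms(1,2) by (auto simp: mats_def) (metis)+
  qed
qed

lemma mats_mat_of [simp]: "mat_of I J A \<in> mats I J"
  by (auto simp: mats_def mat_of_def)

lemma mats_one [simp]: "mat_one I \<in> mats I I"
  by (simp add: mat_one_def)

lemma mats_mul: "A \<in> mats I J \<Longrightarrow> B \<in> mats J K \<Longrightarrow> mat_mul J A B \<in> mats I K"
  unfolding mats_def mat_mul_def by (fastforce dest!: sum.not_neutral_contains_not_neutral)

lemma mats_add: "A \<in> mats I J \<Longrightarrow> B \<in> mats I J \<Longrightarrow> mat_add A B \<in> mats I J"
  unfolding mats_def mat_add_def by (auto, (metis add.right_neutral)+)

lemma mats_scale: "A \<in> mats I J \<Longrightarrow> mat_scale c A \<in> mats I J"
  unfolding mats_def mat_scale_def by fastforce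

lemma mats_zero: "(\<lambda>_ _. 0) \<in> mats I J"
  by (simp add: mats_def)

lemma mat_mul_assoc: "mat_mul K (mat_mul J A B) C = mat_mul J A (mat_mul K B C)"
  unfolding mat_mul_def sum_distrib_left sum_distrib_right
  by (intro ext, subst sum.swap) (simp add: mult.assoc)

lemma mat_mul_one_left:
  assumes "finite I" "A \<in> mats I J"
  shows "mat_mul I (mat_one I) A = A"
proof (intro ext)
  fix i j
  show "mat_mul I (mat_one I) A i j = A i j"
    using assms by (cases "i \<in> I") (auto simp: mat_mul_def mat_one_def mat_of_def mats_def
      if_distrib[where f = "\<lambda>x. x * _"] of_bool_def cong: if_cong)
qed

lemma mat_mul_one_right:
  assumes "finite J" "A \<in> mats I J"
  shows "mat_mul J A (mat_one J) = A"
proof (intro ext)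
  fix i j
  have "mat_mul J A (mat_one J) i j = (if j \<in> J then \<Sum>k\<in>J. if k = j then A i k else 0 else 0)"
    by (auto simp: mat_mul_def mat_one_def mat_of_def intro!: sum.cong)
  then show "mat_mul J A (mat_one J) i j = A i j"
    using assms by (auto simp: mats_def)
qed

lemma mat_mul_add_left: "mat_mul J (mat_add A B) C = mat_add (mat_mul J A C) (mat_mul J B C)"
  by (simp add: mat_mul_def mat_add_def sum.distrib algebra_simps)

lemma mat_mul_add_right: "mat_mul J C (mat_add A B) = mat_add (mat_mul J C A) (mat_mul J C B)"
  by (simp add: mat_mul_def mat_add_def sum.distrib algebra_simps)

lemma mat_mul_scale_left: "mat_mul J (mat_scale c A) B = mat_scale c (mat_mul J A B)"
  by (simp add: mat_mul_def mat_scale_def sum_distrib_left algebra_simps)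

lemma mat_mul_scale_right: "mat_mul J A (mat_scale c B) = mat_scale c (mat_mul J A B)"
  by (simp add: mat_mul_def mat_scale_def sum_distrib_left algebra_simps)

section \<open>Tuples as indices, and the Kronecker product\<close>

lemma length_listset: "u \<in> listset Is \<Longrightarrow> length u = length Is"
  by (induction Is arbitrary: u) (auto simp: set_Cons_def)

lemma finite_listset: "(\<And>I. I \<in> set Is \<Longrightarrow> finite I) \<Longrightarrow> finite (listset Is)"
proof (induction Is)
  case (Cons I Is)
  have "listset (I # Is) = (\<lambda>(x, xs). x # xs) ` (I \<times> listset Is)"
    by (auto simp: set_Cons_def)
  then show ?case using Cons by simp
qed simp

lemma Cons_listset [simp]: "a # u \<in> listset (I # Is) \<longleftrightarrow> a \<in> I \<and> u \<in> listset Is"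
  by (auto simp: set_Cons_def)

lemma append_in_listset:
  "length u = length Is \<Longrightarrow> u @ v \<in> listset (Is @ Js) \<longleftrightarrow> u \<in> listset Is \<and> v \<in> listset Js"
proof (induction Is arbitrary: u)
  case (Cons I Is)
  then show ?case by (cases u) (auto simp del: listset.simps simp: listset.simps(1))
qed auto

lemma listset_append_take_drop:
  assumes "u \<in> listset (Is @ Js)"
  shows "take (length Is) u \<in> listset Is" "drop (length Is) u \<in> listset Js"
proof -
  have "length (take (length Is) u) = length Is"
    using length_listset[OF assms] by simp
  then show "take (length Is) u \<in> listset Is" "drop (length Is) u \<in> listset Js"
    using append_in_listset[of "take (length Is) u" Is "drop (length Is) u" Js] assms by auto
qed

lemma sum_listset_Cons: "(\<Sum>u\<in>listset (I # Is). F u) = (\<Sum>a\<in>I. \<Sum>u\<in>listset Is. F (a # u))"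
proof -
  have "(\<Sum>u\<in>listset (I # Is). F u) = (\<Sum>(a, u)\<in>I \<times> listset Is. F (a # u))"
    by (rule sum.reindex_bij_witness[of _ "\<lambda>(a, u). a # u" "\<lambda>u. (hd u, tl u)"])
      (auto simp: set_Cons_def)
  then show ?thesis by (simp add: sum.cartesian_product)
qed

lemma sum_listset_append:
  "(\<Sum>u\<in>listset (Is @ Js). F u) = (\<Sum>u\<in>listset Is. \<Sum>v\<in>listset Js. F (u @ v))"
  by (induction Is arbitrary: F)
    (simp_all only: append_Nil append_Cons sum_listset_Cons listset.simps(1) finite.emptyI
      finite.insertI sum.insert sum.empty empty_iff, simp_all)

text \<open>A Kronecker product acts one factor at a time: \<open>B\<close> on the tail of the index
  with its head frozen, then \<open>A\<close> on the head. Iterated, this evaluates a string diagram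
  strand by strand.\<close>

lemma app_tensor:
  assumes "length Is = q"
  shows "app (listset (Is @ Js)) (mat_tensor p q A B) w u =
    app (listset Is) A (\<lambda>x. app (listset Js) B (\<lambda>y. w (x @ y)) (drop p u)) (take p u)"
  using assms unfolding app_def sum_listset_append mat_tensor_def sum_distrib_left
  by (intro sum.cong refl) (auto dest: length_listset)

lemma mats_tensor:
  assumes "A \<in> mats (listset Is) (listset Js)" "B \<in> mats (listset Is') (listset Js')"
    and "length Is = p" "length Js = q"
  shows "mat_tensor p q A B \<in> mats (listset (Is @ Is')) (listset (Js @ Js'))"
proof -
  have *: "i \<in> listset (Ks @ Ks')" if "take r i \<in> listset Ks" "drop r i \<in> listset Ks'"
    for i r and Ks Ks' :: "'a set list"
    using append_in_listset[of "take r i" Ks "drop r i" Ks'] that length_listset[OF that(1)] by simp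
  show ?thesis using assms by (auto simp: mats_def mat_tensor_def intro!: *)
qed

lemma mat_tensor_assoc:
  "mat_tensor (p + p') (q + q') (mat_tensor p q A B) C = mat_tensor p q A (mat_tensor p' q' B C)"
  by (simp add: mat_tensor_def drop_take min_def add.commute mult.assoc)

lemma mat_tensor_unit_left: "mat_tensor 0 0 (mat_one {[]}) A = A"
  by (simp add: mat_tensor_def mat_one_def mat_of_def)

lemma mat_tensor_unit_right:
  assumes "A \<in> mats (listset Is) (listset Js)"
  shows "mat_tensor (length Is) (length Js) A (mat_one {[]}) = A"
proof (intro ext)
  fix i j
  show "mat_tensor (length Is) (length Js) A (mat_one {[]}) i j = A i j"
  proof (cases "A i j = 0")
    case True
    then show ?thesis by (auto simp: mat_tensor_def mat_one_def mat_of_def)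
  next
    case False
    then have "length i = length Is" "length j = length Js"
      using assms by (auto simp: mats_def dest: length_listset)
    then show ?thesis by (simp add: mat_tensor_def mat_one_def mat_of_def)
  qed
qed

lemma mat_tensor_one:
  "mat_tensor (length Is) (length Is) (mat_one (listset Is)) (mat_one (listset Js)) =
   mat_one (listset (Is @ Js))"
proof -
  have *: "i \<in> listset (Is @ Js) \<longleftrightarrow> take (length Is) i \<in> listset Is \<and> drop (length Is) i \<in> listset Js" for i
    using listset_append_take_drop[of i Is Js] append_in_listset[of "take (length Is) i" Is "drop (length Is) i" Js]
      length_listset[of "take (length Is) i" Is] by (metis append_take_drop_id)
  show ?thesis
  proof (intro ext)
    fix i j :: "'a list"
    have "i = j \<longleftrightarrow> take (length Is) i = take (length Is) j \<and> drop (length Is) i = drop (length Is) j"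
      by (metis append_take_drop_id)
    then show "mat_tensor (length Is) (length Is) (mat_one (listset Is)) (mat_one (listset Js)) i j =
        mat_one (listset (Is @ Js)) i j"
      unfolding mat_tensor_def mat_one_def mat_of_def * by (cases "i = j") auto
  qed
qed

lemma mat_tensor_mul:
  assumes "length Is = q"
  shows "mat_mul (listset (Is @ Js)) (mat_tensor p q A B) (mat_tensor q r C D) =
    mat_tensor p r (mat_mul (listset Is) A C) (mat_mul (listset Js) B D)"
  using assms unfolding mat_mul_def sum_listset_append mat_tensor_def sum_product
  by (intro ext sum.cong refl) (auto dest: length_listset)

section \<open>The free algebra\<close>

abbreviation free_mult (infixl \<open>\<star>\<close> 70) where
  "f \<star> g \<equiv> f \<otimes>\<^bsub>free_algebra\<^esub> g"

lemma finite_support_mult: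
  fixes f g :: "'v list \<Rightarrow> complex"
  assumes "finite {w. f w \<noteq> 0}" "finite {w. g w \<noteq> 0}"
  shows "finite {w. (\<Sum>k\<le>length w. f (take k w) * g (drop k w)) \<noteq> 0}"
proof (rule finite_subset)
  show "{w. (\<Sum>k\<le>length w. f (take k w) * g (drop k w)) \<noteq> 0} \<subseteq>
    (\<lambda>(x, y). x @ y) ` ({w. f w \<noteq> 0} \<times> {w. g w \<noteq> 0})"
  proof safe
    fix w assume "(\<Sum>k\<le>length w. f (take k w) * g (drop k w)) \<noteq> 0"
    then obtain k where "f (take k w) * g (drop k w) \<noteq> 0"
      by (meson sum.not_neutral_contains_not_neutral)
    then show "w \<in> (\<lambda>(x, y). x @ y) ` ({w. f w \<noteq> 0} \<times> {w. g w \<noteq> 0})"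
      by (intro image_eqI[of _ _ "(take k w, drop k w)"]) auto
  qed
qed (use assms in simp)

lemma free_algebra_simps:
  "carrier free_algebra = {f. finite {w. f w \<noteq> 0}}"
  "f \<star> g = (\<lambda>w. \<Sum>k\<le>length w. f (take k w) * g (drop k w))"
  "f \<oplus>\<^bsub>free_algebra\<^esub> g = (\<lambda>w. f w + g w)"
  "\<one>\<^bsub>free_algebra\<^esub> = (\<lambda>w. of_bool (w = []))"
  "\<zero>\<^bsub>free_algebra\<^esub> = (\<lambda>w. 0)"
  by (simp_all add: free_algebra_def)

text \<open>Both sides sum over the ways to cut a word into three pieces; cut positions
  \<open>l \<le> k\<close> correspond to the lengths \<open>l\<close> and \<open>k - l\<close> of
  the first two pieces.\<close>

lemma free_algebra_assoc:
  fixes f g h :: "'v list \<Rightarrow> complex"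
  shows "(f \<star> g) \<star> h = f \<star> (g \<star> h)"
proof (rule ext)
  fix w :: "'v list"
  let ?S = "Sigma {..length w} (\<lambda>k. {..k})"
  let ?T = "Sigma {..length w} (\<lambda>l. {..length w - l})"
  have "((f \<star> g) \<star> h) w =
    (\<Sum>(k, l)\<in>?S. f (take l w) * g (take (k - l) (drop l w)) * h (drop k w))"
    unfolding free_algebra_simps sum_distrib_right
    by (subst sum.Sigma[symmetric]) (auto intro!: sum.cong simp: min_def drop_take)
  also have "\<dots> = (\<Sum>(l, j)\<in>?T. f (take l w) * g (take j (drop l w)) * h (drop (l + j) w))"
    by (rule sum.reindex_bij_witness[of _ "\<lambda>(l, j). (l + j, l)" "\<lambda>(k, l). (l, k - l)"]) auto
  also have "\<dots> = (f \<star> (g \<star> h)) w"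
    by (simp add: free_algebra_simps sum_distrib_left sum.Sigma[symmetric] ac_simps)
  finally show "((f \<star> g) \<star> h) w = (f \<star> (g \<star> h)) w" .
qed

lemma finite_support_add:
  "finite {w. f w \<noteq> (0::complex)} \<Longrightarrow> finite {w. g w \<noteq> 0} \<Longrightarrow> finite {w. f w + g w \<noteq> 0}"
  by (rule finite_subset[of _ "{w. f w \<noteq> 0} \<union> {w. g w \<noteq> 0}"]) auto

lemma ring_free_algebra: "ring (free_algebra :: ('v list \<Rightarrow> complex) ring)"
proof (intro ringI abelian_groupI monoidI)
  fix f g h :: "'v list \<Rightarrow> complex"
  show "(f \<oplus>\<^bsub>free_algebra\<^esub> g) \<star> h = f \<star> h \<oplus>\<^bsub>free_algebra\<^esub> g \<star> h"
    "h \<star> (f \<oplus>\<^bsub>free_algebra\<^esub> g) = h \<star> f \<oplus>\<^bsub>free_algebra\<^esub> h \<star> g"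
    by (simp_all add: free_algebra_simps sum.distrib algebra_simps)
  show "\<one>\<^bsub>free_algebra\<^esub> \<star> f = f"
  proof
    fix w :: "'v list"
    have "(\<one>\<^bsub>free_algebra\<^esub> \<star> f) w = (\<Sum>k\<le>length w. if k = 0 then f w else 0)"
      unfolding free_algebra_simps by (intro sum.cong refl) auto
    then show "(\<one>\<^bsub>free_algebra\<^esub> \<star> f) w = f w" by simp
  qed
  show "f \<star> \<one>\<^bsub>free_algebra\<^esub> = f"
  proof
    fix w :: "'v list"
    have "(f \<star> \<one>\<^bsub>free_algebra\<^esub>) w = (\<Sum>k\<le>length w. if k = length w then f w else 0)"
      unfolding free_algebra_simps by (intro sum.cong refl) auto
    then show "(f \<star> \<one>\<^bsub>free_algebra\<^esub>) w = f w" by simp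
  qed
  assume "f \<in> carrier free_algebra"
  then show "\<exists>g\<in>carrier free_algebra. g \<oplus>\<^bsub>free_algebra\<^esub> f = \<zero>\<^bsub>free_algebra\<^esub>"
    by (intro bexI[of _ "\<lambda>w. - f w"]) (simp_all add: free_algebra_simps)
next
  fix f g h :: "'v list \<Rightarrow> complex"
  show "(f \<star> g) \<star> h = f \<star> (g \<star> h)"
    by (rule free_algebra_assoc)
qed (auto simp: free_algebra_simps finite_support_mult finite_support_add algebra_simps)

lemma monomial_in_carrier [simp]: "monomial w \<in> carrier free_algebra"
  by (simp add: free_algebra_simps monomial_def)

lemma scaled_in_carrier: "f \<in> carrier free_algebra \<Longrightarrow> (\<lambda>u. c * f u) \<in> carrier free_algebra"
  unfolding free_algebra_simps by (auto elim!: rev_finite_subset)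

lemma scalar_mult_free:
  "(\<lambda>u. c * monomial [] u) \<star> f = (\<lambda>u. c * f u)"
proof
  fix w :: "'a list"
  have "((\<lambda>u. c * monomial [] u) \<star> f) w = (\<Sum>k\<le>length w. if k = 0 then c * f w else 0)"
    unfolding free_algebra_simps monomial_def by (intro sum.cong refl) auto
  then show "((\<lambda>u. c * monomial [] u) \<star> f) w = c * f w" by simp
qed

lemma monomial_mult: "monomial x \<star> monomial y = monomial (x @ y)"
proof
  fix w :: "'a list"
  have *: "take k w = x \<and> drop k w = y \<longleftrightarrow> k = length x \<and> w = x @ y" if "k \<le> length w" for k
    using that by (metis append_eq_conv_conj append_take_drop_id length_take min.absorb2)
  have "of_bool (take k w = x) * of_bool (drop k w = y) =
      (if k = length x then of_bool (w = x @ y) else (0 :: complex))" if "k \<le> length w" for k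
    unfolding of_bool_conj[symmetric] *[OF that] by simp
  then have "(monomial x \<star> monomial y) w =
     (\<Sum>k\<le>length w. if k = length x then of_bool (w = x @ y) else 0)"
    unfolding free_algebra_simps monomial_def by (intro sum.cong refl) (rule, simp)
  also have "\<dots> = monomial (x @ y) w"
    by (auto simp: monomial_def)
  finally show "(monomial x \<star> monomial y) w = monomial (x @ y) w" .
qed

text \<open>Reading a word backwards exchanges the two pieces of each cut. This is the
  antiautomorphism \<iota> before passing to the quotient.\<close>

lemma free_mult_rev:
  "(f \<star> g) \<circ> rev = (g \<circ> rev) \<star> (f \<circ> rev)"
proof
  fix w :: "'a list"
  have "((f \<star> g) \<circ> rev) w =
    (\<Sum>k\<le>length w. f (rev (drop (length w - k) w)) * g (rev (take (length w - k) w)))"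
    by (simp add: free_algebra_simps take_rev drop_rev)
  also have "\<dots> = (\<Sum>k\<le>length w. f (rev (drop k w)) * g (rev (take k w)))"
    by (rule sum.reindex_bij_witness[of _ "\<lambda>k. length w - k" "\<lambda>k. length w - k"]) auto
  finally show "((f \<star> g) \<circ> rev) w = ((g \<circ> rev) \<star> (f \<circ> rev)) w"
    by (simp add: free_algebra_simps mult.commute)
qed

lemma rev_in_carrier: "f \<in> carrier free_algebra \<Longrightarrow> f \<circ> rev \<in> carrier free_algebra"
proof -
  assume "f \<in> carrier free_algebra"
  moreover have "{w. f (rev w) \<noteq> 0} = rev ` {w. f w \<noteq> 0}"
    by (auto intro!: image_eqI[of _ rev "rev _"])
  ultimately show ?thesis by (simp add: free_algebra_simps)
qed

lemma free_algebra_minus: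
  assumes "f \<in> carrier free_algebra"
  shows "\<ominus>\<^bsub>free_algebra\<^esub> f = (\<lambda>w. - f w)"
proof -
  interpret ring "free_algebra :: ('a list \<Rightarrow> complex) ring" by (rule ring_free_algebra)
  show ?thesis
    by (rule minus_equality) (use assms in \<open>simp_all add: free_algebra_simps\<close>)
qed

section \<open>The gamma matrices\<close>

declare One_nat_def [simp del]

definition flip :: "'a set \<Rightarrow> 'a set \<Rightarrow> 'a set" where
  "flip F I = (I - F) \<union> (F - I)"

text \<open>For fixed \<open>A\<close> a character of the group of finite sets under symmetric
  difference; the signs in the gamma matrices are values of such characters.\<close>

definition par :: "'a set \<Rightarrow> 'a set \<Rightarrow> complex" where
  "par A I = (-1) ^ card (I \<inter> A)"

lemma par_flip_single:
  assumes "finite I"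
  shows "par A (flip {j} I) = (if j \<in> A then - par A I else par A I)"
proof (cases "j \<in> A")
  case True
  have "flip {j} I \<inter> A = (if j \<in> I then I \<inter> A - {j} else insert j (I \<inter> A))"
    using True by (auto simp: flip_def)
  moreover have "card (I \<inter> A) = Suc (card (I \<inter> A - {j}))" if "j \<in> I"
    using that True assms by (subst card_Suc_Diff1) auto
  then have "par A I = - ((-1) ^ card (I \<inter> A - {j}))" if "j \<in> I"
    using that by (simp add: par_def)
  ultimately show ?thesis using True assms by (auto simp: par_def)
next
  case False
  then have "flip {j} I \<inter> A = I \<inter> A" by (auto simp: flip_def)
  then show ?thesis using False by (simp add: par_def)
qed

lemma par_square: "par A I * par A I = 1"
  by (simp add: par_def flip: power_mult_distrib)

lemma flip_flip [simp]: "flip F (flip F I) = I"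
  by (auto simp: flip_def)

lemma flip_commute: "flip F (flip G I) = flip G (flip F I)"
  by (auto simp: flip_def)

lemma flip_empty [simp]: "flip {} I = I"
  by (auto simp: flip_def)

lemma sum_pairs: "(\<Sum>k=1..2 * m. F k) = (\<Sum>j=1..m. F (2 * j - 1) + F (2 * j))"
  for F :: "nat \<Rightarrow> 'a::comm_monoid_add"
  by (induction m) (simp_all add: ac_simps)

section \<open>The Jordan-Wigner model of the spin module\<close>

locale spin_setup = quadratic_space scale \<Phi> + spin_data scale \<Phi> N e \<epsilon>
  for scale :: "complex \<Rightarrow> 'v::ab_group_add \<Rightarrow> 'v"
    and \<Phi> :: "'v \<Rightarrow> 'v \<Rightarrow> complex"
    and N :: nat
    and e :: "nat \<Rightarrow> 'v"
    and \<epsilon> :: complex +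
  assumes orthonormal: "orthonormal_basis N e"
    and eps: "\<epsilon> \<in> {1, -1}"
begin

definition P :: "nat set set" where "P = Pow {1..n}"

text \<open>\<open>e (2 * j - 1)\<close> and \<open>e (2 * j)\<close> both toggle the element
  \<open>j\<close>; for odd \<open>N\<close> the last vector toggles nothing.\<close>

definition fl :: "nat \<Rightarrow> nat set" where
  "fl k = (if k \<le> 2 * n then {(k + 1) div 2} else {})"

text \<open>The phases come from \<open>e (2 * j - 1) = \<psi>_dag j + \<psi> j\<close> and
  \<open>e (2 * j) = \<i> (\<psi>_dag j - \<psi> j)\<close>. The set \<open>{..j}\<close> in place
  of \<open>{..<j}\<close> records the minus sign of the annihilation part, which acts when
  \<open>j\<close> is present.\<close>

definition cf :: "nat \<Rightarrow> nat set \<Rightarrow> complex" where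
  "cf k I = (if 2 * n < k then \<epsilon> * par UNIV I
     else if odd k then par {..<(k + 1) div 2} I else \<i> * par {..(k + 1) div 2} I)"

text \<open>The Jordan--Wigner form of the action of \<open>e k\<close>: each basis vector is mapped to a multiple of a
  basis vector.\<close>

definition gam :: "nat \<Rightarrow> (nat set, nat set) cmat" where
  "gam k = (\<lambda>J I. if I \<in> P \<and> J = flip (fl k) I then cf k I else 0)"

lemma finite_P [simp]: "finite P" "I \<in> P \<Longrightarrow> finite I"
  by (auto simp: P_def intro: finite_subset)

lemma P_empty [simp]: "{} \<in> P"
  by (simp add: P_def)

lemma in_P_iff: "I \<in> P \<longleftrightarrow> I \<subseteq> {1..n}"
  by (simp add: P_def)

lemma two_n: "2 * n = (if odd N then N - 1 else N)"
  by presburger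

lemma fl_subset: "k \<in> {1..N} \<Longrightarrow> fl k \<subseteq> {1..n}"
  by (auto simp: fl_def)

lemma flip_fl_in [simp]: "k \<in> {1..N} \<Longrightarrow> flip (fl k) I \<in> P \<longleftrightarrow> I \<in> P"
  using fl_subset[of k] by (auto simp: flip_def in_P_iff)

text \<open>The phase of \<open>e k\<close> notices a toggle by \<open>e l\<close> exactly for
  \<open>l < k\<close>. So of two distinct generators exactly one changes the phase of the other,
  which is anticommutation.\<close>

lemma cf_flip:
  assumes "I \<in> P" "k \<in> {1..N}" "l \<in> {1..N}" "k \<noteq> l"
  shows "cf k (flip (fl l) I) = (if l < k then - cf k I else cf k I)"
proof (cases "l \<le> 2 * n")
  case True
  then have fl: "fl l = {(l + 1) div 2}" by (simp add: fl_def)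
  have I: "finite I" using assms(1) by simp
  consider "2 * n < k" | "k \<le> 2 * n" "odd k" | "k \<le> 2 * n" "even k" by linarith
  then show ?thesis
  proof cases
    case 2
    then have "(l + 1) div 2 < (k + 1) div 2 \<longleftrightarrow> l < k" using assms(4) by presburger
    then show ?thesis using 2 by (simp add: cf_def fl par_flip_single[OF I])
  next
    case 3
    then have "(l + 1) div 2 \<le> (k + 1) div 2 \<longleftrightarrow> l < k" using assms(4) by presburger
    then show ?thesis using 3 by (simp add: cf_def fl par_flip_single[OF I])
  qed (use True in \<open>auto simp: cf_def fl par_flip_single[OF I]\<close>)
next
  case False
  then have "l = N" using assms two_n by (auto split: if_splits)
  then show ?thesis using False assms by (auto simp: fl_def)
qed

text \<open>For odd \<open>k \<le> 2 * n\<close> the toggled element lies outside the counted set;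
  for even \<open>k\<close> the toggle gives -1, which \<open>\<i> * \<i>\<close> cancels.\<close>

lemma cf_square:
  assumes "I \<in> P" "k \<in> {1..N}"
  shows "cf k (flip (fl k) I) * cf k I = 1"
proof -
  have I: "finite I" using assms(1) by simp
  have "\<epsilon> * \<epsilon> = 1" using eps by auto
  then have "\<epsilon> * par UNIV I * (\<epsilon> * par UNIV I) = 1"
    by (metis mult.assoc mult.left_commute mult.right_neutral par_square)
  moreover have "- (\<i> * par A I) * (\<i> * par A I) = 1" for A
    using par_square[of A I] by (simp add: algebra_simps)
  ultimately show ?thesis
    by (auto simp: cf_def fl_def par_flip_single[OF I] par_square)
qed

lemma gam_mats: "k \<in> {1..N} \<Longrightarrow> gam k \<in> mats P P"
  by (auto simp: gam_def mats_def split: if_splits)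

lemma app_gam:
  assumes "k \<in> {1..N}"
  shows "(\<Sum>K\<in>P. gam k J K * F K) = (if J \<in> P then cf k (flip (fl k) J) * F (flip (fl k) J) else 0)"
proof -
  have "(\<Sum>K\<in>P. gam k J K * F K) =
    (\<Sum>K\<in>P. if K = flip (fl k) J then cf k (flip (fl k) J) * F (flip (fl k) J) else 0)"
    by (intro sum.cong refl) (auto simp: gam_def)
  then show ?thesis using assms by simp
qed

lemma app_gam_col:
  assumes "k \<in> {1..N}"
  shows "(\<Sum>K\<in>P. F K * gam k K I) = (if I \<in> P then F (flip (fl k) I) * cf k I else 0)"
proof -
  have "(\<Sum>K\<in>P. F K * gam k K I) =
    (\<Sum>K\<in>P. if K = flip (fl k) I then (if I \<in> P then F (flip (fl k) I) * cf k I else 0) else 0)"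
    by (intro sum.cong refl) (auto simp: gam_def)
  then show ?thesis using assms by simp
qed

lemma gam_mul:
  assumes "k \<in> {1..N}" "l \<in> {1..N}"
  shows "mat_mul P (gam k) (gam l) J I =
    (if I \<in> P \<and> J = flip (fl k) (flip (fl l) I) then cf k (flip (fl l) I) * cf l I else 0)"
  unfolding mat_mul_def app_gam_col[OF assms(2)] using assms
  by (auto simp: gam_def)

lemma gam_square: "k \<in> {1..N} \<Longrightarrow> mat_mul P (gam k) (gam k) = mat_one P"
  by (intro ext) (auto simp: gam_mul cf_square mat_one_def mat_of_def)

lemma gam_anticommute:
  assumes "k \<in> {1..N}" "l \<in> {1..N}" "k \<noteq> l"
  shows "mat_mul P (gam k) (gam l) = mat_scale (-1) (mat_mul P (gam l) (gam k))"
  using assms by (intro ext) (auto simp: gam_mul cf_flip flip_commute mat_scale_def)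

subsection \<open>Orthonormal expansion\<close>

lemma form_add_right: "\<Phi> w (u + v) = \<Phi> w u + \<Phi> w v"
  by (metis form_add_left form_symmetric)

lemma form_scale_right: "\<Phi> w (scale c v) = c * \<Phi> w v"
  by (metis form_scale_left form_symmetric)

lemma form_zero_left [simp]: "\<Phi> 0 w = 0"
  using form_add_left[of 0 0 w] by simp

lemma form_diff_left: "\<Phi> (u - v) w = \<Phi> u w - \<Phi> v w"
  using form_add_left[of "u - v" v w] by simp

lemma form_diff_right: "\<Phi> w (u - v) = \<Phi> w u - \<Phi> w v"
  by (metis form_diff_left form_symmetric)

lemma form_sum_left: "\<Phi> (\<Sum>i\<in>A. f i) w = (\<Sum>i\<in>A. \<Phi> (f i) w)"
  by (induction A rule: infinite_finite_induct) (auto simp: form_add_left)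

lemma form_e: "i \<in> {1..N} \<Longrightarrow> j \<in> {1..N} \<Longrightarrow> \<Phi> (e i) (e j) = of_bool (i = j)"
  using orthonormal unfolding orthonormal_basis_def by blast

lemma eq_zero_if_orthogonal:
  assumes "\<And>k. k \<in> {1..N} \<Longrightarrow> \<Phi> (e k) u = 0"
  shows "u = 0"
proof (rule form_nondegenerate)
  fix w
  have "w \<in> span (e ` {1..N})"
    using orthonormal unfolding orthonormal_basis_def by auto
  then show "\<Phi> u w = 0"
  proof (induction rule: span_induct_alt)
    case base
    then show ?case by (metis form_symmetric form_zero_left)
  next
    case (step c x y)
    then show ?case using assms by (auto simp: form_add_right form_scale_right form_symmetric)
  qed
qed

lemma expand: "v = (\<Sum>k=1..N. scale (\<Phi> (e k) v) (e k))"
proof -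
  have "v - (\<Sum>k=1..N. scale (\<Phi> (e k) v) (e k)) = 0"
  proof (rule eq_zero_if_orthogonal)
    fix k assume k: "k \<in> {1..N}"
    have "\<Phi> (\<Sum>l=1..N. scale (\<Phi> (e l) v) (e l)) (e k) = (\<Sum>l=1..N. if l = k then \<Phi> (e k) v else 0)"
      unfolding form_sum_left using k by (intro sum.cong refl) (auto simp: form_scale_left form_e)
    then have "\<Phi> (e k) (\<Sum>l=1..N. scale (\<Phi> (e l) v) (e l)) = \<Phi> (e k) v"
      using k by (simp add: form_symmetric)
    then show "\<Phi> (e k) (v - (\<Sum>k=1..N. scale (\<Phi> (e k) v) (e k))) = 0"
      by (simp add: form_diff_right)
  qed
  then show ?thesis by simp
qed

lemma parseval: "\<Phi> v w = (\<Sum>k=1..N. \<Phi> (e k) v * \<Phi> (e k) w)"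
  by (subst expand[of v]) (simp add: form_sum_left form_scale_left)

lemma gam_odd_even:
  assumes "j \<in> {1..n}" "I \<in> P" "J \<in> P"
  shows "gam (2 * j - 1) J I = annihilation j J I + creation j J I"
    and "gam (2 * j) J I = \<i> * (creation j J I - annihilation j J I)"
proof -
  have fl: "fl (2 * j - 1) = {j}" "fl (2 * j) = {j}" using assms(1) by (auto simp: fl_def)
  have I: "finite I" using assms(2) by simp
  have p: "par {..<j} I = (-1) ^ card {i \<in> I. i < j}"
    by (simp add: par_def Int_def lessThan_def)
  have q: "par {..j} I = (if j \<in> I then - ((-1) ^ card {i \<in> I. i < j}) else (-1) ^ card {i \<in> I. i < j})"
  proof -
    have "I \<inter> {..j} = (if j \<in> I then insert j {i \<in> I. i < j} else {i \<in> I. i < j})"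
      by (auto simp: le_less)
    then show ?thesis using I by (simp add: par_def)
  qed
  have c: "cf (2 * j - 1) I = par {..<j} I" "cf (2 * j) I = \<i> * par {..j} I"
    using assms(1) by (auto simp: cf_def)
  have f: "flip {j} I = (if j \<in> I then I - {j} else insert j I)"
    by (auto simp: flip_def)
  show "gam (2 * j - 1) J I = annihilation j J I + creation j J I"
    "gam (2 * j) J I = \<i> * (creation j J I - annihilation j J I)"
    unfolding gam_def fl c p q f annihilation_def creation_def using assms(2) by auto
qed

lemma form_psi:
  "2 * \<Phi> (\<psi>_dag j) v = \<Phi> (e (2 * j - 1)) v - \<i> * \<Phi> (e (2 * j)) v"
  "2 * \<Phi> (\<psi> j) v = \<Phi> (e (2 * j - 1)) v + \<i> * \<Phi> (e (2 * j)) v"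
  by (simp_all add: \<psi>_dag_def \<psi>_def form_scale_left form_add_left form_diff_left)

text \<open>Grouping the sum into pairs \<open>2 * j - 1\<close>, \<open>2 * j\<close> passes
  between isotropic and orthonormal coordinates; for odd \<open>N\<close> the leftover term at
  \<open>N\<close> is the parity operator.\<close>

lemma spin_vec_expand: "spin_vec v J I = (\<Sum>k=1..N. \<Phi> (e k) v * gam k J I)"
proof (cases "I \<in> P \<and> J \<in> P")
  case True
  define R where "R = (if odd N then \<Phi> (e N) v * gam N J I else 0)"
  have "(\<Sum>k=1..N. \<Phi> (e k) v * gam k J I) = (\<Sum>k=1..2 * n. \<Phi> (e k) v * gam k J I) + R"
  proof (cases "odd N")
    case True
    then have "{1..N} = insert N {1..2 * n}" "N \<notin> {1..2 * n}" unfolding two_n by (auto elim: oddE)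
    then show ?thesis using True by (simp add: R_def add.commute)
  next
    case False
    then show ?thesis by (simp add: R_def)
  qed
  also have "(\<Sum>k=1..2 * n. \<Phi> (e k) v * gam k J I) =
    (\<Sum>j=1..n. 2 * \<Phi> (\<psi>_dag j) v * annihilation j J I + 2 * \<Phi> (\<psi> j) v * creation j J I)"
    unfolding sum_pairs
  proof (rule sum.cong[OF HOL.refl])
    fix j assume "j \<in> {1..n}"
    then show "\<Phi> (e (2 * j - 1)) v * gam (2 * j - 1) J I + \<Phi> (e (2 * j)) v * gam (2 * j) J I =
      2 * \<Phi> (\<psi>_dag j) v * annihilation j J I + 2 * \<Phi> (\<psi> j) v * creation j J I"
      using True unfolding form_psi gam_odd_even[OF \<open>j \<in> {1..n}\<close> conjunct1[OF True] conjunct2[OF True]]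
      by (simp add: algebra_simps)
  qed
  also have "R = (if odd N then \<Phi> (e N) v * parity_op J I else 0)"
  proof -
    have "gam N J I = parity_op J I" if "odd N"
      using that True two_n by (auto simp: gam_def fl_def cf_def parity_op_def par_def)
    then show ?thesis by (simp add: R_def)
  qed
  finally show ?thesis using True by (simp add: spin_vec_def mat_of_def P_def)
next
  case False
  then have "gam k J I = 0" if "k \<in> {1..N}" for k
    using gam_mats[OF that] by (auto simp: mats_def)
  then show ?thesis using False by (auto simp: spin_vec_def mat_of_def P_def)
qed

lemma spin_vec_e: "k \<in> {1..N} \<Longrightarrow> spin_vec (e k) = gam k"
proof (intro ext)
  fix J I assume k: "k \<in> {1..N}"
  have "spin_vec (e k) J I = (\<Sum>l=1..N. if l = k then gam k J I else 0)"
    unfolding spin_vec_expand using k by (intro sum.cong refl) (auto simp: form_e)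
  then show "spin_vec (e k) J I = gam k J I" using k by simp
qed

lemma spin_vec_mats: "spin_vec v \<in> mats P P"
  by (simp add: spin_vec_def P_def)

lemma spin_vec_add: "spin_vec (v + w) J I = spin_vec v J I + spin_vec w J I"
  by (simp add: spin_vec_expand form_add_right sum.distrib algebra_simps)

lemma spin_vec_scale: "spin_vec (scale c v) J I = c * spin_vec v J I"
  by (simp add: spin_vec_expand form_scale_right sum_distrib_left algebra_simps)

lemma clifford_gam:
  assumes "k \<in> {1..N}" "l \<in> {1..N}"
  shows "mat_mul P (gam k) (gam l) J I + mat_mul P (gam l) (gam k) J I = 2 * of_bool (k = l) * mat_one P J I"
proof (cases "k = l")
  case True
  then show ?thesis using gam_square[OF assms(1)] by simp
next
  case False
  then show ?thesis using gam_anticommute[OF assms False] by (simp add: mat_scale_def)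
qed

lemma spin_vec_mul:
  "mat_mul P (spin_vec v) (spin_vec w) J I =
   (\<Sum>k=1..N. \<Sum>l=1..N. \<Phi> (e k) v * \<Phi> (e l) w * mat_mul P (gam k) (gam l) J I)"
proof -
  have "mat_mul P (spin_vec v) (spin_vec w) J I =
    (\<Sum>K\<in>P. \<Sum>k=1..N. \<Sum>l=1..N. \<Phi> (e k) v * \<Phi> (e l) w * (gam k J K * gam l K I))"
    unfolding mat_mul_def spin_vec_expand sum_product by (simp add: ac_simps)
  also have "\<dots> = (\<Sum>k=1..N. \<Sum>K\<in>P. \<Sum>l=1..N. \<Phi> (e k) v * \<Phi> (e l) w * (gam k J K * gam l K I))"
    by (rule sum.swap)
  also have "\<dots> = (\<Sum>k=1..N. \<Sum>l=1..N. \<Sum>K\<in>P. \<Phi> (e k) v * \<Phi> (e l) w * (gam k J K * gam l K I))"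
    by (rule sum.cong[OF HOL.refl], rule sum.swap)
  finally show ?thesis by (simp add: mat_mul_def sum_distrib_left)
qed

lemma spin_vec_clifford:
  "mat_mul P (spin_vec v) (spin_vec w) J I + mat_mul P (spin_vec w) (spin_vec v) J I =
   2 * \<Phi> v w * mat_one P J I"
proof -
  have "mat_mul P (spin_vec w) (spin_vec v) J I =
    (\<Sum>k=1..N. \<Sum>l=1..N. \<Phi> (e k) v * \<Phi> (e l) w * mat_mul P (gam l) (gam k) J I)"
    unfolding spin_vec_mul by (subst sum.swap) (simp add: mult.commute)
  then have "mat_mul P (spin_vec v) (spin_vec w) J I + mat_mul P (spin_vec w) (spin_vec v) J I =
    (\<Sum>k=1..N. \<Sum>l=1..N. \<Phi> (e k) v * \<Phi> (e l) w *
       (mat_mul P (gam k) (gam l) J I + mat_mul P (gam l) (gam k) J I))"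
    by (simp only: spin_vec_mul[of v w] sum.distrib[symmetric] distrib_left)
  also have "\<dots> = (\<Sum>k=1..N. \<Sum>l=1..N. if l = k then \<Phi> (e k) v * \<Phi> (e k) w * 2 * mat_one P J I else 0)"
    by (intro sum.cong refl) (auto simp: clifford_gam)
  also have "\<dots> = 2 * \<Phi> v w * mat_one P J I"
    by (simp add: parseval[of v w] sum_distrib_left sum_distrib_right algebra_simps)
  finally show ?thesis .
qed

subsection \<open>The form on the spin module\<close>

text \<open>The sign of \<open>spin_form I ({1..n} - I)\<close>; in this product form its behaviour under \<open>flip\<close> and
  complements is evident.\<close>

definition bb :: "nat set \<Rightarrow> complex" where
  "bb I = (\<Prod>i\<in>I. \<kappa> * (-1) ^ (i - 1))"

lemma kappa_square [simp]: "\<kappa> * \<kappa> = 1"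
  by (simp add: \<kappa>_def flip: power_mult_distrib)

lemma kappa_sign_square [simp]: "\<kappa> * (-1) ^ i * (\<kappa> * (-1) ^ i) = 1"
  by (metis kappa_square minus_one_mult_self mult.assoc mult.left_commute mult.right_neutral)

lemma bb_square [simp]: "bb I * bb I = 1"
  unfolding bb_def prod.distrib[symmetric] by simp

lemma minus_one_power_eqI: "even (a + b) \<Longrightarrow> (-1 :: complex) ^ a = (-1) ^ b"
  by (metis even_add neg_one_even_power neg_one_odd_power)

text \<open>Adding a new maximum \<open>m\<close> to \<open>I\<close> raises the binomial
  coefficient by \<open>card I\<close> and creates \<open>m - 1 - card I\<close> inversions with the
  complement, in total \<open>m - 1\<close>. Together with \<open>n * N\<close> this is the sign of
  one factor of \<open>bb\<close>.\<close>

lemma spin_form_sign: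
  assumes "finite I" "I \<subseteq> {1..n}"
  shows "(-1) ^ ((card I choose 2) + n * N * card I +
      card {(i, j). i \<in> I \<and> j \<in> {1..n} - I \<and> i > j}) = bb I"
  using assms
proof (induction I rule: finite_linorder_max_induct)
  case empty
  have [simp]: "(0::nat) choose 2 = 0" by (simp add: numeral_2_eq_2)
  show ?case by (simp add: bb_def)
next
  case (insert m I)
  let ?S = "\<lambda>I. {(i, j). i \<in> I \<and> j \<in> {1..n} - I \<and> i > j}"
  have I: "I \<subseteq> {1..<m}" using insert by auto
  have m: "m \<notin> I" "1 \<le> m" "m \<le> n" using insert by auto
  have "?S (insert m I) = ?S I \<union> Pair m ` ({1..<m} - I)"
    using insert(2) m by (auto dest: order.strict_trans)
  moreover have "?S I \<inter> Pair m ` ({1..<m} - I) = {}" using m by auto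
  moreover have "finite (?S I)"
    by (rule finite_subset[of _ "I \<times> {1..n}"]) (use insert in auto)
  ultimately have "card (?S (insert m I)) = card (?S I) + card (Pair m ` ({1..<m} - I))"
    by (simp add: card_Un_disjoint)
  also have "card (Pair m ` ({1..<m} - I)) = m - 1 - card I"
    using I insert(1) by (simp add: card_image inj_on_def card_Diff_subset)
  finally have S: "card (?S (insert m I)) = card (?S I) + (m - 1 - card I)" .
  have le: "card I \<le> m - 1" using card_mono[OF _ I] by simp
  have c: "card (insert m I) = Suc (card I)" using insert m by simp
  have ch: "(Suc a choose 2) = (a choose 2) + a" for a :: nat
    by (simp add: numeral_2_eq_2)
  have "(-1 :: complex) ^ ((card (insert m I) choose 2) + n * N * card (insert m I) + card (?S (insert m I)))
     = (-1) ^ (((card I choose 2) + n * N * card I + card (?S I)) + (n * N + (m - 1)))"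
    unfolding S c ch using le m(2) by (intro minus_one_power_eqI) (auto simp: algebra_simps)
  also have "\<dots> = bb I * (\<kappa> * (-1) ^ (m - 1))"
    unfolding power_add[of _ _ "n * N + (m - 1)"] \<kappa>_def power_add[of _ "n * N"] using insert by simp
  also have "\<dots> = bb (insert m I)"
    using insert(1) m by (simp add: bb_def mult.commute)
  finally show ?case .
qed

lemma spin_form_eq: "I \<in> P \<Longrightarrow> spin_form I J = (if J = {1..n} - I then bb I else 0)"
  using spin_form_sign[of I] finite_P(2)[of I] by (auto simp: spin_form_def in_P_iff)

text \<open>The two products combine to the product over all of \<open>{1..n}\<close>. Its value is
  the symmetry sign of the form on the spin module, which is why the crossing of two spin strands
  carries \<open>\<sigma>\<close>.\<close>

lemma bb_complement:
  assumes "I \<in> P"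
  shows "bb I * bb ({1..n} - I) = \<sigma>"
proof -
  have "bb I * bb ({1..n} - I) = bb {1..n}"
    unfolding bb_def using assms prod.subset_diff[of I "{1..n}" "\<lambda>i. \<kappa> * (-1) ^ (i - 1)"]
    by (simp add: mult.commute in_P_iff)
  also have "\<dots> = \<kappa> ^ n * (-1) ^ (n choose 2)"
  proof -
    have "(\<Prod>i=1..m. \<kappa> * (-1) ^ (i - 1)) = \<kappa> ^ m * (-1) ^ (m choose 2)" for m
      by (induction m) (simp_all add: numeral_2_eq_2 power_add algebra_simps)
    then show ?thesis by (simp add: bb_def)
  qed
  also have "\<dots> = \<sigma>"
    unfolding \<kappa>_def \<sigma>_def power_mult[symmetric] power_add[symmetric]
    by (rule minus_one_power_eqI) auto
  finally show ?thesis .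
qed

lemma bb_flip:
  assumes "I \<in> P" "j \<in> {1..n}"
  shows "bb (flip {j} I) = \<kappa> * (-1) ^ (j - 1) * bb I"
proof (cases "j \<in> I")
  case True
  have "bb I = \<kappa> * (-1) ^ (j - 1) * bb (I - {j})"
    unfolding bb_def using True assms(1) by (subst prod.remove[of I j]) auto
  moreover have "flip {j} I = I - {j}" using True by (auto simp: flip_def)
  ultimately show ?thesis by (metis kappa_sign_square mult.assoc mult.left_neutral)
next
  case False
  moreover have "flip {j} I = insert j I" using False by (auto simp: flip_def)
  ultimately show ?thesis using assms(1) by (simp add: bb_def)
qed

lemma par_complement:
  assumes "I \<in> P"
  shows "par {..<j} ({1..n} - I) * par {..<j} I = (-1) ^ card ({1..n} \<inter> {..<j})"
proof -
  have "card ({1..n} \<inter> {..<j}) = card (({1..n} - I) \<inter> {..<j}) + card (I \<inter> {..<j})"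
    using assms by (subst card_Un_disjoint[symmetric]) (auto intro!: arg_cong[where f = card] finite_subset[of I "{1..n}"] simp: in_P_iff)
  then show ?thesis by (simp add: par_def power_add)
qed

text \<open>For \<open>k \<le> 2 * n\<close> the sign \<open>(-1) ^ (j - 1)\<close> in
  \<open>bb\<close> counts the elements below \<open>j\<close>, which are shared between
  \<open>I\<close> and its complement. For odd \<open>N\<close> and \<open>k = N\<close>, passing to
  the complement multiplies the parity by \<open>(-1) ^ n\<close>, which is
  \<open>\<kappa>\<close>.\<close>

lemma cf_bb:
  assumes I: "I \<in> P" and k: "k \<in> {1..N}"
  shows "cf k I * bb (flip (fl k) I) = \<kappa> * bb I * cf k (flip (fl k) ({1..n} - I))"
proof -
  have fin: "finite I" "finite ({1..n} - I)" using I by auto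
  let ?J = "{1..n} - I"
  show ?thesis
  proof (cases "k \<le> 2 * n")
    case True
    define j where "j = (k + 1) div 2"
    have j: "j \<in> {1..n}" using True k by (auto simp: j_def)
    have fl: "fl k = {j}" using True by (simp add: fl_def j_def)
    have *: "par {..<j} I * (-1) ^ (j - 1) = par {..<j} ?J"
    proof -
      have "{1..n} \<inter> {..<j} = {1..<j}" using j by auto
      then have "par {..<j} ?J * par {..<j} I = (-1) ^ (j - 1)"
        using par_complement[OF I, of j] by simp
      then show ?thesis
        using par_square[of "{..<j}" I] by (metis mult.assoc mult.commute mult.right_neutral)
    qed
    have le: "par {..j} A = (if j \<in> A then - par {..<j} A else par {..<j} A)" if "finite A" for A
    proof -
      have "A \<inter> {..j} = (if j \<in> A then insert j (A \<inter> {..<j}) else A \<inter> {..<j})"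
        by (auto simp: le_less)
      then show ?thesis using that by (simp add: par_def)
    qed
    have "j \<in> ?J \<longleftrightarrow> j \<notin> I" using j by auto
    then have "cf k (flip (fl k) ?J) = cf k I * (-1) ^ (j - 1)"
      using True *[symmetric] unfolding fl
      by (cases "odd k") (auto simp: cf_def j_def[symmetric] par_flip_single[OF fin(2)] le[OF fin(1)] le[OF fin(2)])
    then show ?thesis unfolding fl bb_flip[OF I j] by (simp add: algebra_simps)
  next
    case False
    then have N: "odd N" "k = N" using k two_n by (auto split: if_splits)
    have fl: "fl k = {}" using False by (simp add: fl_def)
    have "card ?J + card I = n"
      using I fin card_mono[of "{1..n}" I] by (simp add: card_Diff_subset in_P_iff)
    then have "par UNIV I = (-1) ^ n * par UNIV ?J"
      unfolding par_def by (simp flip: power_add) (rule minus_one_power_eqI, presburger)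
    moreover have "\<kappa> = (-1) ^ n"
      unfolding \<kappa>_def using N(1) by (intro minus_one_power_eqI) auto
    ultimately show ?thesis using False by (simp add: fl cf_def)
  qed
qed

text \<open>Vectors are self-adjoint up to \<open>\<kappa>\<close> for the form on the spin module.
  Both sides are monomial, and their supports agree because toggling commutes with taking
  complements.\<close>

lemma gam_adjoint:
  assumes "I \<in> P" "J \<in> P" "k \<in> {1..N}"
  shows "(\<Sum>K\<in>P. gam k K I * spin_form K J) = \<kappa> * (\<Sum>K\<in>P. spin_form I K * gam k K J)"
proof -
  have fl: "fl k \<subseteq> {1..n}" using assms(3) by (rule fl_subset)
  have "(\<Sum>K\<in>P. gam k K I * spin_form K J) = spin_form (flip (fl k) I) J * cf k I"
    using app_gam_col[OF assms(3), of "\<lambda>K. spin_form K J" I] assms(1) by (simp add: mult.commute)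
  moreover have "(\<Sum>K\<in>P. spin_form I K * gam k K J) = spin_form I (flip (fl k) J) * cf k J"
    using app_gam_col[OF assms(3), of "\<lambda>K. spin_form I K" J] assms(2) by simp
  moreover have "J = {1..n} - flip (fl k) I \<longleftrightarrow> flip (fl k) J = {1..n} - I"
    using assms fl unfolding flip_def in_P_iff by blast
  moreover have "cf k I * bb (flip (fl k) I) = \<kappa> * bb I * cf k J" if "flip (fl k) J = {1..n} - I"
    using cf_bb[OF assms(1,3)] that by (metis flip_flip)
  ultimately show ?thesis using assms by (auto simp: spin_form_eq algebra_simps)
qed

subsection \<open>Schur's lemma and traces\<close>

definition trace :: "(nat set, nat set) cmat \<Rightarrow> complex" where
  "trace A = (\<Sum>I\<in>P. A I I)"

lemma trace_one: "trace (mat_one P) = 2 ^ n"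
  by (simp add: trace_def mat_one_def mat_of_def P_def card_Pow)

lemma trace_mul_commute: "trace (mat_mul P A B) = trace (mat_mul P B A)"
  unfolding trace_def mat_mul_def by (subst sum.swap) (simp add: mult.commute)

text \<open>Commuting with all products \<open>gam (2 * j - 1) gam (2 * j)\<close>, which are diagonal with
  joint eigenspaces of dimension one, forces \<open>X\<close> to be diagonal.\<close>

lemma schur:
  assumes X: "X \<in> mats P P"
    and comm: "\<And>k. k \<in> {1..N} \<Longrightarrow> mat_mul P (gam k) X = mat_mul P X (gam k)"
  shows "X = mat_scale (X {} {}) (mat_one P)"
proof -
  have c: "cf k (flip (fl k) J) * X (flip (fl k) J) I = X J (flip (fl k) I) * cf k I"
    if "k \<in> {1..N}" "I \<in> P" "J \<in> P" for k I J
    using fun_cong[OF fun_cong[OF comm[OF that(1)], of J], of I] that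
    by (simp add: mat_mul_def app_gam app_gam_col)
  have off: "X J I = 0" if IJ: "I \<in> P" "J \<in> P" "I \<noteq> J" for I J
  proof -
    obtain j where j: "j \<in> {1..n}" "j \<in> I \<longleftrightarrow> j \<notin> J" using IJ unfolding in_P_iff by blast
    \<comment> \<open>Both generators toggle \<open>j\<close>, and their phases differ by the sign
      that tells whether \<open>j\<close> is present. As \<open>j\<close> lies in exactly one of
      \<open>I\<close> and \<open>J\<close>, the two commutation equations together equate the entry
      with its negative.\<close>
    define a b where "a = 2 * j - 1" and "b = 2 * j"
    have ab: "a \<in> {1..N}" "b \<in> {1..N}" using j by (auto simp: a_def b_def)
    have fl: "fl a = {j}" "fl b = {j}" using j by (auto simp: fl_def a_def b_def)
    have fin: "finite I" "finite J" using IJ by auto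
    have *: "cf a A = par {..<j} A" "cf b A = \<i> * par {..j} A" for A
      using j by (auto simp: cf_def a_def b_def)
    have le: "par {..j} A = (if j \<in> A then - par {..<j} A else par {..<j} A)" if "finite A" for A
    proof -
      have "A \<inter> {..j} = (if j \<in> A then insert j (A \<inter> {..<j}) else A \<inter> {..<j})"
        by (auto simp: le_less)
      then show ?thesis using that by (simp add: par_def)
    qed
    have nz: "par {..<j} A \<noteq> 0" for A by (simp add: par_def)
    have I': "flip {j} I \<in> P" using flip_fl_in[OF ab(1), of I] IJ fl by simp
    have "par {..<j} J * X (flip {j} J) (flip {j} I) = X J I * par {..<j} I"
      using c[OF ab(1) I' IJ(2)] fin by (simp add: fl * par_flip_single)
    moreover have "- par {..j} J * X (flip {j} J) (flip {j} I) = - X J I * par {..j} I"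
      using c[OF ab(2) I' IJ(2)] fin by (simp add: fl * par_flip_single)
    ultimately show "X J I = 0"
      using j(2) nz fin by (auto simp: le split: if_splits)
  qed
  \<comment> \<open>A single generator that toggles \<open>j\<close> identifies the diagonal entries
    at \<open>I\<close> and at \<open>insert j I\<close>.\<close>
  have diag: "X I I = X {} {}" if "I \<in> P" for I
    using finite_P(2)[OF that] that unfolding in_P_iff
  proof (induction I rule: finite_induct)
    case (insert j I)
    define k where "k = 2 * j - 1"
    have k: "k \<in> {1..N}" "fl k = {j}" "cf k A = par {..<j} A" for A
      using insert by (auto simp: fl_def cf_def k_def)
    have f: "flip {j} (insert j I) = I" "flip {j} I = insert j I" using insert by (auto simp: flip_def)
    have "cf k I * X I I = X (insert j I) (insert j I) * cf k I"
      using c[OF k(1), of I "insert j I"] insert f by (simp add: k(2) in_P_iff)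
    moreover have "cf k I \<noteq> 0" by (simp add: k par_def)
    ultimately show ?case using insert by simp
  qed simp
  show ?thesis
  proof (intro ext)
    fix J I
    show "X J I = mat_scale (X {} {}) (mat_one P) J I"
      using off[of I J] diag[of I] X by (cases "I \<in> P \<and> J \<in> P")
        (auto simp: mat_scale_def mat_one_def mat_of_def mats_def)
  qed
qed

end

section \<open>The Clifford algebra and the spin representation\<close>

definition tr_mat :: "('i, 'j) cmat \<Rightarrow> ('j, 'i) cmat" where
  "tr_mat A = (\<lambda>i j. A j i)"

lemma tr_mat_mul: "tr_mat (mat_mul J A B) = mat_mul J (tr_mat B) (tr_mat A)"
  by (simp add: tr_mat_def mat_mul_def mult.commute)

lemma mats_outside:
  "A \<in> mats I J \<Longrightarrow> i \<notin> I \<Longrightarrow> A i j = 0" "A \<in> mats I J \<Longrightarrow> j \<notin> J \<Longrightarrow> A i j = 0"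
  by (auto simp: mats_def)

lemma free_carrier_add:
  "f \<in> carrier free_algebra \<Longrightarrow> g \<in> carrier free_algebra \<Longrightarrow> (\<lambda>u. f u + g u) \<in> carrier free_algebra"
  by (simp add: free_algebra_simps finite_support_add)

lemma free_carrier_diff:
  assumes "f \<in> carrier free_algebra" "g \<in> carrier free_algebra"
  shows "(\<lambda>u. f u - g u) \<in> carrier free_algebra"
  using free_carrier_add[OF assms(1) scaled_in_carrier[OF assms(2), of "-1"]] by simp

context spin_setup
begin

abbreviation cl_mult (infixl \<open>\<odot>\<close> 70) where
  "a \<odot> b \<equiv> a \<otimes>\<^bsub>Cl\<^esub> b"

interpretation FA: ring "free_algebra :: ('v list \<Rightarrow> complex) ring"
  by (rule ring_free_algebra)

lemma clifford_relations_carrier: "clifford_relations \<subseteq> carrier free_algebra"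
  unfolding clifford_relations_def
  by (auto intro!: free_carrier_add free_carrier_diff monomial_in_carrier scaled_in_carrier)

lemma ideal_clifford: "ideal clifford_ideal free_algebra"
  unfolding clifford_ideal_def by (rule FA.genideal_ideal[OF clifford_relations_carrier])

interpretation I: ideal clifford_ideal "free_algebra :: ('v list \<Rightarrow> complex) ring"
  by (rule ideal_clifford)

lemma clifford_relationI: "f \<in> clifford_relations \<Longrightarrow> f \<in> clifford_ideal"
  unfolding clifford_ideal_def using FA.genideal_self[OF clifford_relations_carrier] by blast

lemma ideal_carrier: "f \<in> clifford_ideal \<Longrightarrow> f \<in> carrier free_algebra"
  by (rule I.Icarr)

lemma ideal_scale: "f \<in> clifford_ideal \<Longrightarrow> (\<lambda>u. c * f u) \<in> clifford_ideal"
  using I.I_l_closed[of f "\<lambda>u. c * monomial [] u"] scaled_in_carrier[OF monomial_in_carrier, of c "[]"]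
  by (simp add: scalar_mult_free)

lemma ring_Cl: "ring Cl"
  unfolding Cl_def by (rule I.quotient_is_ring)

lemma carrier_Cl: "carrier Cl = cl_of ` carrier free_algebra"
  by (auto simp: Cl_def cl_of_def FactRing_def A_RCOSETS_def')

lemma cl_of_in [simp]: "f \<in> carrier free_algebra \<Longrightarrow> cl_of f \<in> carrier Cl"
  by (simp add: carrier_Cl)

lemma cl_of_mult:
  "f \<in> carrier free_algebra \<Longrightarrow> g \<in> carrier free_algebra \<Longrightarrow>
   cl_of f \<odot> cl_of g = cl_of (f \<star> g)"
  by (simp add: Cl_def cl_of_def FactRing_def I.rcoset_mult_add)

lemma cl_of_add:
  "f \<in> carrier free_algebra \<Longrightarrow> g \<in> carrier free_algebra \<Longrightarrow>
   cl_of f \<oplus>\<^bsub>Cl\<^esub> cl_of g = cl_of (\<lambda>u. f u + g u)"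
  by (simp add: Cl_def cl_of_def FactRing_def I.a_rcos_sum free_algebra_simps(3))

lemma cl_one: "\<one>\<^bsub>Cl\<^esub> = cl_of (monomial [])"
  by (simp add: Cl_def cl_of_def FactRing_def free_algebra_simps monomial_def)

lemma cl_of_iff:
  "f \<in> cl_of g \<longleftrightarrow> f \<in> carrier free_algebra \<and> (\<lambda>u. f u - g u) \<in> clifford_ideal"
  if g: "g \<in> carrier free_algebra"
proof
  assume "f \<in> cl_of g"
  then obtain h where h: "h \<in> clifford_ideal" "f = (\<lambda>u. h u + g u)"
    by (auto simp: cl_of_def a_r_coset_def' free_algebra_simps(3))
  then show "f \<in> carrier free_algebra \<and> (\<lambda>u. f u - g u) \<in> clifford_ideal"
    using free_carrier_add[OF ideal_carrier[OF h(1)] g] h(1) unfolding h(2) by simp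
next
  assume f: "f \<in> carrier free_algebra \<and> (\<lambda>u. f u - g u) \<in> clifford_ideal"
  have "f = (\<lambda>u. (f u - g u) + g u)" by simp
  then show "f \<in> cl_of g"
    using f unfolding cl_of_def a_r_coset_def' free_algebra_simps(3) by blast
qed

lemma cl_of_eqI:
  assumes "f \<in> carrier free_algebra" "g \<in> carrier free_algebra" "(\<lambda>u. f u - g u) \<in> clifford_ideal"
  shows "cl_of f = cl_of g"
proof -
  have "f \<in> cl_of g" using assms by (simp add: cl_of_iff)
  then show ?thesis
    unfolding cl_of_def using I.a_repr_independence'[of f g] assms(2) unfolding cl_of_def by metis
qed

text \<open>The elements whose reversal lies in the ideal form an ideal, and it contains the
  relations, since reversal at most exchanges \<open>v\<close> and \<open>w\<close> in them. Hence
  reversal descends to the Clifford algebra.\<close>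

lemma ideal_rev:
  assumes "f \<in> clifford_ideal"
  shows "f \<circ> rev \<in> clifford_ideal"
proof -
  let ?J = "{f \<in> carrier free_algebra. f \<circ> rev \<in> clifford_ideal}"
  have "ideal ?J free_algebra"
  proof (rule idealI[OF ring_free_algebra])
    show "subgroup ?J (add_monoid free_algebra)"
    proof (rule FA.add.subgroupI)
      have "\<zero>\<^bsub>free_algebra\<^esub> \<in> ?J"
        using I.zero_closed by (auto simp: free_algebra_simps comp_def)
      then show "?J \<noteq> {}" by blast
      fix a b assume "a \<in> ?J" "b \<in> ?J"
      then show "a \<oplus>\<^bsub>free_algebra\<^esub> b \<in> ?J"
        using I.a_closed[of "a \<circ> rev" "b \<circ> rev"] FA.a_closed[of a b]
        by (auto simp: free_algebra_simps(3) comp_def)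
    next
      fix a assume a: "a \<in> ?J"
      then show "\<ominus>\<^bsub>free_algebra\<^esub> a \<in> ?J"
        using ideal_scale[of "a \<circ> rev" "-1"] scaled_in_carrier[of a "-1"]
        by (auto simp: free_algebra_minus comp_def)
    qed auto
    fix a x :: "'v list \<Rightarrow> complex" assume "a \<in> ?J" "x \<in> carrier free_algebra"
    then show "x \<star> a \<in> ?J" "a \<star> x \<in> ?J"
      by (auto simp: free_mult_rev rev_in_carrier intro: I.I_r_closed I.I_l_closed)
  qed
  moreover have "clifford_relations \<subseteq> ?J"
  proof
    fix f assume f: "f \<in> clifford_relations"
    have rev_eq: "of_bool (rev u = w) = (of_bool (u = rev w) :: complex)" for u w :: "'v list"
      by (simp add: rev_swap)
    have "f \<circ> rev \<in> clifford_relations"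
    proof -
      consider v w where "f = (\<lambda>u. monomial [v + w] u - monomial [v] u - monomial [w] u)"
        | c v where "f = (\<lambda>u. monomial [scale c v] u - c * monomial [v] u)"
        | v w where "f = (\<lambda>u. monomial [v, w] u + monomial [w, v] u - 2 * \<Phi> v w * monomial [] u)"
        using f unfolding clifford_relations_def by blast
      then show ?thesis
      proof cases
        case (3 v w)
        then have "f \<circ> rev = (\<lambda>u. monomial [w, v] u + monomial [v, w] u - 2 * \<Phi> w v * monomial [] u)"
          by (auto simp: monomial_def rev_eq form_symmetric)
        then show ?thesis unfolding clifford_relations_def by blast
      next
        case (1 v w)
        then have "f \<circ> rev = f" by (auto simp: monomial_def rev_eq)
        then show ?thesis using f by simp
      next
        case (2 c v)
        then have "f \<circ> rev = f" by (auto simp: monomial_def rev_eq)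
        then show ?thesis using f by simp
      qed
    qed
    then show "f \<in> ?J"
      using f clifford_relations_carrier clifford_relationI by auto
  qed
  ultimately have "clifford_ideal \<subseteq> ?J"
    unfolding clifford_ideal_def by (rule FA.genideal_minimal)
  then show ?thesis using assms by blast
qed

lemma cl_rev_cl_of:
  assumes "f \<in> carrier free_algebra"
  shows "cl_rev (cl_of f) = cl_of (f \<circ> rev)"
proof -
  have *: "g \<circ> rev \<in> cl_of (h \<circ> rev)" if h: "g \<in> cl_of h" "h \<in> carrier free_algebra" for g h
  proof -
    have "g \<in> carrier free_algebra" "(\<lambda>u. g u - h u) \<in> clifford_ideal"
      using h cl_of_iff by blast+
    moreover have "(\<lambda>u. (g \<circ> rev) u - (h \<circ> rev) u) = (\<lambda>u. g u - h u) \<circ> rev"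
      by (simp add: fun_eq_iff)
    ultimately show ?thesis
      unfolding cl_of_iff[OF rev_in_carrier[OF h(2)]] by (simp only: ideal_rev rev_in_carrier simp_thms)
  qed
  have rr: "(g \<circ> rev) \<circ> rev = g" for g :: "'v list \<Rightarrow> complex"
    by (simp add: fun_eq_iff)
  show ?thesis
  proof (intro Set.set_eqI iffI)
    fix h assume "h \<in> cl_of (f \<circ> rev)"
    from *[OF this rev_in_carrier[OF assms]] have "h \<circ> rev \<in> cl_of f" by (simp only: rr)
    then have "(h \<circ> rev) \<circ> rev \<in> cl_rev (cl_of f)" unfolding cl_rev_def by (rule imageI)
    then show "h \<in> cl_rev (cl_of f)" by (simp only: rr)
  next
    fix h assume "h \<in> cl_rev (cl_of f)"
    then obtain g where "g \<in> cl_of f" "h = g \<circ> rev" unfolding cl_rev_def by blast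
    then show "h \<in> cl_of (f \<circ> rev)" using *[OF _ assms] by blast
  qed
qed

subsection \<open>The spin representation\<close>

lemma spin_word_mats: "spin_word w \<in> mats P P"
  by (induction w) (auto simp flip: P_def intro: mats_mul spin_vec_mats)

lemma spin_word_append: "spin_word (x @ y) = mat_mul P (spin_word x) (spin_word y)"
  by (induction x) (simp_all flip: P_def add: mat_mul_one_left[OF _ spin_word_mats] mat_mul_assoc)

lemma spin_free_supp:
  assumes "finite W" "{w. f w \<noteq> 0} \<subseteq> W"
  shows "spin_free f J I = (\<Sum>w\<in>W. f w * spin_word w J I)"
  unfolding spin_free_def by (rule sum.mono_neutral_left) (use assms in auto)

lemma spin_free_monomial: "spin_free (monomial w) = spin_word w"
  by (intro ext) (simp add: spin_free_supp[of "{w}"] monomial_def)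

lemma spin_free_lin:
  assumes "f \<in> carrier free_algebra" "g \<in> carrier free_algebra"
  shows "spin_free (\<lambda>u. a * f u + b * g u) J I = a * spin_free f J I + b * spin_free g J I"
proof -
  let ?W = "{w. f w \<noteq> 0} \<union> {w. g w \<noteq> 0}"
  have "finite ?W" using assms by (simp add: free_algebra_simps)
  then show ?thesis
    by (subst (1 2 3) spin_free_supp[of ?W]) (auto simp: sum_distrib_left sum.distrib algebra_simps)
qed

lemma spin_free_add:
  "f \<in> carrier free_algebra \<Longrightarrow> g \<in> carrier free_algebra \<Longrightarrow>
   spin_free (\<lambda>u. f u + g u) J I = spin_free f J I + spin_free g J I"
  using spin_free_lin[of f g 1 1] by simp

lemma spin_free_diff:
  "f \<in> carrier free_algebra \<Longrightarrow> g \<in> carrier free_algebra \<Longrightarrow>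
   spin_free (\<lambda>u. f u - g u) J I = spin_free f J I - spin_free g J I"
  using spin_free_lin[of f g 1 "-1"] by simp

lemma spin_free_scale: "f \<in> carrier free_algebra \<Longrightarrow> spin_free (\<lambda>u. c * f u) J I = c * spin_free f J I"
  using spin_free_lin[of f f c 0] by simp

text \<open>Cuts of a word into pieces on which \<open>f\<close> and \<open>g\<close> are nonzero
  correspond to pairs from the two supports; on such pairs multiplicativity is concatenation of
  words.\<close>

lemma spin_free_mult:
  fixes f g :: "'v list \<Rightarrow> complex"
  assumes "f \<in> carrier free_algebra" "g \<in> carrier free_algebra"
  shows "spin_free (f \<star> g) = mat_mul P (spin_free f) (spin_free g)"
proof (intro ext)
  fix J I
  let ?A = "{w. f w \<noteq> 0}" and ?B = "{w. g w \<noteq> 0}"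
  define W where "W = (\<lambda>(x, y). x @ y) ` (?A \<times> ?B)"
  have fin: "finite ?A" "finite ?B" using assms by (auto simp: free_algebra_simps)
  have W: "finite W" "x @ y \<in> W" if "x \<in> ?A" "y \<in> ?B" for x y
    using fin that by (auto simp: W_def)
  have fW: "finite W" using fin by (simp add: W_def)
  have supp: "{w. (f \<star> g) w \<noteq> 0} \<subseteq> W"
  proof safe
    fix w assume "(f \<star> g) w \<noteq> 0"
    then obtain k where "f (take k w) * g (drop k w) \<noteq> 0"
      unfolding free_algebra_simps by (meson sum.not_neutral_contains_not_neutral)
    then show "w \<in> W" unfolding W_def by (intro image_eqI[of _ _ "(take k w, drop k w)"]) auto
  qed
  let ?S = "Sigma W (\<lambda>w. {..length w})"
  let ?T = "{(w, k) \<in> ?S. take k w \<in> ?A \<and> drop k w \<in> ?B}"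
  have "spin_free (f \<star> g) J I = (\<Sum>w\<in>W. (f \<star> g) w * spin_word w J I)"
    by (rule spin_free_supp) (use fW supp in auto)
  also have "\<dots> = (\<Sum>(w, k)\<in>?S. f (take k w) * g (drop k w) * spin_word w J I)"
    using fW by (simp add: free_algebra_simps sum_distrib_right sum.Sigma)
  also have "\<dots> = (\<Sum>(w, k)\<in>?T. f (take k w) * g (drop k w) * spin_word w J I)"
    by (rule sum.mono_neutral_right) (use fW in auto)
  also have "\<dots> = (\<Sum>(x, y)\<in>?A \<times> ?B. f x * g y * spin_word (x @ y) J I)"
    by (rule sum.reindex_bij_witness[of _ "\<lambda>(x, y). (x @ y, length x)" "\<lambda>(w, k). (take k w, drop k w)"])
      (use W(2) in auto)
  also have "\<dots> = (\<Sum>x\<in>?A. \<Sum>y\<in>?B. \<Sum>K\<in>P. f x * g y * (spin_word x J K * spin_word y K I))"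
    by (simp add: sum.cartesian_product[symmetric] spin_word_append mat_mul_def sum_distrib_left)
  also have "\<dots> = (\<Sum>K\<in>P. \<Sum>x\<in>?A. \<Sum>y\<in>?B. f x * g y * (spin_word x J K * spin_word y K I))"
    by (simp only: sum.swap[of _ P])
  also have "\<dots> = mat_mul P (spin_free f) (spin_free g) J I"
    by (simp add: mat_mul_def spin_free_def sum_product algebra_simps)
  finally show "spin_free (f \<star> g) J I = mat_mul P (spin_free f) (spin_free g) J I" .
qed

lemma spin_free_mats: "spin_free f \<in> mats P P"
  unfolding mats_def mem_Collect_eq
proof (intro allI impI)
  fix J I assume "spin_free f J I \<noteq> 0"
  then obtain w where "spin_word w J I \<noteq> 0"
    unfolding spin_free_def by (metis (no_types, lifting) mult_zero_right sum.not_neutral_contains_not_neutral)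
  then show "J \<in> P \<and> I \<in> P" using spin_word_mats[of w] by (auto simp: mats_def)
qed

text \<open>The kernel of the representation is a two-sided ideal, and it contains the relations
  because \<open>spin_vec\<close> is linear and satisfies the Clifford identity.\<close>

lemma spin_free_ideal:
  assumes "f \<in> clifford_ideal"
  shows "spin_free f J I = 0"
proof -
  let ?K = "{f \<in> carrier free_algebra. \<forall>J I. spin_free f J I = 0}"
  have "ideal ?K free_algebra"
  proof (rule idealI[OF ring_free_algebra])
    show "subgroup ?K (add_monoid free_algebra)"
    proof (rule FA.add.subgroupI)
      have "\<zero>\<^bsub>free_algebra\<^esub> \<in> ?K" by (auto simp: free_algebra_simps spin_free_def)
      then show "?K \<noteq> {}" by blast
      fix a b assume "a \<in> ?K" "b \<in> ?K"
      then show "a \<oplus>\<^bsub>free_algebra\<^esub> b \<in> ?K"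
        by (auto simp: free_algebra_simps(3) spin_free_add free_carrier_add)
    next
      fix a assume a: "a \<in> ?K"
      then show "\<ominus>\<^bsub>free_algebra\<^esub> a \<in> ?K"
        using scaled_in_carrier[of a "-1"] spin_free_scale[of a "-1"] by (auto simp: free_algebra_minus)
    qed auto
    fix a x :: "'v list \<Rightarrow> complex" assume "a \<in> ?K" "x \<in> carrier free_algebra"
    then show "x \<star> a \<in> ?K" "a \<star> x \<in> ?K"
      by (auto simp: spin_free_mult mat_mul_def)
  qed
  moreover have "clifford_relations \<subseteq> ?K"
  proof
    fix f assume f: "f \<in> clifford_relations"
    have "spin_free f J I = 0" for J I
      using f unfolding clifford_relations_def
      by (auto simp: spin_free_diff spin_free_add spin_free_scale spin_free_monomial free_carrier_diff
        free_carrier_add scaled_in_carrier spin_vec_add spin_vec_scale spin_vec_clifford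
        mat_mul_one_right[OF _ spin_vec_mats] P_def[symmetric])
    then show "f \<in> ?K" using f clifford_relations_carrier by auto
  qed
  ultimately have "clifford_ideal \<subseteq> ?K"
    unfolding clifford_ideal_def by (rule FA.genideal_minimal)
  then show ?thesis using assms by blast
qed

lemma spin_act_cl_of:
  assumes "f \<in> carrier free_algebra"
  shows "spin_act (cl_of f) = spin_free f"
proof -
  have "spin_free g = spin_free f" if "g \<in> cl_of f" for g
  proof (intro ext)
    fix J I
    have g: "g \<in> carrier free_algebra" "(\<lambda>u. g u - f u) \<in> clifford_ideal"
      using that assms by (auto simp: cl_of_iff)
    show "spin_free g J I = spin_free f J I"
      using spin_free_ideal[OF g(2), of J I] spin_free_diff[OF g(1) assms, of J I] by simp
  qed
  moreover have "f \<in> cl_of f"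
    using assms I.zero_closed by (simp add: cl_of_iff free_algebra_simps)
  ultimately have "spin_free ` cl_of f = {spin_free f}" by blast
  then show ?thesis by (simp add: spin_act_def)
qed

lemma spin_act_mats: "a \<in> carrier Cl \<Longrightarrow> spin_act a \<in> mats P P"
  by (auto simp: carrier_Cl spin_act_cl_of spin_free_mats)

lemma spin_act_mult:
  "a \<in> carrier Cl \<Longrightarrow> b \<in> carrier Cl \<Longrightarrow> spin_act (a \<odot> b) = mat_mul P (spin_act a) (spin_act b)"
  by (auto simp: carrier_Cl spin_act_cl_of cl_of_mult spin_free_mult FA.m_closed)

lemma spin_act_one: "spin_act \<one>\<^bsub>Cl\<^esub> = mat_one P"
  by (simp add: cl_one spin_act_cl_of spin_free_monomial flip: P_def)

lemma cl_vec_in [simp]: "cl_vec v \<in> carrier Cl"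
  by (simp add: cl_vec_def)

lemma spin_act_vec: "spin_act (cl_vec v) = spin_vec v"
  by (simp add: cl_vec_def spin_act_cl_of spin_free_monomial flip: P_def)
    (simp add: mat_mul_one_right[OF _ spin_vec_mats])

lemma cl_scalar_in [simp]: "cl_scalar c \<in> carrier Cl"
  by (simp add: cl_scalar_def scaled_in_carrier)

lemma cl_scalar_mult:
  "f \<in> carrier free_algebra \<Longrightarrow> cl_scalar c \<odot> cl_of f = cl_of (\<lambda>u. c * f u)"
  by (simp add: cl_scalar_def cl_of_mult scaled_in_carrier scalar_mult_free)

lemma spin_act_linear: "linear_functional Cl cl_scalar (\<lambda>a. spin_act a J I)"
  unfolding linear_functional_def
  by (auto simp: carrier_Cl cl_of_add spin_act_cl_of spin_free_add free_carrier_add cl_scalar_mult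
    scaled_in_carrier spin_free_scale)

text \<open>The anticommutator with \<open>u\<close> is the scalar \<open>2 * \<Phi> v u\<close>, so
  nondegeneracy recovers \<open>v\<close>. In particular \<open>V\<close> embeds into the Clifford
  algebra, which makes the description in \<open>vec_act\<close> unique.\<close>

lemma spin_vec_inj:
  assumes "spin_vec v = spin_vec w"
  shows "v = w"
proof -
  have "\<Phi> (v - w) u = 0" for u
    using spin_vec_clifford[of v u "{}" "{}"] spin_vec_clifford[of w u "{}" "{}"] assms
    by (simp add: mat_one_def mat_of_def form_diff_left)
  then show ?thesis using form_nondegenerate[of "v - w"] by simp
qed

lemma cl_vec_inj: "cl_vec v = cl_vec w \<Longrightarrow> v = w"
  by (metis spin_act_vec spin_vec_inj)

subsection \<open>The action of the group\<close>

interpretation C: ring Cl by (rule ring_Cl)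

lemma kappa_even: "even N \<Longrightarrow> \<kappa> = 1"
  by (simp add: \<kappa>_def)

text \<open>The representative is chosen so that all signs \<open>\<kappa> ^ length w\<close> are
  trivial: for even \<open>N\<close> because \<open>\<kappa> = 1\<close>, for odd \<open>N\<close>
  because the group lies in the even part. The condition \<open>g \<iota>(g) = 1\<close> makes the
  reversal represent the inverse.\<close>

lemma GV_rep:
  assumes "g \<in> GV"
  obtains f where "f \<in> carrier free_algebra" "g = cl_of f" "cl_of (f \<circ> rev) = inv\<^bsub>Cl\<^esub> g"
    "\<And>w. f w \<noteq> 0 \<Longrightarrow> \<kappa> ^ length w = 1"
proof -
  have g: "g \<in> Pin" "odd N \<Longrightarrow> g \<in> cl_even"
    using assms by (auto simp: GV_def Spin_def split: if_splits)
  have kap: "\<kappa> ^ k = 1" if "even N \<or> even k" for k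
    using that kappa_square kappa_even by (auto elim!: evenE simp: power_mult power2_eq_square)
  obtain f where f: "f \<in> carrier free_algebra" "g = cl_of f" "\<And>w. f w \<noteq> 0 \<Longrightarrow> \<kappa> ^ length w = 1"
  proof (cases "odd N")
    case True
    then show ?thesis using g that kap by (fastforce simp: cl_even_def)
  next
    case False
    then show ?thesis using g that kap by (fastforce simp: Pin_def cl_even_def cl_odd_def)
  qed
  have u: "g \<in> Units Cl" "g \<odot> cl_rev g = \<one>\<^bsub>Cl\<^esub>" using g by (auto simp: Pin_def)
  have "cl_rev g \<in> carrier Cl" using f by (simp add: cl_rev_cl_of rev_in_carrier)
  then have "cl_rev g = inv\<^bsub>Cl\<^esub> g"
    using u by (metis C.Units_closed C.Units_inv_closed C.Units_l_inv C.l_one C.m_assoc C.r_one)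
  then show ?thesis using that f by (simp add: cl_rev_cl_of)
qed

lemma GV_Units: "g \<in> GV \<Longrightarrow> g \<in> Units Cl"
  by (auto simp: GV_def Spin_def Pin_def split: if_splits)

lemma GV_carrier: "g \<in> GV \<Longrightarrow> g \<in> carrier Cl"
  using GV_Units C.Units_closed by blast

lemma spin_act_inv:
  assumes "g \<in> Units Cl"
  shows "mat_mul P (spin_act g) (spin_act (inv\<^bsub>Cl\<^esub> g)) = mat_one P"
    "mat_mul P (spin_act (inv\<^bsub>Cl\<^esub> g)) (spin_act g) = mat_one P"
  using assms by (simp_all add: spin_act_mult[symmetric] C.Units_closed spin_act_one)

lemma vec_act_eqI:
  assumes "cl_vec w = g \<odot> cl_vec v \<odot> inv\<^bsub>Cl\<^esub> g"
  shows "vec_act g v = w"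
  unfolding vec_act_def using assms cl_vec_inj by (intro the_equality) metis+

lemma cl_vec_vec_act:
  assumes "g \<in> GV"
  shows "cl_vec (vec_act g v) = g \<odot> cl_vec v \<odot> inv\<^bsub>Cl\<^esub> g"
proof -
  have "g \<in> Pin" using assms by (auto simp: GV_def Spin_def split: if_splits)
  then have eq: "(\<lambda>x. g \<odot> x \<odot> inv\<^bsub>Cl\<^esub> g) ` range cl_vec = range cl_vec"
    by (simp add: Pin_def)
  have "g \<odot> cl_vec v \<odot> inv\<^bsub>Cl\<^esub> g \<in> range cl_vec"
    by (subst eq[symmetric]) (rule image_eqI, rule HOL.refl, rule rangeI)
  then obtain w where w: "cl_vec w = g \<odot> cl_vec v \<odot> inv\<^bsub>Cl\<^esub> g"
    by (metis imageE)
  show ?thesis unfolding vec_act_eqI[OF w] by (rule w)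
qed

lemma spin_vec_vec_act:
  assumes "g \<in> GV"
  shows "spin_vec (vec_act g v) = mat_mul P (mat_mul P (spin_act g) (spin_vec v)) (spin_act (inv\<^bsub>Cl\<^esub> g))"
  using assms GV_Units[OF assms]
  by (simp add: spin_act_vec[symmetric] cl_vec_vec_act spin_act_mult GV_carrier)

lemma vec_act_lin:
  assumes "g \<in> GV"
  shows "vec_act g (scale a u + scale b v) = scale a (vec_act g u) + scale b (vec_act g v)"
  by (rule spin_vec_inj) (auto simp: spin_vec_vec_act[OF assms] spin_vec_add spin_vec_scale
    mat_mul_def fun_eq_iff algebra_simps sum.distrib sum_distrib_left)

lemma vec_act_mult:
  assumes "g \<in> GV" "h \<in> GV"
  shows "vec_act (g \<odot> h) v = vec_act g (vec_act h v)"
proof (rule vec_act_eqI)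
  have u: "g \<in> Units Cl" "h \<in> Units Cl" using assms GV_Units by auto
  have "inv\<^bsub>Cl\<^esub> (g \<odot> h) = inv\<^bsub>Cl\<^esub> h \<odot> inv\<^bsub>Cl\<^esub> g"
  proof (rule C.inv_char)
    have c: "g \<in> carrier Cl" "h \<in> carrier Cl" "inv\<^bsub>Cl\<^esub> g \<in> carrier Cl" "inv\<^bsub>Cl\<^esub> h \<in> carrier Cl"
      using u by (auto simp: C.Units_closed)
    have "g \<odot> h \<odot> (inv\<^bsub>Cl\<^esub> h \<odot> inv\<^bsub>Cl\<^esub> g) =
        g \<odot> (h \<odot> inv\<^bsub>Cl\<^esub> h) \<odot> inv\<^bsub>Cl\<^esub> g"
      using c by (simp only: C.m_assoc C.m_closed)
    then show "g \<odot> h \<odot> (inv\<^bsub>Cl\<^esub> h \<odot> inv\<^bsub>Cl\<^esub> g) = \<one>\<^bsub>Cl\<^esub>"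
      using u c by simp
    have "inv\<^bsub>Cl\<^esub> h \<odot> inv\<^bsub>Cl\<^esub> g \<odot> (g \<odot> h) =
        inv\<^bsub>Cl\<^esub> h \<odot> (inv\<^bsub>Cl\<^esub> g \<odot> g) \<odot> h"
      using c by (simp only: C.m_assoc C.m_closed)
    then show "inv\<^bsub>Cl\<^esub> h \<odot> inv\<^bsub>Cl\<^esub> g \<odot> (g \<odot> h) = \<one>\<^bsub>Cl\<^esub>"
      using u c by simp
  qed (use u in \<open>auto simp: C.Units_closed\<close>)
  then show "cl_vec (vec_act g (vec_act h v)) =
      g \<odot> h \<odot> cl_vec v \<odot> inv\<^bsub>Cl\<^esub> (g \<odot> h)"
    using u assms by (simp add: cl_vec_vec_act C.m_assoc C.Units_closed)
qed

lemma vec_act_one: "vec_act \<one>\<^bsub>Cl\<^esub> v = v"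
  by (rule vec_act_eqI) simp

lemma mat_one_apply: "mat_one P {} {} = 1"
  by (simp add: mat_one_def mat_of_def)

text \<open>Conjugation carries the anticommutator of \<open>u\<close> and \<open>v\<close> to that
  of their images. As it is a scalar it stays the same, and its entry at \<open>{}\<close> reads off
  the form.\<close>

lemma vec_act_form:
  assumes "g \<in> GV"
  shows "\<Phi> (vec_act g u) (vec_act g v) = \<Phi> u v"
proof -
  let ?A = "spin_act g" and ?B = "spin_act (inv\<^bsub>Cl\<^esub> g)"
  have A: "?A \<in> mats P P" "?B \<in> mats P P"
    using GV_Units[OF assms] by (auto intro!: spin_act_mats C.Units_closed)
  have *: "mat_mul P (spin_vec (vec_act g u)) (spin_vec (vec_act g v)) =
    mat_mul P (mat_mul P ?A (mat_mul P (spin_vec u) (spin_vec v))) ?B" for u v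
  proof -
    have "mat_mul P (spin_vec (vec_act g u)) (spin_vec (vec_act g v)) =
      mat_mul P (mat_mul P ?A (spin_vec u)) (mat_mul P (mat_mul P ?B ?A) (mat_mul P (spin_vec v) ?B))"
      by (simp add: spin_vec_vec_act[OF assms] mat_mul_assoc)
    then show ?thesis
      using spin_act_inv[OF GV_Units[OF assms]] A
      by (simp add: mat_mul_one_left[OF _ mats_mul[OF spin_vec_mats]] mat_mul_assoc)
  qed
  have "2 * \<Phi> (vec_act g u) (vec_act g v) * mat_one P {} {} =
    mat_mul P (spin_vec (vec_act g u)) (spin_vec (vec_act g v)) {} {} +
    mat_mul P (spin_vec (vec_act g v)) (spin_vec (vec_act g u)) {} {}"
    by (rule spin_vec_clifford[symmetric])
  also have "\<dots> = mat_mul P (mat_mul P ?A (mat_add (mat_mul P (spin_vec u) (spin_vec v))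
      (mat_mul P (spin_vec v) (spin_vec u)))) ?B {} {}"
    unfolding * by (simp add: mat_mul_add_left mat_mul_add_right) (simp add: mat_add_def)
  also have "mat_add (mat_mul P (spin_vec u) (spin_vec v)) (mat_mul P (spin_vec v) (spin_vec u)) =
      mat_scale (2 * \<Phi> u v) (mat_one P)"
    unfolding mat_add_def mat_scale_def spin_vec_clifford ..
  finally show ?thesis
    using spin_act_inv[OF GV_Units[OF assms]] A
    by (simp add: mat_mul_scale_left mat_mul_scale_right mat_mul_one_right mat_one_apply)
      (simp add: mat_scale_def mat_one_apply)
qed

section \<open>Invariance of the form on the spin module\<close>

definition BS :: "(nat set, nat set) cmat" where
  "BS = mat_of P P spin_form"

lemma spin_vec_adjoint:
  "mat_mul P (tr_mat (spin_vec v)) BS = mat_scale \<kappa> (mat_mul P BS (spin_vec v))"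
proof (intro ext)
  fix I J
  show "mat_mul P (tr_mat (spin_vec v)) BS I J = mat_scale \<kappa> (mat_mul P BS (spin_vec v)) I J"
  proof (cases "I \<in> P \<and> J \<in> P")
    case True
    have "mat_mul P (tr_mat (spin_vec v)) BS I J =
      (\<Sum>k=1..N. \<Phi> (e k) v * (\<Sum>K\<in>P. gam k K I * spin_form K J))"
      unfolding mat_mul_def tr_mat_def spin_vec_expand BS_def mat_of_def sum_distrib_left sum_distrib_right
      using True by (subst sum.swap) (simp add: ac_simps cong: sum.cong)
    also have "\<dots> = (\<Sum>k=1..N. \<Phi> (e k) v * (\<kappa> * (\<Sum>K\<in>P. spin_form I K * gam k K J)))"
      using True gam_adjoint by (intro sum.cong HOL.refl) auto
    also have "\<dots> = mat_scale \<kappa> (mat_mul P BS (spin_vec v)) I J"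
      unfolding mat_mul_def mat_scale_def spin_vec_expand BS_def mat_of_def sum_distrib_left sum_distrib_right
      using True by (subst (2) sum.swap) (simp add: ac_simps cong: sum.cong)
    finally show ?thesis .
  next
    case False
    then show ?thesis
      by (auto simp: mat_mul_def mat_scale_def BS_def mat_of_def tr_mat_def
        mats_outside[OF spin_vec_mats[of v]])
  qed
qed

text \<open>Moving the transposed letters across the form one at a time reverses the word and costs
  one \<open>\<kappa>\<close> per letter.\<close>

lemma spin_word_adjoint:
  "mat_mul P (tr_mat (spin_word w)) BS = mat_scale (\<kappa> ^ length w) (mat_mul P BS (spin_word (rev w)))"
proof (induction w)
  case Nil
  have "tr_mat (mat_one P) = mat_one P" by (auto simp: tr_mat_def mat_one_def mat_of_def fun_eq_iff)
  moreover have "BS \<in> mats P P" by (simp add: BS_def)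
  ultimately show ?case
    by (simp flip: P_def add: mat_mul_one_left mat_mul_one_right) (simp add: mat_scale_def)
next
  case (Cons v w)
  have "mat_mul P (tr_mat (spin_word (v # w))) BS =
      mat_mul P (tr_mat (spin_word w)) (mat_mul P (tr_mat (spin_vec v)) BS)"
    by (simp flip: P_def add: tr_mat_mul mat_mul_assoc)
  also have "\<dots> = mat_scale \<kappa> (mat_mul P (mat_mul P (tr_mat (spin_word w)) BS) (spin_vec v))"
    by (simp add: spin_vec_adjoint mat_mul_scale_right mat_mul_assoc)
  also have "\<dots> = mat_scale (\<kappa> ^ length (v # w)) (mat_mul P BS (mat_mul P (spin_word (rev w)) (spin_vec v)))"
    by (simp add: Cons mat_mul_scale_left mat_mul_assoc) (simp add: mat_scale_def mult.assoc)
  also have "mat_mul P (spin_word (rev w)) (spin_vec v) = spin_word (rev (v # w))"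
    by (simp add: spin_word_append flip: P_def) (simp add: mat_mul_one_right[OF _ spin_vec_mats])
  finally show ?case .
qed

text \<open>On a representative from \<open>GV_rep\<close> the powers of \<open>\<kappa>\<close> are
  trivial and reversal is inversion, so the adjoint of \<open>g\<close> is its inverse.\<close>

lemma spin_act_adjoint:
  assumes "g \<in> GV"
  shows "mat_mul P (tr_mat (spin_act g)) BS = mat_mul P BS (spin_act (inv\<^bsub>Cl\<^esub> g))"
proof (intro ext)
  fix I J
  obtain f where f: "f \<in> carrier free_algebra" "g = cl_of f" "cl_of (f \<circ> rev) = inv\<^bsub>Cl\<^esub> g"
    "\<And>w. f w \<noteq> 0 \<Longrightarrow> \<kappa> ^ length w = 1" using GV_rep[OF assms] by blast
  let ?W = "{w. f w \<noteq> 0}"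
  have W: "finite ?W" using f(1) by (simp add: free_algebra_simps)
  have "{w. f (rev w) \<noteq> 0} = rev ` ?W" by (auto intro!: image_eqI[of _ rev "rev _"])
  then have inv: "spin_act (inv\<^bsub>Cl\<^esub> g) K J = (\<Sum>w\<in>?W. f w * spin_word (rev w) K J)" for K
    unfolding f(3)[symmetric] spin_act_cl_of[OF rev_in_carrier[OF f(1)]] spin_free_def
    by (simp add: sum.reindex)
  have "mat_mul P (tr_mat (spin_act g)) BS I J =
    (\<Sum>w\<in>?W. f w * mat_mul P (tr_mat (spin_word w)) BS I J)"
    unfolding f(2) spin_act_cl_of[OF f(1)] mat_mul_def tr_mat_def spin_free_def sum_distrib_left sum_distrib_right
    by (subst sum.swap) (simp add: ac_simps)
  also have "\<dots> = (\<Sum>w\<in>?W. f w * mat_mul P BS (spin_word (rev w)) I J)"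
    using f(4) by (intro sum.cong HOL.refl) (simp add: spin_word_adjoint mat_scale_def)
  also have "\<dots> = mat_mul P BS (spin_act (inv\<^bsub>Cl\<^esub> g)) I J"
    unfolding inv mat_mul_def sum_distrib_left by (subst sum.swap) (simp add: ac_simps)
  finally show "mat_mul P (tr_mat (spin_act g)) BS I J = mat_mul P BS (spin_act (inv\<^bsub>Cl\<^esub> g)) I J" .
qed

lemma spin_act_form:
  assumes "g \<in> GV"
  shows "mat_mul P (tr_mat (spin_act g)) (mat_mul P BS (spin_act g)) = BS"
proof -
  have "BS \<in> mats P P" by (simp add: BS_def)
  then show ?thesis
    using spin_act_inv(2)[OF GV_Units[OF assms]]
    by (simp add: mat_mul_assoc[symmetric] spin_act_adjoint[OF assms])
      (simp add: mat_mul_assoc mat_mul_one_right)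
qed

end

section \<open>Elements of the group\<close>

lemma free_mult_scalar: "f \<star> (\<lambda>u. c * monomial [] u) = (\<lambda>u. c * f u)"
proof
  fix w :: "'a list"
  have "(f \<star> (\<lambda>u. c * monomial [] u)) w = (\<Sum>k\<le>length w. if k = length w then c * f w else 0)"
    unfolding free_algebra_simps monomial_def by (intro sum.cong HOL.refl) auto
  then show "(f \<star> (\<lambda>u. c * monomial [] u)) w = c * f w" by simp
qed

context spin_setup
begin

interpretation C: ring Cl by (rule ring_Cl)

lemma cl_scalar_mult_vec: "cl_scalar c \<odot> cl_vec v = cl_vec (scale c v)"
proof -
  have "(\<lambda>u. monomial [scale c v] u - c * monomial [v] u) \<in> clifford_ideal"
    by (rule clifford_relationI, unfold clifford_relations_def) blast
  then show ?thesis
    unfolding cl_vec_def cl_scalar_mult[OF monomial_in_carrier]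
    by (intro cl_of_eqI[symmetric] scaled_in_carrier monomial_in_carrier)
qed

lemma cl_vec_add: "cl_vec v \<oplus>\<^bsub>Cl\<^esub> cl_vec w = cl_vec (v + w)"
proof -
  have "(\<lambda>u. monomial [v + w] u - (monomial [v] u + monomial [w] u)) \<in> clifford_ideal"
    unfolding diff_diff_eq[symmetric]
    by (rule clifford_relationI, unfold clifford_relations_def) blast
  then show ?thesis
    unfolding cl_vec_def cl_of_add[OF monomial_in_carrier monomial_in_carrier]
    by (intro cl_of_eqI[symmetric] free_carrier_add monomial_in_carrier)
qed

lemma cl_vec_mult: "cl_vec v \<odot> cl_vec w = cl_of (monomial [v, w])"
  by (simp add: cl_vec_def cl_of_mult monomial_mult)

lemma cl_vec_clifford:
  "cl_vec v \<odot> cl_vec w \<oplus>\<^bsub>Cl\<^esub> cl_vec w \<odot> cl_vec v = cl_scalar (2 * \<Phi> v w)"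
  unfolding cl_vec_mult cl_scalar_def cl_of_add[OF monomial_in_carrier monomial_in_carrier]
  by (intro cl_of_eqI free_carrier_add scaled_in_carrier monomial_in_carrier clifford_relationI)
    (unfold clifford_relations_def, blast)

lemma cl_vec_square:
  assumes "\<Phi> v v = 1"
  shows "cl_vec v \<odot> cl_vec v = \<one>\<^bsub>Cl\<^esub>"
proof -
  have "(\<lambda>u. monomial [v, v] u + monomial [v, v] u - 2 * \<Phi> v v * monomial [] u) \<in> clifford_ideal"
    by (rule clifford_relationI, unfold clifford_relations_def) blast
  from ideal_scale[OF this, of "1/2"]
  have "(\<lambda>u. 1 / 2 * (monomial [v, v] u + monomial [v, v] u - 2 * \<Phi> v v * monomial [] u)) \<in> clifford_ideal" .
  also have "(\<lambda>u. 1 / 2 * (monomial [v, v] u + monomial [v, v] u - 2 * \<Phi> v v * monomial [] u)) =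
      (\<lambda>u. monomial [v, v] u - monomial [] u)"
    using assms by (simp add: fun_eq_iff diff_divide_distrib)
  finally have "(\<lambda>u. monomial [v, v] u - monomial [] u) \<in> clifford_ideal" .
  then show ?thesis
    unfolding cl_vec_mult cl_one by (intro cl_of_eqI monomial_in_carrier)
qed

lemma cl_inv_eqI:
  assumes "x \<in> carrier Cl" "y \<in> carrier Cl" "x \<odot> y = \<one>\<^bsub>Cl\<^esub>" "y \<odot> x = \<one>\<^bsub>Cl\<^esub>"
  shows "x \<in> Units Cl" "inv\<^bsub>Cl\<^esub> x = y"
  using assms C.inv_char[of x y] by (auto simp: Units_def)

text \<open>For a unit vector \<open>v\<close> this fixes \<open>v\<close> and negates its
  orthogonal complement: conjugation in the Clifford algebra is minus the hyperplane
  reflection.\<close>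

definition reflect :: "'v \<Rightarrow> 'v \<Rightarrow> 'v" where
  "reflect v w = scale (2 * \<Phi> v w) v - w"

lemma reflect_reflect:
  assumes "\<Phi> v v = 1"
  shows "reflect v (reflect v w) = w"
  using assms by (simp add: reflect_def form_diff_right form_scale_right)

text \<open>Multiply the Clifford relation \<open>v w + w v = 2 \<Phi>(v, w)\<close> by
  \<open>v\<close> on the right and use \<open>v v = 1\<close>.\<close>

lemma cl_vec_conj:
  assumes "\<Phi> v v = 1"
  shows "cl_vec v \<odot> cl_vec w \<odot> cl_vec v = cl_vec (reflect v w)"
proof -
  let ?a = "cl_vec v" and ?b = "cl_vec w"
  have "(?a \<odot> ?b \<oplus>\<^bsub>Cl\<^esub> ?b \<odot> ?a) \<odot> ?a = cl_vec (scale (2 * \<Phi> v w) v)"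
    by (simp add: cl_vec_clifford cl_scalar_mult_vec)
  moreover have "(?a \<odot> ?b \<oplus>\<^bsub>Cl\<^esub> ?b \<odot> ?a) \<odot> ?a =
      ?a \<odot> ?b \<odot> ?a \<oplus>\<^bsub>Cl\<^esub> ?b"
    by (simp add: C.l_distr C.m_assoc cl_vec_square[OF assms])
  moreover have "cl_vec (scale (2 * \<Phi> v w) v) = cl_vec (reflect v w) \<oplus>\<^bsub>Cl\<^esub> ?b"
    by (simp add: cl_vec_add reflect_def)
  ultimately show ?thesis by simp
qed

lemma cl_rev_vec [simp]: "cl_rev (cl_vec v) = cl_vec v"
proof -
  have "monomial [v] \<circ> rev = monomial [v]" by (auto simp: monomial_def fun_eq_iff rev_swap)
  then show ?thesis by (simp add: cl_vec_def cl_rev_cl_of)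
qed

lemma unit_vector_in_Pin:
  assumes v: "\<Phi> v v = 1"
  shows "cl_vec v \<in> Pin"
proof -
  have "cl_vec v \<in> cl_odd"
    unfolding cl_odd_def cl_vec_def by (rule imageI) (auto simp: monomial_def free_algebra_simps)
  moreover have "(\<lambda>x. cl_vec v \<odot> x \<odot> inv\<^bsub>Cl\<^esub> cl_vec v) ` range cl_vec = range cl_vec"
  proof -
    have "range (\<lambda>w. cl_vec (reflect v w)) = range cl_vec"
      using reflect_reflect[OF v] by (metis surjI surj_def full_SetCompr_eq image_comp image_image)
    then show ?thesis
      by (simp add: cl_inv_eqI(2)[OF _ _ cl_vec_square cl_vec_square] v cl_vec_conj image_image)
  qed
  ultimately show ?thesis
    unfolding Pin_def using cl_inv_eqI(1)[OF _ _ cl_vec_square cl_vec_square] v by (simp add: cl_vec_square)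
qed

lemma unit_vector_in_GV:
  assumes v: "\<Phi> v v = 1" and "even N"
  shows "cl_vec v \<in> GV" "vec_act (cl_vec v) w = reflect v w"
proof -
  show "cl_vec v \<in> GV" using unit_vector_in_Pin[OF v] assms(2) by (simp add: GV_def)
  show "vec_act (cl_vec v) w = reflect v w"
    by (rule vec_act_eqI) (simp add: cl_inv_eqI(2)[OF _ _ cl_vec_square cl_vec_square] v cl_vec_conj)
qed

text \<open>Even products belong to the group for every \<open>N\<close>; the infinitesimal argument
  for powers of \<open>V\<close> uses only these.\<close>

lemma product_in_GV:
  assumes v: "\<Phi> v v = 1" and w: "\<Phi> w w = 1"
  shows "cl_vec v \<odot> cl_vec w \<in> GV" (is "?g \<in> GV")
    "vec_act (cl_vec v \<odot> cl_vec w) x = reflect v (reflect w x)"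
proof -
  let ?h = "cl_vec w \<odot> cl_vec v"
  have "?g \<odot> ?h = cl_vec v \<odot> (cl_vec w \<odot> cl_vec w) \<odot> cl_vec v"
    by (simp only: C.m_assoc C.m_closed cl_vec_in)
  then have gh: "?g \<odot> ?h = \<one>\<^bsub>Cl\<^esub>" by (simp add: cl_vec_square v w)
  have "?h \<odot> ?g = cl_vec w \<odot> (cl_vec v \<odot> cl_vec v) \<odot> cl_vec w"
    by (simp only: C.m_assoc C.m_closed cl_vec_in)
  then have hg: "?h \<odot> ?g = \<one>\<^bsub>Cl\<^esub>" by (simp add: cl_vec_square v w)
  note inv = cl_inv_eqI[OF C.m_closed[OF cl_vec_in cl_vec_in] C.m_closed[OF cl_vec_in cl_vec_in] gh hg]
  have conj: "?g \<odot> cl_vec x \<odot> inv\<^bsub>Cl\<^esub> ?g = cl_vec (reflect v (reflect w x))" for x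
  proof -
    have "?g \<odot> cl_vec x \<odot> ?h =
        cl_vec v \<odot> (cl_vec w \<odot> cl_vec x \<odot> cl_vec w) \<odot> cl_vec v"
      by (simp only: C.m_assoc C.m_closed cl_vec_in)
    then show ?thesis by (simp add: inv(2) cl_vec_conj v w)
  qed
  have "?g \<in> cl_even"
    unfolding cl_even_def cl_vec_mult by (rule imageI) (auto simp: monomial_def free_algebra_simps)
  moreover have "(\<lambda>x. ?g \<odot> x \<odot> inv\<^bsub>Cl\<^esub> ?g) ` range cl_vec = range cl_vec"
  proof -
    have "surj (\<lambda>x. reflect v (reflect w x))"
      using reflect_reflect[OF v] reflect_reflect[OF w] by (intro surjI[of _ "\<lambda>x. reflect w (reflect v x)"]) simp
    then have "range (\<lambda>x. cl_vec (reflect v (reflect w x))) = range cl_vec"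
      by (metis image_image)
    then show ?thesis by (simp add: image_image conj)
  qed
  moreover have "cl_rev ?g = ?h"
  proof -
    have "monomial [v, w] \<circ> rev = monomial [w, v]" by (auto simp: monomial_def fun_eq_iff rev_swap)
    then show ?thesis by (simp add: cl_vec_mult cl_rev_cl_of)
  qed
  ultimately show "?g \<in> GV"
    unfolding GV_def Spin_def Pin_def using inv(1) gh by auto
  show "vec_act ?g x = reflect v (reflect w x)"
    by (rule vec_act_eqI) (simp add: conj)
qed

lemma minus_one_in_GV:
  shows "cl_scalar (-1) \<in> GV" "vec_act (cl_scalar (-1)) x = x"
    "spin_act (cl_scalar (-1)) = mat_scale (-1) (mat_one P)"
proof -
  let ?m = "\<lambda>u :: 'v list. -1 * monomial [] u"
  have m: "?m \<in> carrier free_algebra" by (intro scaled_in_carrier monomial_in_carrier)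
  have sq: "cl_scalar (-1) \<odot> cl_scalar (-1) = \<one>\<^bsub>Cl\<^esub>"
    unfolding cl_scalar_def[of "-1"] cl_of_mult[OF m m] scalar_mult_free cl_one by simp
  note inv = cl_inv_eqI[OF cl_scalar_in cl_scalar_in sq sq]
  have conj: "cl_scalar (-1) \<odot> cl_vec x \<odot> inv\<^bsub>Cl\<^esub> cl_scalar (-1) = cl_vec x" for x
  proof -
    have "cl_scalar (-1) \<odot> cl_vec x \<odot> cl_scalar (-1) =
        cl_of ((\<lambda>u. -1 * monomial [x] u) \<star> ?m)"
      unfolding cl_vec_def cl_scalar_mult[OF monomial_in_carrier]
      unfolding cl_scalar_def by (rule cl_of_mult[OF scaled_in_carrier[OF monomial_in_carrier] m])
    then show ?thesis unfolding inv(2) free_mult_scalar by (simp add: cl_vec_def)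
  qed
  have "cl_scalar (-1) \<in> cl_even"
    unfolding cl_even_def cl_scalar_def using m by (intro imageI) (auto simp: monomial_def)
  moreover have "cl_rev (cl_scalar (-1)) = cl_scalar (-1)"
  proof -
    have "?m \<circ> rev = ?m" by (auto simp: monomial_def fun_eq_iff)
    then show ?thesis unfolding cl_scalar_def cl_rev_cl_of[OF m] by simp
  qed
  ultimately show "cl_scalar (-1) \<in> GV"
    unfolding GV_def Spin_def Pin_def using inv(1) sq conj by (auto simp: image_image)
  show "vec_act (cl_scalar (-1)) x = x"
    by (rule vec_act_eqI) (simp add: conj)
  show "spin_act (cl_scalar (-1)) = mat_scale (-1) (mat_one P)"
    unfolding cl_scalar_def spin_act_cl_of[OF m]
    using spin_free_scale[OF monomial_in_carrier, of "-1" "[]"]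
    by (auto simp: fun_eq_iff mat_scale_def spin_free_monomial P_def)
qed

lemma inv_in_GV:
  assumes "g \<in> GV"
  shows "inv\<^bsub>Cl\<^esub> g \<in> GV"
proof -
  have Pin: "g \<in> Pin" and even: "odd N \<Longrightarrow> g \<in> cl_even"
    using assms by (auto simp: GV_def Spin_def split: if_splits)
  obtain f where f: "f \<in> carrier free_algebra" "g = cl_of f" "cl_of (f \<circ> rev) = inv\<^bsub>Cl\<^esub> g"
    using GV_rep[OF assms] by metis
  have u: "g \<in> Units Cl" using GV_Units[OF assms] .
  \<comment> \<open>Reversal preserves word lengths, so the inverse has the same degree as
    \<open>g\<close>; the predicate \<open>p\<close> covers the even and the odd case at
    once.\<close>
  have hom: "inv\<^bsub>Cl\<^esub> g \<in> A" if hA: "g \<in> A" "A = cl_even \<or> A = cl_odd" for A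
  proof -
    have "\<exists>p. A = cl_of ` {f \<in> carrier free_algebra. \<forall>w. f w \<noteq> 0 \<longrightarrow> p (length w)}"
      using hA(2)
    proof
      assume "A = cl_even"
      then show ?thesis unfolding cl_even_def by (intro exI[of _ even])
    next
      assume "A = cl_odd"
      then show ?thesis unfolding cl_odd_def by (intro exI[of _ odd])
    qed
    then obtain p :: "nat \<Rightarrow> bool" where A: "A = cl_of ` {f \<in> carrier free_algebra. \<forall>w. f w \<noteq> 0 \<longrightarrow> p (length w)}" ..
    then obtain f' where f': "f' \<in> carrier free_algebra" "g = cl_of f'" "\<forall>w. f' w \<noteq> 0 \<longrightarrow> p (length w)"
      using hA(1) unfolding A by blast
    have "inv\<^bsub>Cl\<^esub> g = cl_of (f' \<circ> rev)"
      using f f' cl_rev_cl_of by metis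
    moreover have "f' \<circ> rev \<in> {f \<in> carrier free_algebra. \<forall>w. f w \<noteq> 0 \<longrightarrow> p (length w)}"
    proof (intro CollectI conjI allI impI)
      show "f' \<circ> rev \<in> carrier free_algebra" by (rule rev_in_carrier[OF f'(1)])
      fix w assume "(f' \<circ> rev) w \<noteq> 0"
      then show "p (length w)" using f'(3)[rule_format, of "rev w"] by simp
    qed
    ultimately show ?thesis unfolding A by blast
  qed
  have "cl_rev (inv\<^bsub>Cl\<^esub> g) = g"
  proof -
    have "(f \<circ> rev) \<circ> rev = f" by (simp add: fun_eq_iff)
    then show ?thesis using f cl_rev_cl_of[OF rev_in_carrier[OF f(1)]] by simp
  qed
  moreover have "(\<lambda>x. inv\<^bsub>Cl\<^esub> g \<odot> x \<odot> inv\<^bsub>Cl\<^esub> (inv\<^bsub>Cl\<^esub> g)) ` range cl_vec = range cl_vec"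
  proof -
    have c: "g \<in> carrier Cl" "inv\<^bsub>Cl\<^esub> g \<in> carrier Cl" using u by (auto simp: C.Units_closed)
    have *: "inv\<^bsub>Cl\<^esub> g \<odot> (g \<odot> cl_vec x \<odot> inv\<^bsub>Cl\<^esub> g) \<odot> g = cl_vec x" for x
    proof -
      have "inv\<^bsub>Cl\<^esub> g \<odot> (g \<odot> cl_vec x \<odot> inv\<^bsub>Cl\<^esub> g) \<odot> g =
          (inv\<^bsub>Cl\<^esub> g \<odot> g) \<odot> cl_vec x \<odot> (inv\<^bsub>Cl\<^esub> g \<odot> g)"
        using c by (simp only: C.m_assoc C.m_closed cl_vec_in)
      then show ?thesis using u by simp
    qed
    have eq: "range cl_vec = (\<lambda>x. g \<odot> x \<odot> inv\<^bsub>Cl\<^esub> g) ` range cl_vec"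
      using Pin by (simp add: Pin_def)
    have "(\<lambda>x. inv\<^bsub>Cl\<^esub> g \<odot> x \<odot> g) ` range cl_vec =
      (\<lambda>x. inv\<^bsub>Cl\<^esub> g \<odot> x \<odot> g) ` (\<lambda>x. g \<odot> x \<odot> inv\<^bsub>Cl\<^esub> g) ` range cl_vec"
      by (rule arg_cong[OF eq])
    also have "\<dots> = range cl_vec" by (simp add: image_image *)
    finally show ?thesis using u by (simp add: C.Units_inv_inv)
  qed
  ultimately have "inv\<^bsub>Cl\<^esub> g \<in> Units Cl" "g \<in> cl_even \<union> cl_odd \<Longrightarrow> inv\<^bsub>Cl\<^esub> g \<in> Pin"
    unfolding Pin_def using u hom by auto
  then show ?thesis
    using Pin even hom unfolding GV_def Spin_def by (auto simp: Pin_def)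
qed

end

section \<open>Regular functions\<close>

lemma regular_const: "regular_function R \<eta> G (\<lambda>_. c)"
  unfolding regular_function_def using polynomial_function.intros(1) by blast

lemma regular_linear: "linear_functional R \<eta> L \<Longrightarrow> regular_function R \<eta> G L"
  unfolding regular_function_def using polynomial_function.intros(2) by blast

lemma regular_add:
  assumes "regular_function R \<eta> G f" "regular_function R \<eta> G h"
  shows "regular_function R \<eta> G (\<lambda>g. f g + h g)"
proof -
  obtain p q where "polynomial_function R \<eta> p" "polynomial_function R \<eta> q" "\<forall>g\<in>G. f g = p g" "\<forall>g\<in>G. h g = q g"
    using assms unfolding regular_function_def by blast
  then show ?thesis
    unfolding regular_function_def by (intro exI[of _ "\<lambda>g. p g + q g"]) (auto intro: polynomial_function.intros)
qed

lemma regular_mult: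
  assumes "regular_function R \<eta> G f" "regular_function R \<eta> G h"
  shows "regular_function R \<eta> G (\<lambda>g. f g * h g)"
proof -
  obtain p q where "polynomial_function R \<eta> p" "polynomial_function R \<eta> q" "\<forall>g\<in>G. f g = p g" "\<forall>g\<in>G. h g = q g"
    using assms unfolding regular_function_def by blast
  then show ?thesis
    unfolding regular_function_def by (intro exI[of _ "\<lambda>g. p g * q g"]) (auto intro: polynomial_function.intros)
qed

lemma regular_sum: "(\<And>i. i \<in> A \<Longrightarrow> regular_function R \<eta> G (f i)) \<Longrightarrow> regular_function R \<eta> G (\<lambda>g. \<Sum>i\<in>A. f i g)"
  by (induction A rule: infinite_finite_induct) (auto intro: regular_const regular_add)

lemma regular_cong:
  "(\<And>g. g \<in> G \<Longrightarrow> f g = h g) \<Longrightarrow> regular_function R \<eta> G f \<longleftrightarrow> regular_function R \<eta> G h"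
  unfolding regular_function_def by auto

section \<open>The modules\<close>

context spin_setup
begin

abbreviation M :: "colour \<Rightarrow> (('v list \<Rightarrow> complex) set, label) based_module" where
  "M x \<equiv> (case x of \<SS> \<Rightarrow> S_module | \<VV> \<Rightarrow> V_module)"

abbreviation gm :: "colour \<Rightarrow> ('v list \<Rightarrow> complex) set \<Rightarrow> label \<Rightarrow> label \<Rightarrow> complex" where
  "gm x g a b \<equiv> snd (M x) g [a] [b]"

definition act :: "colour list \<Rightarrow> ('v list \<Rightarrow> complex) set \<Rightarrow> (label list \<Rightarrow> complex) \<Rightarrow> label list \<Rightarrow> complex" where
  "act X g = app (word_basis X) (snd (inc_obj X) g)"

lemma basis_simps: "basis \<SS> = SpinL ` P" "basis \<VV> = VecL ` {1..N}"
  by (simp_all add: basis_def P_def)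

lemma finite_basis [simp]: "finite (basis x)"
  by (cases x) (simp_all add: basis_simps)

lemma finite_word_basis [simp]: "finite (word_basis X)"
  unfolding word_basis_def by (rule finite_listset) auto

lemma word_basis_Nil [simp]: "word_basis [] = {[]}"
  by (simp add: word_basis_def)

lemma in_word_basis_Cons: "u \<in> word_basis (x # X) \<longleftrightarrow> (\<exists>a v. u = a # v \<and> a \<in> basis x \<and> v \<in> word_basis X)"
  by (auto simp: word_basis_def set_Cons_def)

lemma Cons_in_word_basis [simp]: "a # v \<in> word_basis (x # X) \<longleftrightarrow> a \<in> basis x \<and> v \<in> word_basis X"
  by (simp add: in_word_basis_Cons)

lemma length_word_basis: "u \<in> word_basis X \<Longrightarrow> length u = length X"
  by (auto simp: word_basis_def dest: length_listset)

lemma word_basis_append: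
  "u \<in> word_basis (X @ Y) \<longleftrightarrow> take (length X) u \<in> word_basis X \<and> drop (length X) u \<in> word_basis Y"
proof -
  have "u \<in> word_basis (X @ Y)" if "take (length X) u \<in> word_basis X" "drop (length X) u \<in> word_basis Y"
    using append_in_listset[of "take (length X) u" "map basis X" "drop (length X) u" "map basis Y"]
      that length_word_basis[OF that(1)] by (simp add: word_basis_def)
  then show ?thesis
    using listset_append_take_drop[of u "map basis X" "map basis Y"] by (auto simp: word_basis_def)
qed

lemma append_in_word_basis:
  "length u = length X \<Longrightarrow> u @ v \<in> word_basis (X @ Y) \<longleftrightarrow> u \<in> word_basis X \<and> v \<in> word_basis Y"
  by (simp add: word_basis_append)

lemma sum_word_basis_Cons: "(\<Sum>u\<in>word_basis (x # X). F u) = (\<Sum>a\<in>basis x. \<Sum>u\<in>word_basis X. F (a # u))"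
  unfolding word_basis_def list.map by (rule sum_listset_Cons)

lemma fst_M: "fst (M x) = [basis x]"
  by (cases x) (simp_all add: S_module_def V_module_def)

lemma fst_inc_obj: "fst (inc_obj X) = map basis X"
  by (induction X) (simp_all add: trivial_module_def module_tensor_def fst_M)

lemma listset_fst_inc_obj: "listset (fst (inc_obj X)) = word_basis X"
  by (simp add: fst_inc_obj word_basis_def)

lemma snd_M_mats: "snd (M x) g \<in> mats (word_basis [x]) (word_basis [x])"
  by (cases x) (simp_all add: S_module_def V_module_def word_basis_def)

lemma snd_inc_obj_Cons: "snd (inc_obj (x # X)) g = mat_tensor (Suc 0) (Suc 0) (snd (M x) g) (snd (inc_obj X) g)"
  by (simp add: module_tensor_def fst_M)

lemma snd_inc_obj_mats: "snd (inc_obj X) g \<in> mats (word_basis X) (word_basis X)"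
proof (induction X)
  case Nil
  then show ?case by (simp add: trivial_module_def)
next
  case (Cons x X)
  have "mat_tensor (Suc 0) (Suc 0) (snd (M x) g) (snd (inc_obj X) g) \<in>
      mats (listset ([basis x] @ map basis X)) (listset ([basis x] @ map basis X))"
    by (rule mats_tensor) (use snd_M_mats[of x g] Cons in \<open>simp_all add: word_basis_def\<close>)
  then show ?case by (simp add: snd_inc_obj_Cons word_basis_def del: inc_obj.simps)
qed

lemma inc_obj_eqI: "fst A = fst B \<Longrightarrow> (\<And>g. snd A g = snd B g) \<Longrightarrow> A = B"
  by (simp add: prod_eq_iff fun_eq_iff)

lemma snd_inc_obj_append:
  "snd (inc_obj (X @ Y)) g = mat_tensor (length X) (length X) (snd (inc_obj X) g) (snd (inc_obj Y) g)"
proof (induction X)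
  case Nil
  then show ?case by (simp add: trivial_module_def mat_tensor_unit_left)
next
  case (Cons x X)
  then show ?case
    using mat_tensor_assoc[of "Suc 0" "length X" "Suc 0" "length X" "snd (M x) g" "snd (inc_obj X) g" "snd (inc_obj Y) g"]
    by (simp add: snd_inc_obj_Cons del: inc_obj.simps)
qed

lemma inc_obj_append: "inc_obj (X @ Y) = module_tensor (inc_obj X) (inc_obj Y)"
  by (rule inc_obj_eqI) (simp_all add: fst_inc_obj module_tensor_def snd_inc_obj_append)

lemma snd_inc_obj_single: "snd (inc_obj [x]) g = snd (M x) g"
proof -
  have "mat_tensor (length [basis x]) (length [basis x]) (snd (M x) g) (mat_one {[]}) = snd (M x) g"
    by (rule mat_tensor_unit_right) (use snd_M_mats[of x g] in \<open>simp add: word_basis_def\<close>)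
  then show ?thesis by (simp add: module_tensor_def fst_M trivial_module_def)
qed

lemma act_Nil: "act [] g w [] = w []"
  by (simp add: act_def trivial_module_def app_def mat_one_def mat_of_def)

lemma act_append:
  "act (X @ Y) g w u = act X g (\<lambda>x. act Y g (\<lambda>y. w (x @ y)) (drop (length X) u)) (take (length X) u)"
  unfolding act_def snd_inc_obj_append word_basis_def map_append by (subst app_tensor) simp_all

lemma act_Cons: "act (x # X) g w (a # u) = (\<Sum>b\<in>basis x. gm x g a b * act X g (\<lambda>v. w (b # v)) u)"
proof -
  have "act ([x] @ X) g w (a # u) = act [x] g (\<lambda>x. act X g (\<lambda>y. w (x @ y)) u) [a]"
    unfolding act_append by simp
  also have "\<dots> = (\<Sum>b\<in>basis x. gm x g a b * act X g (\<lambda>v. w (b # v)) u)"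
    unfolding act_def[of "[x]"] snd_inc_obj_single by (simp add: app_def sum_word_basis_Cons)
  finally show ?thesis by simp
qed

lemma gm_S: "I \<in> P \<Longrightarrow> J \<in> P \<Longrightarrow> gm \<SS> g (SpinL J) (SpinL I) = spin_act g J I"
  by (simp add: S_module_def mat_of_def basis_simps image_iff)

lemma gm_V: "i \<in> {1..N} \<Longrightarrow> j \<in> {1..N} \<Longrightarrow> gm \<VV> g (VecL i) (VecL j) = \<Phi> (e i) (vec_act g (e j))"
  by (simp add: V_module_def mat_of_def basis_simps image_iff)

lemma sum_basis_S: "(\<Sum>a\<in>basis \<SS>. F a) = (\<Sum>I\<in>P. F (SpinL I))"
  unfolding basis_simps by (subst sum.reindex) (auto simp: inj_on_def)

lemma sum_basis_V: "(\<Sum>a\<in>basis \<VV>. F a) = (\<Sum>i=1..N. F (VecL i))"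
  unfolding basis_simps by (subst sum.reindex) (auto simp: inj_on_def)

lemma vec_act_expand:
  assumes "g \<in> GV"
  shows "vec_act g v = (\<Sum>k=1..N. scale (\<Phi> (e k) v) (vec_act g (e k)))"
proof -
  have zero: "vec_act g 0 = 0" using vec_act_lin[OF assms, of 0 0 0 0] by simp
  have sum: "vec_act g (\<Sum>k\<in>A. scale (c k) (f k)) = (\<Sum>k\<in>A. scale (c k) (vec_act g (f k)))"
    if "finite A" for A :: "nat set" and c f
    using that
  proof (induction A rule: finite_induct)
    case (insert k A)
    then show ?case using vec_act_lin[OF assms, of "c k" "f k" 1 "\<Sum>k\<in>A. scale (c k) (f k)"] by simp
  qed (simp add: zero)
  show ?thesis by (subst expand[of v]) (rule sum, simp)
qed

lemma form_sum_right: "\<Phi> w (\<Sum>i\<in>A. f i) = (\<Sum>i\<in>A. \<Phi> w (f i))"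
  using form_sum_left[of f A w] by (simp add: form_symmetric)

lemma gm_mult:
  assumes "g \<in> GV" "h \<in> GV" "a \<in> basis x" "c \<in> basis x"
  shows "gm x (g \<odot> h) a c = (\<Sum>b\<in>basis x. gm x g a b * gm x h b c)"
proof (cases x)
  case \<SS>
  then obtain J I where "a = SpinL J" "c = SpinL I" "J \<in> P" "I \<in> P"
    using assms by (auto simp: basis_simps)
  then show ?thesis
    unfolding \<SS> sum_basis_S using assms GV_carrier
    by (simp add: gm_S[simplified] spin_act_mult mat_mul_def)
next
  case \<VV>
  then obtain i j where ij: "a = VecL i" "c = VecL j" "i \<in> {1..N}" "j \<in> {1..N}"
    using assms by (auto simp: basis_simps)
  have "\<Phi> (e i) (vec_act g (vec_act h (e j))) =
    (\<Sum>k=1..N. \<Phi> (e i) (vec_act g (e k)) * \<Phi> (e k) (vec_act h (e j)))"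
    by (subst vec_act_expand[OF assms(1)]) (simp add: form_sum_right form_scale_right mult.commute)
  then show ?thesis
    unfolding \<VV> sum_basis_V using assms ij by (simp add: gm_V[simplified] vec_act_mult)
qed

lemma gm_one:
  assumes "a \<in> basis x" "b \<in> basis x"
  shows "gm x \<one>\<^bsub>Cl\<^esub> a b = of_bool (a = b)"
proof (cases x)
  case \<SS>
  then show ?thesis using assms
    by (auto simp: basis_simps gm_S[simplified] spin_act_one mat_one_def mat_of_def)
next
  case \<VV>
  then show ?thesis using assms
    by (auto simp: basis_simps gm_V[simplified] vec_act_one form_e)
qed

interpretation C: ring Cl by (rule ring_Cl)

lemma gm_inv:
  assumes "g \<in> GV" "a \<in> basis x" "c \<in> basis x"
  shows "(\<Sum>b\<in>basis x. gm x g a b * gm x (inv\<^bsub>Cl\<^esub> g) b c) = of_bool (a = c)"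
  using gm_mult[OF assms(1) inv_in_GV[OF assms(1)] assms(2,3)] gm_one[OF assms(2,3)] GV_Units[OF assms(1)]
  by simp

subsection \<open>The forms in terms of complementary labels\<close>

text \<open>In the chosen bases both forms are monomial: the basis vector labelled \<open>a\<close>
  pairs only with the one labelled \<open>co a\<close>, with value \<open>bt a\<close>. This lets
  the spin and the vector module share the same computations.\<close>

fun co :: "label \<Rightarrow> label" where
  "co (SpinL I) = SpinL ({1..n} - I)"
| "co (VecL i) = VecL i"

fun bt :: "label \<Rightarrow> complex" where
  "bt (SpinL I) = bb I"
| "bt (VecL i) = 1"

text \<open>The scalar of the crossing is also the symmetry sign of the form:
  \<open>bt (co a)\<close> and \<open>bt a\<close> differ by \<open>sg x x\<close>.\<close>

definition sg :: "colour \<Rightarrow> colour \<Rightarrow> complex" where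
  "sg x y = (if x = \<SS> \<and> y = \<SS> then \<sigma> else 1)"

lemma compl_in_P: "{1..n} - I \<in> P"
  by (auto simp: in_P_iff)

lemma co_in [simp]: "a \<in> basis x \<Longrightarrow> co a \<in> basis x"
  by (cases x) (auto simp: basis_simps compl_in_P)

lemma co_co [simp]: "a \<in> basis x \<Longrightarrow> co (co a) = a"
  by (cases x) (auto simp: basis_simps in_P_iff double_diff)

lemma co_eq_iff: "a \<in> basis x \<Longrightarrow> b \<in> basis x \<Longrightarrow> b = co a \<longleftrightarrow> a = co b"
  by (metis co_co)

lemma co_inj: "a \<in> basis x \<Longrightarrow> b \<in> basis x \<Longrightarrow> co a = co b \<longleftrightarrow> a = b"
  by (metis co_co)

lemma bt_square [simp]: "bt a * bt a = 1"
  by (cases a) auto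

lemma bt_bt_left [simp]: "bt a * (bt a * c) = c"
  by (metis bt_square mult.assoc mult_1)

lemma bt_co: "a \<in> basis x \<Longrightarrow> bt (co a) = sg x x * bt a"
proof (cases x)
  case \<SS>
  assume "a \<in> basis x"
  then obtain I where I: "I \<in> P" "a = SpinL I" using \<SS> by (auto simp: basis_simps)
  have "bb ({1..n} - I) = (bb I * bb ({1..n} - I)) * bb I"
    using bb_square[of I] by (metis mult.commute mult.left_commute mult.right_neutral)
  then show ?thesis using I \<SS> by (simp add: bb_complement sg_def)
qed (auto simp: basis_simps sg_def)

lemma sg_square [simp]: "sg x y * sg x y = 1" "sg x y * (sg x y * c) = c"
proof -
  have "\<sigma> * \<sigma> = 1" by (simp add: \<sigma>_def flip: power_mult_distrib)
  then show "sg x y * sg x y = 1" by (simp add: sg_def)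
  then show "sg x y * (sg x y * c) = c" by (metis mult.assoc mult_1)
qed

lemma sg_commute: "sg x y = sg y x"
  by (auto simp: sg_def)

lemma label_form_eq:
  assumes "a \<in> basis x" "b \<in> basis x"
  shows "label_form a b = (if b = co a then bt a else 0)"
  using assms by (cases x) (auto simp: basis_simps label_form_def spin_form_eq form_e)

lemma sum_co: "(\<Sum>a\<in>basis x. F (co a)) = (\<Sum>a\<in>basis x. F a)"
  by (rule sum.reindex_bij_witness[of _ co co]) auto

text \<open>The vector labelled \<open>co a\<close> has value \<open>bt (co a)\<close> against
  \<open>a\<close> and vanishes against all other labels, and this sign is its own inverse.\<close>

lemma left_dual_eq:
  assumes "a \<in> basis x" "b \<in> basis x"
  shows "left_dual (basis x) a b = (if b = co a then bt b else 0)"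
proof -
  let ?c = "\<lambda>b. if b \<in> basis x \<and> b = co a then bt b else 0"
  have s: "(\<Sum>z\<in>basis x. c z * label_form z y) = c (co y) * bt (co y)" if "y \<in> basis x" for c y
  proof -
    have "(\<Sum>z\<in>basis x. c z * label_form z y) = (\<Sum>z\<in>basis x. if z = co y then c (co y) * bt (co y) else 0)"
      using that by (intro sum.cong HOL.refl) (auto simp: label_form_eq co_eq_iff)
    then show ?thesis using that by simp
  qed
  have "left_dual (basis x) a = ?c"
    unfolding left_dual_def
  proof (rule the_equality)
    show "(\<forall>z. z \<notin> basis x \<longrightarrow> ?c z = 0) \<and>
      (\<forall>y\<in>basis x. (\<Sum>z\<in>basis x. ?c z * label_form z y) = of_bool (a = y))"
      using assms by (auto simp only: s) (auto simp: co_inj)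
    fix c assume c: "(\<forall>z. z \<notin> basis x \<longrightarrow> c z = 0) \<and>
      (\<forall>y\<in>basis x. (\<Sum>z\<in>basis x. c z * label_form z y) = of_bool (a = y))"
    show "c = ?c"
    proof
      fix z
      show "c z = ?c z"
      proof (cases "z \<in> basis x")
        case True
        then have "c z * bt z = of_bool (a = co z)" using c s[of "co z" c] by auto
        then have "c z * bt z * bt z = of_bool (a = co z) * bt z" by simp
        then show ?thesis using True assms co_eq_iff[OF assms(1) True] by (auto simp: mult.assoc)
      qed (use c in auto)
    qed
  qed
  then show ?thesis using assms by simp
qed

lemma gm_form:
  assumes "g \<in> GV" "a \<in> basis x" "b \<in> basis x"
  shows "(\<Sum>c\<in>basis x. bt c * gm x g c a * gm x g (co c) b) = (if b = co a then bt a else 0)"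
proof (cases x)
  case \<SS>
  then obtain I J where IJ: "a = SpinL I" "b = SpinL J" "I \<in> P" "J \<in> P"
    using assms by (auto simp: basis_simps)
  have "mat_mul P BS (spin_act g) K J = bb K * spin_act g ({1..n} - K) J" if "K \<in> P" for K
  proof -
    have "mat_mul P BS (spin_act g) K J =
      (\<Sum>L\<in>P. if L = {1..n} - K then bb K * spin_act g ({1..n} - K) J else 0)"
      unfolding mat_mul_def using that
      by (intro sum.cong HOL.refl) (auto simp: BS_def mat_of_def spin_form_eq)
    then show ?thesis by (simp add: compl_in_P)
  qed
  then have "mat_mul P (tr_mat (spin_act g)) (mat_mul P BS (spin_act g)) I J =
      (\<Sum>K\<in>P. spin_act g K I * (bb K * spin_act g ({1..n} - K) J))"
    by (subst mat_mul_def) (simp add: tr_mat_def)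
  then have "(\<Sum>K\<in>P. spin_act g K I * (bb K * spin_act g ({1..n} - K) J)) = BS I J"
    by (simp add: spin_act_form[OF assms(1)])
  then show ?thesis
    using IJ unfolding \<SS> sum_basis_S
    by (simp add: gm_S[simplified] compl_in_P BS_def mat_of_def spin_form_eq ac_simps)
next
  case \<VV>
  then obtain i j where ij: "a = VecL i" "b = VecL j" "i \<in> {1..N}" "j \<in> {1..N}"
    using assms by (auto simp: basis_simps)
  have "(\<Sum>k=1..N. \<Phi> (e k) (vec_act g (e i)) * \<Phi> (e k) (vec_act g (e j))) = of_bool (i = j)"
    using ij by (simp add: parseval[symmetric] vec_act_form[OF assms(1)] form_e)
  then show ?thesis
    using ij unfolding \<VV> sum_basis_V by (auto simp: gm_V[simplified])
qed

text \<open>The inverse is the adjoint, in entries. The invariance of the form is multiplied by the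
  matrix of the inverse, and the double sum is evaluated in both orders.\<close>

lemma gm_co:
  assumes "g \<in> GV" "a \<in> basis x" "d \<in> basis x"
  shows "gm x g (co d) a = bt (co d) * bt a * gm x (inv\<^bsub>Cl\<^esub> g) (co a) d"
proof -
  let ?h = "inv\<^bsub>Cl\<^esub> g"
  have "(\<Sum>b\<in>basis x. (\<Sum>c\<in>basis x. bt c * gm x g c a * gm x g (co c) b) * gm x ?h b d) =
    (\<Sum>c\<in>basis x. bt c * gm x g c a * (\<Sum>b\<in>basis x. gm x g (co c) b * gm x ?h b d))"
    unfolding sum_distrib_right sum_distrib_left by (subst sum.swap) (simp add: mult.assoc)
  also have "\<dots> = (\<Sum>c\<in>basis x. if c = co d then bt (co d) * gm x g (co d) a else 0)"
    using assms(3) by (intro sum.cong HOL.refl) (auto simp: gm_inv[OF assms(1) _ assms(3)] co_eq_iff)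
  also have "\<dots> = bt (co d) * gm x g (co d) a" using assms by simp
  finally have "bt (co d) * gm x g (co d) a =
    (\<Sum>b\<in>basis x. (\<Sum>c\<in>basis x. bt c * gm x g c a * gm x g (co c) b) * gm x ?h b d)" ..
  also have "\<dots> = (\<Sum>b\<in>basis x. if b = co a then bt a * gm x ?h (co a) d else 0)"
    by (intro sum.cong HOL.refl) (auto simp: gm_form[OF assms(1,2)])
  also have "\<dots> = bt a * gm x ?h (co a) d" using assms by simp
  finally show ?thesis by (metis bt_bt_left mult.assoc)
qed

text \<open>Invariance of the element inserted by a cup: \<open>gm_co\<close> trades one of the two
  factors for an entry of the inverse.\<close>

lemma gm_dual:
  assumes "g \<in> GV" "a \<in> basis x" "b \<in> basis x"
  shows "(\<Sum>c\<in>basis x. gm x g a c * gm x g b (co c) * bt (co c)) = (if b = co a then bt b else 0)"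
proof -
  have "gm x g b (co c) * bt (co c) = bt b * gm x (inv\<^bsub>Cl\<^esub> g) c (co b)" if "c \<in> basis x" for c
  proof -
    have "gm x g b (co c) = bt b * bt (co c) * gm x (inv\<^bsub>Cl\<^esub> g) c (co b)"
      using gm_co[OF assms(1) co_in[OF that] co_in[OF assms(3)]] that assms(3) by simp
    then show ?thesis by (simp add: ac_simps)
  qed
  then have "(\<Sum>c\<in>basis x. gm x g a c * gm x g b (co c) * bt (co c)) =
    bt b * (\<Sum>c\<in>basis x. gm x g a c * gm x (inv\<^bsub>Cl\<^esub> g) c (co b))"
    unfolding sum_distrib_left by (intro sum.cong HOL.refl) (simp add: ac_simps)
  then show ?thesis
    using assms by (simp add: gm_inv[OF assms(1)]) (metis co_eq_iff)
qed

subsection \<open>Rationality\<close>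

lemma bb_bb_left: "bb I * (bb I * c) = c"
  by (metis bb_square mult.assoc mult_1)

text \<open>By adjointness the inverse has the entries of \<open>g\<close> up to position and sign,
  and hence regular ones.\<close>

lemma spin_act_inv_entry:
  assumes "g \<in> GV" "I \<in> P" "J \<in> P"
  shows "spin_act (inv\<^bsub>Cl\<^esub> g) I J = bb ({1..n} - I) * bb ({1..n} - J) * spin_act g ({1..n} - J) ({1..n} - I)"
proof -
  have IJ: "SpinL I \<in> basis \<SS>" "SpinL J \<in> basis \<SS>" using assms by (auto simp: basis_simps)
  have dd: "{1..n} - ({1..n} - I) = I" using assms by (simp add: in_P_iff double_diff)
  have "spin_act g ({1..n} - J) ({1..n} - I) = bb ({1..n} - J) * bb ({1..n} - I) * spin_act (inv\<^bsub>Cl\<^esub> g) I J"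
    using gm_co[OF assms(1) co_in[OF IJ(1)] IJ(2)] assms by (simp add: gm_S[simplified] compl_in_P dd)
  then show ?thesis
    by (simp add: mult.assoc bb_bb_left)
qed

lemma spin_act_regular: "regular_function Cl cl_scalar GV (\<lambda>g. spin_act g J I)"
  by (rule regular_linear[OF spin_act_linear])

lemma spin_act_inv_regular:
  assumes "I \<in> P" "J \<in> P"
  shows "regular_function Cl cl_scalar GV (\<lambda>g. spin_act (inv\<^bsub>Cl\<^esub> g) I J)"
  by (subst regular_cong[OF spin_act_inv_entry[OF _ assms]])
    (auto intro: regular_mult[OF regular_const spin_act_regular])

lemma trace_form: "trace (mat_mul P (spin_vec v) (spin_vec w)) = 2 ^ n * \<Phi> v w"
proof -
  have "2 * trace (mat_mul P (spin_vec v) (spin_vec w)) =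
    trace (mat_mul P (spin_vec v) (spin_vec w)) + trace (mat_mul P (spin_vec w) (spin_vec v))"
    by (simp add: trace_mul_commute)
  also have "\<dots> = (\<Sum>I\<in>P. 2 * \<Phi> v w * mat_one P I I)"
    unfolding trace_def sum.distrib[symmetric] spin_vec_clifford ..
  also have "\<dots> = 2 * \<Phi> v w * 2 ^ n"
    using trace_one by (simp add: trace_def sum_distrib_left[symmetric])
  finally show ?thesis by simp
qed

text \<open>The trace of \<open>u g v g^(-1)\<close> on the spin module is
  \<open>2 ^ n * \<Phi>(u, g v)\<close>. So the matrix of \<open>g\<close> on \<open>V\<close> is
  polynomial in the entries of \<open>g\<close> and of its inverse, and the vector module is
  algebraic.\<close>

lemma vec_act_entry:
  assumes "g \<in> GV"
  shows "\<Phi> u (vec_act g v) = inverse (2 ^ n) * (\<Sum>I\<in>P. \<Sum>J\<in>P. spin_vec u I J *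
    (\<Sum>K\<in>P. (\<Sum>L\<in>P. spin_act g J L * spin_vec v L K) * spin_act (inv\<^bsub>Cl\<^esub> g) K I))"
proof -
  have "2 ^ n * \<Phi> u (vec_act g v) = (\<Sum>I\<in>P. \<Sum>J\<in>P. spin_vec u I J *
    (\<Sum>K\<in>P. (\<Sum>L\<in>P. spin_act g J L * spin_vec v L K) * spin_act (inv\<^bsub>Cl\<^esub> g) K I))"
    unfolding trace_form[symmetric] spin_vec_vec_act[OF assms] by (simp add: trace_def mat_mul_def)
  then show ?thesis by (simp add: field_simps)
qed

lemma vec_act_regular: "regular_function Cl cl_scalar GV (\<lambda>g. \<Phi> u (vec_act g v))"
  by (subst regular_cong[OF vec_act_entry], assumption)
    (intro regular_mult regular_sum regular_const spin_act_regular spin_act_inv_regular)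

lemma gm_regular:
  assumes "a \<in> basis x" "b \<in> basis x"
  shows "regular_function Cl cl_scalar GV (\<lambda>g. gm x g a b)"
  using assms by (cases x) (auto simp: basis_simps gm_S[simplified] gm_V[simplified] spin_act_regular vec_act_regular)

lemma inc_obj_rep:
  "snd (inc_obj X) \<one>\<^bsub>Cl\<^esub> = mat_one (word_basis X)" (is ?one)
  "g \<in> GV \<Longrightarrow> h \<in> GV \<Longrightarrow> snd (inc_obj X) (g \<odot> h) =
     mat_mul (word_basis X) (snd (inc_obj X) g) (snd (inc_obj X) h)"
proof -
  have M1: "snd (M x) \<one>\<^bsub>Cl\<^esub> = mat_one (listset [basis x])" for x
  proof (intro ext)
    fix u v
    show "snd (M x) \<one>\<^bsub>Cl\<^esub> u v = mat_one (listset [basis x]) u v"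
    proof (cases "u \<in> word_basis [x] \<and> v \<in> word_basis [x]")
      case True
      then obtain a b where "u = [a]" "v = [b]" "a \<in> basis x" "b \<in> basis x"
        by (auto simp: in_word_basis_Cons)
      then show ?thesis by (auto simp: gm_one mat_one_def mat_of_def)
    next
      case False
      then show ?thesis
        using mats_outside[OF snd_M_mats] by (auto simp: mat_one_def mat_of_def word_basis_def simp del: listset.simps)
    qed
  qed
  show ?one
  proof (induction X)
    case (Cons x X)
    then show ?case
      using mat_tensor_one[of "[basis x]" "map basis X"]
      by (simp add: snd_inc_obj_Cons M1 word_basis_def del: inc_obj.simps listset.simps)
  qed (simp add: trivial_module_def)
  assume g: "g \<in> GV" "h \<in> GV"
  have M2: "snd (M x) (g \<odot> h) = mat_mul (listset [basis x]) (snd (M x) g) (snd (M x) h)" for x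
  proof (intro ext)
    fix u v
    show "snd (M x) (g \<odot> h) u v = mat_mul (listset [basis x]) (snd (M x) g) (snd (M x) h) u v"
    proof (cases "u \<in> word_basis [x] \<and> v \<in> word_basis [x]")
      case True
      then obtain a b where "u = [a]" "v = [b]" "a \<in> basis x" "b \<in> basis x"
        by (auto simp: in_word_basis_Cons)
      then show ?thesis
        using gm_mult[OF g] by (simp add: mat_mul_def sum_listset_Cons del: listset.simps(2))
    next
      case False
      then show ?thesis
        using mats_outside[OF snd_M_mats] by (auto simp: mat_mul_def)
    qed
  qed
  show "snd (inc_obj X) (g \<odot> h) = mat_mul (word_basis X) (snd (inc_obj X) g) (snd (inc_obj X) h)"
  proof (induction X)
    case Nil
    show ?case by (simp add: trivial_module_def mat_mul_one_left[OF _ mats_one])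
  next
    case (Cons x X)
    then show ?case
      using mat_tensor_mul[of "[basis x]" "Suc 0" "map basis X" "Suc 0" "snd (M x) g" "snd (inc_obj X) g" "Suc 0"]
      by (simp add: snd_inc_obj_Cons M2 word_basis_def del: inc_obj.simps listset.simps)
  qed
qed

lemma inc_obj_regular:
  "u \<in> word_basis X \<Longrightarrow> v \<in> word_basis X \<Longrightarrow> regular_function Cl cl_scalar GV (\<lambda>g. snd (inc_obj X) g u v)"
proof (induction X arbitrary: u v)
  case Nil
  then show ?case by (simp add: trivial_module_def regular_const)
next
  case (Cons x X)
  then obtain a u' b v' where "u = a # u'" "v = b # v'" "a \<in> basis x" "b \<in> basis x"
    "u' \<in> word_basis X" "v' \<in> word_basis X" by (auto simp: in_word_basis_Cons)
  then show ?case
    using Cons.IH gm_regular by (simp add: snd_inc_obj_Cons mat_tensor_def regular_mult del: inc_obj.simps)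
qed

lemma inc_obj_in: "inc_obj X \<in> Obj G_mod"
  unfolding G_mod_def module_category_def based_modules_def
  using snd_inc_obj_mats[of X] inc_obj_rep(1)[of X] inc_obj_rep(2)[of _ _ X] inc_obj_regular[of _ X] fst_inc_obj[of X]
    listset_fst_inc_obj[of X]
  by (auto simp: case_prod_beta)

end

section \<open>The incarnation functor\<close>

lemma mult_if_zero: "c * (if Q then x else 0) = (if Q then c * x else (0 :: complex))"
  by simp

lemma sum_if_const: "(\<Sum>d\<in>A. if Q then F d else 0) = (if Q then \<Sum>d\<in>A. F d else (0 :: complex))"
  by simp

section \<open>Evaluation of diagrams, soundness of the relations and equivariance\<close>

context spin_setup
begin

definition ev :: "complex diagram \<Rightarrow> (label list \<Rightarrow> complex) \<Rightarrow> label list \<Rightarrow> complex" where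
  "ev d = app (word_basis (src d)) (inc_diagram d)"

text \<open>Structure constants of Clifford multiplication: the coefficient of \<open>b\<close> when
  the vector \<open>a\<close> is applied to \<open>c\<close>.\<close>

definition mm :: "label \<Rightarrow> label \<Rightarrow> label \<Rightarrow> complex" where
  "mm a b c = (case (a, b, c) of (VecL i, SpinL J, SpinL I) \<Rightarrow> gam i J I | _ \<Rightarrow> 0)"

lemma inc_diagram_mats:
  "wf_diagram d \<Longrightarrow> inc_diagram d \<in> mats (word_basis (tgt d)) (word_basis (src d))"
proof (induction d)
  case (Horiz d d')
  then show ?case
    using mats_tensor[of "inc_diagram d" "map basis (tgt d)" "map basis (src d)" "inc_diagram d'"]
    by (simp add: word_basis_def)
qed (auto simp: mats_zero intro: mats_mul mats_add mats_scale)

lemma ev_cong: "(\<And>v. v \<in> word_basis (src d) \<Longrightarrow> w v = w' v) \<Longrightarrow> ev d w = ev d w'"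
  unfolding ev_def by (rule app_cong)

lemma ev_Strand: "u \<in> word_basis X \<Longrightarrow> ev (Strand X) w u = w u"
  by (simp add: ev_def app_one)

lemma ev_comp: "src g = tgt f \<Longrightarrow> ev (g \<circ>\<^sub>d f) w u = ev g (ev f w) u"
  by (simp add: ev_def app_mul)

lemma ev_tensor:
  "ev (f \<otimes>\<^sub>d g) w u =
   ev f (\<lambda>x. ev g (\<lambda>y. w (x @ y)) (drop (length (tgt f)) u)) (take (length (tgt f)) u)"
  unfolding ev_def by (simp add: word_basis_def app_tensor)

lemma ev_plus: "src f = src g \<Longrightarrow> ev (f +\<^sub>d g) w u = ev f w u + ev g w u"
  by (simp add: ev_def app_add)

lemma ev_scale: "ev (c *\<^sub>d f) w u = c * ev f w u"
  by (simp add: ev_def app_scale)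

lemma ev_Cap: "ev (Cap x) w [] = (\<Sum>a\<in>basis x. bt a * w [a, co a])"
proof -
  have "ev (Cap x) w [] = (\<Sum>a\<in>basis x. \<Sum>b\<in>basis x. label_form a b * w [a, b])"
    by (simp add: ev_def app_def sum_word_basis_Cons mat_of_def)
  also have "\<dots> = (\<Sum>a\<in>basis x. \<Sum>b\<in>basis x. if b = co a then bt a * w [a, co a] else 0)"
    by (intro sum.cong HOL.refl) (simp add: label_form_eq)
  finally show ?thesis by simp
qed

lemma ev_Cup: "a \<in> basis x \<Longrightarrow> b \<in> basis x \<Longrightarrow> ev (Cup x) w [a, b] = (if b = co a then bt b * w [] else 0)"
  by (simp add: ev_def app_def mat_of_def left_dual_eq)

lemma ev_Cross:
  assumes "a \<in> basis x" "b \<in> basis y"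
  shows "ev (Cross x y) w [b, a] = sg x y * w [a, b]"
proof -
  have "ev (Cross x y) w [b, a] =
    (\<Sum>a'\<in>basis x. \<Sum>b'\<in>basis y. if b' = b then if a' = a then sg x y * w [a, b] else 0 else 0)"
    unfolding ev_def app_def src.simps sum_word_basis_Cons word_basis_Nil
    using assms by (intro sum.cong HOL.refl) (auto simp: mat_of_def sg_def)
  then show ?thesis using assms by simp
qed

lemma ev_Mu:
  assumes "b \<in> basis \<SS>"
  shows "ev Mu w [b] = (\<Sum>a\<in>basis \<VV>. \<Sum>c\<in>basis \<SS>. mm a b c * w [a, c])"
  unfolding ev_def app_def src.simps sum_word_basis_Cons word_basis_Nil
  using assms by (intro sum.cong HOL.refl) (auto simp: mat_of_def mm_def basis_simps spin_vec_e)

lemma inc_diagram_eqI: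
  assumes "wf_diagram f" "wf_diagram g" "src f = src g" "tgt f = tgt g"
    and "\<And>w u. u \<in> word_basis (tgt f) \<Longrightarrow> ev f w u = ev g w u"
  shows "inc_diagram f = inc_diagram g"
  using inc_diagram_mats[OF assms(1)] inc_diagram_mats[OF assms(2)] assms(3-5)
  by (intro mat_eqI[of _ "word_basis (tgt f)" "word_basis (src f)"]) (auto simp: ev_def)

lemma sum_co_delta:
  "b \<in> basis x \<Longrightarrow> (\<Sum>d\<in>basis x. if b = co d then F d else 0) = F (co b)"
  "b \<in> basis x \<Longrightarrow> (\<Sum>d\<in>basis x. if d = co b then F d else 0) = F (co b)"
proof -
  assume b: "b \<in> basis x"
  have "(\<Sum>d\<in>basis x. if b = co d then F d else 0) = (\<Sum>d\<in>basis x. if d = co b then F d else 0)"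
    using co_eq_iff[OF _ b] by (intro sum.cong HOL.refl) auto
  then show "(\<Sum>d\<in>basis x. if b = co d then F d else 0) = F (co b)"
    "(\<Sum>d\<in>basis x. if d = co b then F d else 0) = F (co b)" using b by simp_all
qed

lemma bt_V: "a \<in> basis \<VV> \<Longrightarrow> bt a = 1" "a \<in> basis \<VV> \<Longrightarrow> co a = a"
  by (auto simp: basis_simps)

lemma kappa_kappa_left [simp]: "\<kappa> * (\<kappa> * c) = c"
  by (metis kappa_square mult.assoc mult_1)

text \<open>This is \<open>gam_adjoint\<close> at complementary labels, and the content of the
  relation \<open>mu_flip\<close>. Replacing \<open>bt (co b)\<close> and \<open>bt (co c)\<close>
  by \<open>bt b\<close> and \<open>bt c\<close> costs \<open>\<sigma>\<close> on either side, which
  cancels.\<close>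

lemma mm_adjoint:
  assumes "a \<in> basis \<VV>" "b \<in> basis \<SS>" "c \<in> basis \<SS>"
  shows "bt b * (bt c * mm a (co c) (co b)) = \<kappa> * mm a b c"
proof -
  obtain k J I where *: "a = VecL k" "b = SpinL J" "c = SpinL I" "k \<in> {1..N}" "J \<in> P" "I \<in> P"
    using assms by (auto simp: basis_simps)
  let ?cJ = "{1..n} - J" and ?cI = "{1..n} - I"
  have dd: "{1..n} - ?cJ = J" "{1..n} - ?cI = I" using * by (auto simp: in_P_iff double_diff)
  have "(\<Sum>K\<in>P. gam k K ?cJ * spin_form K I) = (\<Sum>K\<in>P. if K = ?cI then bb ?cI * gam k ?cI ?cJ else 0)"
    using * dd by (intro sum.cong HOL.refl) (auto simp: spin_form_eq in_P_iff)
  moreover have "(\<Sum>K\<in>P. spin_form ?cJ K * gam k K I) = (\<Sum>K\<in>P. if K = J then bb ?cJ * gam k J I else 0)"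
    by (intro sum.cong HOL.refl) (auto simp: spin_form_eq compl_in_P dd)
  ultimately have "bb ?cI * gam k ?cI ?cJ = \<kappa> * (bb ?cJ * gam k J I)"
    using gam_adjoint[of ?cJ I k] * by (simp add: compl_in_P)
  then have F: "bt (co c) * mm a (co c) (co b) = \<kappa> * (bt (co b) * mm a b c)"
    using * by (simp add: mm_def)
  let ?s = "sg \<SS> \<SS>"
  have "bt c * mm a (co c) (co b) = ?s * (bt (co c) * mm a (co c) (co b))"
    by (simp add: bt_co[OF assms(3)] mult.assoc)
  also have "\<dots> = ?s * (\<kappa> * (bt (co b) * mm a b c))" by (simp only: F)
  also have "\<dots> = \<kappa> * (?s * (bt (co b) * mm a b c))" by (rule mult.left_commute)
  also have "\<dots> = \<kappa> * (bt b * mm a b c)" by (simp add: bt_co[OF assms(2)] mult.assoc)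
  finally have "bt b * (bt c * mm a (co c) (co b)) = bt b * (\<kappa> * (bt b * mm a b c))" by simp
  also have "\<dots> = \<kappa> * (bt b * (bt b * mm a b c))" by (rule mult.left_commute)
  finally show ?thesis by simp
qed

lemma mm_clifford:
  assumes "a \<in> basis \<VV>" "a' \<in> basis \<VV>" "b \<in> basis \<SS>" "d \<in> basis \<SS>"
  shows "(\<Sum>c\<in>basis \<SS>. mm a b c * mm a' c d) + (\<Sum>c\<in>basis \<SS>. mm a' b c * mm a c d) =
    (if a = a' \<and> b = d then 2 else 0)"
proof -
  obtain k l J I where *: "a = VecL k" "a' = VecL l" "b = SpinL J" "d = SpinL I" "k \<in> {1..N}" "l \<in> {1..N}"
    "J \<in> P" "I \<in> P"
    using assms by (auto simp: basis_simps)
  then show ?thesis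
    using clifford_gam[of k l J I] by (auto simp: sum_basis_S mm_def mat_mul_def mat_one_def mat_of_def)
qed

lemma card_basis: "card (basis \<VV>) = N" "card (basis \<SS>) = 2 ^ n"
  by (simp_all add: basis_simps card_image inj_on_def P_def card_Pow)

lemmas ev_simps = ev_comp ev_tensor ev_plus ev_scale ev_Cap ev_Cup ev_Cross ev_Mu ev_Strand
  sum_distrib_left mult_if_zero sum_if_const sum_co_delta

lemma sb_rel_sound:
  assumes "sb_rel (of_nat N) (\<sigma> * 2 ^ n) \<kappa> f g"
  shows "inc_diagram f = inc_diagram g"
proof (rule inc_diagram_eqI)
  fix w :: "label list \<Rightarrow> complex" and u
  assume u: "u \<in> word_basis (tgt f)"
  from assms u show "ev f w u = ev g w u"
  proof (cases rule: sb_rel.cases)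
    case (sym_inv y x)
    then show ?thesis using u by (auto simp: in_word_basis_Cons ev_simps sg_commute[of y x])
  next
    case (braid y z x)
    then show ?thesis using u by (auto simp: in_word_basis_Cons ev_simps ac_simps)
  next
    case (zigzag_left x)
    then show ?thesis using u by (auto simp: in_word_basis_Cons ev_simps cong: sum.cong_simp)
  next
    case (zigzag_right x)
    then show ?thesis using u by (auto simp: in_word_basis_Cons ev_simps co_inj cong: sum.cong_simp)
  next
    case (cap_cross x)
    \<comment> \<open>The crossing contributes \<open>sg x x\<close>, exactly the symmetry sign of
      the form, so both are absorbed when \<open>a\<close> is replaced by
      \<open>co a\<close>.\<close>
    then have "ev f w u = (\<Sum>a\<in>basis x. bt (co a) * w [co a, co (co a)])"
      using u by (auto simp: ev_simps bt_co ac_simps intro!: sum.cong)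
    also have "\<dots> = (\<Sum>a\<in>basis x. bt a * w [a, co a])"
      by (rule sum_co)
    also have "\<dots> = ev g w u"
      using u cap_cross by (simp add: ev_Cap)
    finally show ?thesis .
  next
    case (cap_slide y x)
    then show ?thesis using u
      by (auto simp: in_word_basis_Cons ev_simps sg_commute[of y x] ac_simps cong: sum.cong_simp)
  next
    case (mu_cross x)
    then show ?thesis using u
      by (auto simp: in_word_basis_Cons ev_simps ac_simps sg_def cong: sum.cong_simp)
  next
    case mu_rotate
    then obtain a b where ab: "u = [b, a]" "a \<in> basis \<VV>" "b \<in> basis \<SS>"
      using u by (auto simp: in_word_basis_Cons)
    have "ev f w u = (\<Sum>c\<in>basis \<SS>. bt c * (mm a (co c) (co b) * (bt b * w [c])))"
      unfolding mu_rotate ab(1) using ab(2,3)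
      by (simp add: ev_simps bt_V cong: sum.cong_simp)
    \<comment> \<open>Each of the two values of \<open>bt\<close> changes by
      \<open>\<sigma>\<close>, so their product does not change.\<close>
    also have "\<dots> = (\<Sum>c\<in>basis \<SS>. bt (co c) * (mm a (co c) (co b) * (bt (co b) * w [co (co c)])))"
      using ab by (intro sum.cong HOL.refl) (simp add: bt_co mult.left_commute[of "sg \<SS> \<SS>"] mult.assoc)
    also have "\<dots> = (\<Sum>c\<in>basis \<SS>. bt c * (mm a c (co b) * (bt (co b) * w [co c])))"
      by (rule sum_co)
    also have "\<dots> = ev g w u"
      unfolding mu_rotate ab(1) using ab(2,3)
      by (simp add: ev_simps bt_V cong: sum.cong_simp)
    finally show ?thesis .
  next
    case mu_flip
    then obtain b where b: "u = [b]" "b \<in> basis \<SS>" using u by (auto simp: in_word_basis_Cons)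
    have "ev g w u = (\<Sum>c\<in>basis \<SS>. \<Sum>a\<in>basis \<VV>. \<kappa> * (bt c * (mm a (co c) (co b) * (bt b * w [c, a]))))"
      unfolding mu_flip b(1) using b(2) by (simp add: ev_simps cong: sum.cong_simp)
    also have "\<dots> = (\<Sum>c\<in>basis \<SS>. \<Sum>a\<in>basis \<VV>. mm a b c * w [c, a])"
    proof (intro sum.cong HOL.refl)
      fix c a assume "c \<in> basis \<SS>" "a \<in> basis \<VV>"
      then have "\<kappa> * (bt b * (bt c * mm a (co c) (co b))) * w [c, a] = mm a b c * w [c, a]"
        using mm_adjoint[of a b c] b(2) by simp
      then show "\<kappa> * (bt c * (mm a (co c) (co b) * (bt b * w [c, a]))) = mm a b c * w [c, a]"
        by (simp add: ac_simps)
    qed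
    also have "\<dots> = ev f w u"
      unfolding mu_flip b(1) using b(2) by (subst sum.swap) (simp add: ev_simps sg_def cong: sum.cong_simp)
    finally show ?thesis ..
  next
    case clifford
    then obtain b where b: "u = [b]" "b \<in> basis \<SS>" using u by (auto simp: in_word_basis_Cons)
    have swap: "(\<Sum>a\<in>basis \<VV>. \<Sum>c\<in>basis \<SS>. \<Sum>a'\<in>basis \<VV>. \<Sum>d\<in>basis \<SS>. F a c a' d) =
        (\<Sum>a\<in>basis \<VV>. \<Sum>a'\<in>basis \<VV>. \<Sum>d\<in>basis \<SS>. \<Sum>c\<in>basis \<SS>. F a c a' d)" for F :: "label \<Rightarrow> label \<Rightarrow> label \<Rightarrow> label \<Rightarrow> complex"
      by (rule sum.cong[OF HOL.refl], subst sum.swap, rule sum.cong[OF HOL.refl], rule sum.swap)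
    have "ev f w u =
      (\<Sum>a\<in>basis \<VV>. \<Sum>c\<in>basis \<SS>. \<Sum>a'\<in>basis \<VV>. \<Sum>d\<in>basis \<SS>. mm a b c * (mm a' c d * w [a, a', d])) +
      (\<Sum>a\<in>basis \<VV>. \<Sum>c\<in>basis \<SS>. \<Sum>a'\<in>basis \<VV>. \<Sum>d\<in>basis \<SS>. mm a b c * (mm a' c d * w [a', a, d]))"
      unfolding clifford b(1) using b(2) by (simp add: ev_simps sg_def cong: sum.cong_simp)
    also have "(\<Sum>a\<in>basis \<VV>. \<Sum>c\<in>basis \<SS>. \<Sum>a'\<in>basis \<VV>. \<Sum>d\<in>basis \<SS>. mm a b c * (mm a' c d * w [a', a, d])) =
      (\<Sum>a\<in>basis \<VV>. \<Sum>a'\<in>basis \<VV>. \<Sum>d\<in>basis \<SS>. \<Sum>c\<in>basis \<SS>. mm a' b c * (mm a c d * w [a, a', d]))"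
      unfolding swap by (rule sum.swap)
    also have "(\<Sum>a\<in>basis \<VV>. \<Sum>c\<in>basis \<SS>. \<Sum>a'\<in>basis \<VV>. \<Sum>d\<in>basis \<SS>. mm a b c * (mm a' c d * w [a, a', d])) +
        (\<Sum>a\<in>basis \<VV>. \<Sum>a'\<in>basis \<VV>. \<Sum>d\<in>basis \<SS>. \<Sum>c\<in>basis \<SS>. mm a' b c * (mm a c d * w [a, a', d])) =
      (\<Sum>a\<in>basis \<VV>. \<Sum>a'\<in>basis \<VV>. \<Sum>d\<in>basis \<SS>.
        ((\<Sum>c\<in>basis \<SS>. mm a b c * mm a' c d) + (\<Sum>c\<in>basis \<SS>. mm a' b c * mm a c d)) * w [a, a', d])"
      unfolding swap by (simp add: sum.distrib[symmetric] sum_distrib_right distrib_right mult.assoc)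
    also have "\<dots> = (\<Sum>a\<in>basis \<VV>. \<Sum>a'\<in>basis \<VV>. \<Sum>d\<in>basis \<SS>. if d = b then if a' = a then 2 * w [a, a, b] else 0 else 0)"
      using b(2) by (intro sum.cong HOL.refl) (auto simp: mm_clifford)
    also have "\<dots> = ev g w u"
      unfolding clifford b(1) using b(2) by (simp add: ev_simps bt_V cong: sum.cong_simp)
    finally show ?thesis .
  next
    case dim_V
    then show ?thesis using u by (simp add: ev_simps bt_V card_basis cong: sum.cong_simp)
  next
    case dim_S
    have *: "bt a * (bt (co a) * w []) = \<sigma> * w []" if "a \<in> basis \<SS>" for a
    proof -
      have "bt a * (bt (co a) * w []) = \<sigma> * (bt a * (bt a * w []))"
        using bt_co[OF that] by (simp only: sg_def ac_simps simp_thms if_True)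
      then show ?thesis by simp
    qed
    have "ev f w u = (\<Sum>a\<in>basis \<SS>. bt a * (bt (co a) * w []))"
      using u dim_S by (simp add: ev_simps cong: sum.cong_simp)
    also have "\<dots> = (\<Sum>a\<in>basis \<SS>. \<sigma> * w [])" using * by (rule sum.cong[OF HOL.refl])
    also have "\<dots> = ev g w u" using u dim_S by (simp add: ev_simps card_basis)
    finally show ?thesis .
  qed
qed (use sb_rel_typed[OF assms] in auto)

lemma sb_eq_sound:
  "sb_eq (of_nat N) (\<sigma> * 2 ^ n) \<kappa> f g \<Longrightarrow> inc_diagram f = inc_diagram g"
proof (induction rule: sb_eq.induct)
  case (rel f g)
  then show ?case by (rule sb_rel_sound)
next
  case (vert_cong g g' f f')
  then show ?case using sb_eq_typed by (metis inc_diagram.simps(6))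
next
  case (horiz_cong f f' g g')
  then show ?case using sb_eq_typed by (metis inc_diagram.simps(7))
next
  case (vert_assoc h g f)
  then show ?case by (simp add: mat_mul_assoc)
next
  case (vert_id_left f)
  then show ?case using inc_diagram_mats[of f] by (simp add: mat_mul_one_left)
next
  case (vert_id_right f)
  then show ?case using inc_diagram_mats[of f] by (simp add: mat_mul_one_right)
next
  case (horiz_assoc f g h)
  then show ?case by (simp add: mat_tensor_assoc)
next
  case (horiz_unit_left f)
  then show ?case by (simp add: mat_tensor_unit_left)
next
  case (horiz_unit_right f)
  then show ?case
    using mat_tensor_unit_right[of "inc_diagram f" "map basis (tgt f)" "map basis (src f)"] inc_diagram_mats[of f]
    by (simp add: word_basis_def)
next
  case (horiz_id X Y)
  then show ?case
    using mat_tensor_one[of "map basis X" "map basis Y"] by (simp add: word_basis_def)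
next
  case (interchange g f g' f')
  then show ?case
    using mat_tensor_mul[of "map basis (tgt f)" "length (tgt f)" "map basis (tgt f')" "length (tgt g)"
      "inc_diagram g" "inc_diagram g'" "length (src f)"]
    by (simp add: word_basis_def)
qed (auto simp: mat_mul_def mat_tensor_def mat_add_def mat_scale_def fun_eq_iff sum.distrib
  sum_distrib_left algebra_simps)

subsection \<open>Equivariance\<close>

text \<open>The identity \<open>(g v g^(-1)) g = g v\<close> of the Clifford algebra, written in
  entries on the spin module.\<close>

lemma mm_equivariant:
  assumes g: "g \<in> GV" and "b \<in> basis \<SS>" "v \<in> basis \<VV>" "d \<in> basis \<SS>"
  shows "(\<Sum>a\<in>basis \<VV>. \<Sum>c\<in>basis \<SS>. mm a b c * gm \<VV> g a v * gm \<SS> g c d) =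
    (\<Sum>c\<in>basis \<SS>. gm \<SS> g b c * mm v c d)"
proof -
  obtain k J I where *: "b = SpinL J" "d = SpinL I" "v = VecL k" "k \<in> {1..N}" "J \<in> P" "I \<in> P"
    using assms by (auto simp: basis_simps)
  have "(\<Sum>a\<in>basis \<VV>. \<Sum>c\<in>basis \<SS>. mm a b c * gm \<VV> g a v * gm \<SS> g c d) =
    (\<Sum>l=1..N. \<Sum>K\<in>P. gam l J K * \<Phi> (e l) (vec_act g (e k)) * spin_act g K I)"
    unfolding sum_basis_V sum_basis_S using * by (simp add: mm_def gm_S[simplified] gm_V[simplified] cong: sum.cong_simp)
  also have "\<dots> = mat_mul P (spin_vec (vec_act g (e k))) (spin_act g) J I"
    unfolding mat_mul_def spin_vec_expand sum_distrib_right by (subst sum.swap) (simp add: ac_simps)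
  also have "\<dots> = mat_mul P (spin_act g) (spin_vec (e k)) J I"
    using spin_act_inv(2)[OF GV_Units[OF g]] mat_mul_one_right[OF _ mats_mul[OF spin_act_mats[OF GV_carrier[OF g]] spin_vec_mats]]
    by (simp add: spin_vec_vec_act[OF g] mat_mul_assoc[of P P _ "spin_act (inv\<^bsub>Cl\<^esub> g)"])
  also have "\<dots> = (\<Sum>c\<in>basis \<SS>. gm \<SS> g b c * mm v c d)"
    unfolding mat_mul_def sum_basis_S using * by (simp add: mm_def gm_S[simplified] spin_vec_e cong: sum.cong_simp)
  finally show ?thesis .
qed

lemma act_pair:
  "act [x, y] g w [a, b] = (\<Sum>c\<in>basis x. \<Sum>d\<in>basis y. gm x g a c * (gm y g b d * w [c, d]))"
  by (simp add: act_Cons act_Nil sum_distrib_left)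

lemma equivariant_iff:
  assumes "A \<in> mats (word_basis Y) (word_basis X)"
  shows "A \<in> module_homs GV (inc_obj X) (inc_obj Y) \<longleftrightarrow>
    (\<forall>g\<in>GV. \<forall>w. \<forall>u\<in>word_basis Y. app (word_basis X) A (act X g w) u = act Y g (app (word_basis X) A w) u)"
proof -
  have "mat_mul (word_basis X) A (snd (inc_obj X) g) = mat_mul (word_basis Y) (snd (inc_obj Y) g) A \<longleftrightarrow>
    (\<forall>w. \<forall>u\<in>word_basis Y. app (word_basis X) A (act X g w) u = act Y g (app (word_basis X) A w) u)" for g
  proof
    assume "mat_mul (word_basis X) A (snd (inc_obj X) g) = mat_mul (word_basis Y) (snd (inc_obj Y) g) A"
    then show "\<forall>w. \<forall>u\<in>word_basis Y. app (word_basis X) A (act X g w) u = act Y g (app (word_basis X) A w) u"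
      unfolding act_def by (metis app_mul)
  next
    assume "\<forall>w. \<forall>u\<in>word_basis Y. app (word_basis X) A (act X g w) u = act Y g (app (word_basis X) A w) u"
    then show "mat_mul (word_basis X) A (snd (inc_obj X) g) = mat_mul (word_basis Y) (snd (inc_obj Y) g) A"
      using assms snd_inc_obj_mats
      by (intro mat_eqI[of _ "word_basis Y" "word_basis X"] mats_mul) (auto simp: app_mul act_def)
  qed
  then show ?thesis using assms by (simp add: module_homs_def listset_fst_inc_obj)
qed

lemma module_homs_mats: "A \<in> module_homs GV (inc_obj X) (inc_obj Y) \<Longrightarrow> A \<in> mats (word_basis Y) (word_basis X)"
  by (simp add: module_homs_def listset_fst_inc_obj)

lemma homs_one: "mat_one (word_basis X) \<in> module_homs GV (inc_obj X) (inc_obj X)"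
  using mat_mul_one_left[OF finite_word_basis snd_inc_obj_mats] mat_mul_one_right[OF finite_word_basis snd_inc_obj_mats]
  by (simp add: module_homs_def listset_fst_inc_obj)

lemma homs_mul:
  "A \<in> module_homs GV (inc_obj Y) (inc_obj Z) \<Longrightarrow> B \<in> module_homs GV (inc_obj X) (inc_obj Y) \<Longrightarrow>
   mat_mul (word_basis Y) A B \<in> module_homs GV (inc_obj X) (inc_obj Z)"
  unfolding module_homs_def listset_fst_inc_obj
  by (auto intro: mats_mul simp: mat_mul_assoc) (simp add: mat_mul_assoc[symmetric])

lemma homs_add:
  "A \<in> module_homs GV (inc_obj X) (inc_obj Y) \<Longrightarrow> B \<in> module_homs GV (inc_obj X) (inc_obj Y) \<Longrightarrow>
   mat_add A B \<in> module_homs GV (inc_obj X) (inc_obj Y)"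
  unfolding module_homs_def listset_fst_inc_obj
  by (auto intro: mats_add simp: mat_mul_add_left mat_mul_add_right)

lemma homs_scale:
  "A \<in> module_homs GV (inc_obj X) (inc_obj Y) \<Longrightarrow> mat_scale c A \<in> module_homs GV (inc_obj X) (inc_obj Y)"
  unfolding module_homs_def listset_fst_inc_obj
  by (auto intro: mats_scale simp: mat_mul_scale_left mat_mul_scale_right)

lemma homs_tensor:
  assumes "A \<in> module_homs GV (inc_obj X) (inc_obj Y)" "B \<in> module_homs GV (inc_obj X') (inc_obj Y')"
  shows "mat_tensor (length Y) (length X) A B \<in> module_homs GV (inc_obj (X @ X')) (inc_obj (Y @ Y'))"
proof -
  have "mat_tensor (length Y) (length X) A B \<in> mats (word_basis (Y @ Y')) (word_basis (X @ X'))"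
    using assms unfolding module_homs_def listset_fst_inc_obj word_basis_def map_append
    by (intro mats_tensor) auto
  moreover have "mat_mul (word_basis (X @ X')) (mat_tensor (length Y) (length X) A B) (snd (inc_obj (X @ X')) g) =
      mat_mul (word_basis (Y @ Y')) (snd (inc_obj (Y @ Y')) g) (mat_tensor (length Y) (length X) A B)"
    if "g \<in> GV" for g
    using assms that unfolding module_homs_def listset_fst_inc_obj snd_inc_obj_append
    by (simp add: word_basis_def mat_tensor_mul)
  ultimately show ?thesis unfolding module_homs_def listset_fst_inc_obj by blast
qed

lemma cap_equivariant: "g \<in> GV \<Longrightarrow> ev (Cap x) (act [x, x] g w) [] = ev (Cap x) w []"
proof -
  assume g: "g \<in> GV"
  have "ev (Cap x) (act [x, x] g w) [] =
    (\<Sum>a\<in>basis x. \<Sum>c\<in>basis x. \<Sum>d\<in>basis x. bt a * gm x g a c * gm x g (co a) d * w [c, d])"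
    by (simp add: ev_Cap act_pair sum_distrib_left mult.assoc)
  also have "\<dots> = (\<Sum>c\<in>basis x. \<Sum>d\<in>basis x. \<Sum>a\<in>basis x. bt a * gm x g a c * gm x g (co a) d * w [c, d])"
    by (subst sum.swap) (rule sum.cong[OF HOL.refl], rule sum.swap)
  also have "\<dots> = (\<Sum>c\<in>basis x. \<Sum>d\<in>basis x. if d = co c then bt c * w [c, d] else 0)"
    unfolding sum_distrib_right[symmetric] using gm_form[OF g] by (intro sum.cong HOL.refl) simp
  finally show ?thesis by (simp add: ev_Cap)
qed

lemma cup_equivariant:
  assumes "g \<in> GV" "a \<in> basis x" "b \<in> basis x"
  shows "act [x, x] g (ev (Cup x) w) [a, b] = ev (Cup x) w [a, b]"
proof -
  have "act [x, x] g (ev (Cup x) w) [a, b] =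
    (\<Sum>c\<in>basis x. \<Sum>d\<in>basis x. if d = co c then gm x g a c * gm x g b d * bt d * w [] else 0)"
    unfolding act_pair by (intro sum.cong HOL.refl) (simp add: ev_Cup)
  also have "\<dots> = (\<Sum>c\<in>basis x. gm x g a c * gm x g b (co c) * bt (co c)) * w []"
    by (simp add: sum_distrib_right)
  finally show ?thesis using assms by (simp add: gm_dual ev_Cup)
qed

lemma cross_equivariant:
  assumes "a \<in> basis x" "b \<in> basis y"
  shows "ev (Cross x y) (act [x, y] g w) [b, a] = act [y, x] g (ev (Cross x y) w) [b, a]"
proof -
  have "act [y, x] g (ev (Cross x y) w) [b, a] =
    (\<Sum>d\<in>basis y. \<Sum>c\<in>basis x. gm y g b d * (gm x g a c * (sg x y * w [c, d])))"
    unfolding act_pair by (intro sum.cong HOL.refl) (simp add: ev_Cross)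
  then show ?thesis
    using assms by (subst (asm) sum.swap) (simp add: ev_Cross act_pair sum_distrib_left ac_simps)
qed

lemma mu_equivariant:
  assumes g: "g \<in> GV" and b: "b \<in> basis \<SS>"
  shows "ev Mu (act [\<VV>, \<SS>] g w) [b] = act [\<SS>] g (ev Mu w) [b]"
proof -
  let ?V = "basis \<VV>" and ?S = "basis \<SS>"
  have "ev Mu (act [\<VV>, \<SS>] g w) [b] =
    (\<Sum>a\<in>?V. \<Sum>c\<in>?S. \<Sum>v\<in>?V. \<Sum>d\<in>?S. mm a b c * gm \<VV> g a v * gm \<SS> g c d * w [v, d])"
    using b by (simp add: ev_Mu act_pair sum_distrib_left mult.assoc)
  also have "\<dots> = (\<Sum>a\<in>?V. \<Sum>v\<in>?V. \<Sum>d\<in>?S. \<Sum>c\<in>?S. mm a b c * gm \<VV> g a v * gm \<SS> g c d * w [v, d])"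
    by (rule sum.cong[OF HOL.refl], subst sum.swap, rule sum.cong[OF HOL.refl], rule sum.swap)
  also have "\<dots> = (\<Sum>v\<in>?V. \<Sum>d\<in>?S. \<Sum>a\<in>?V. \<Sum>c\<in>?S. mm a b c * gm \<VV> g a v * gm \<SS> g c d * w [v, d])"
    by (subst sum.swap) (rule sum.cong[OF HOL.refl], rule sum.swap)
  also have "\<dots> = (\<Sum>v\<in>?V. \<Sum>d\<in>?S. \<Sum>c\<in>?S. gm \<SS> g b c * mm v c d * w [v, d])"
    unfolding sum_distrib_right[symmetric] using mm_equivariant[OF g b] by (intro sum.cong HOL.refl) simp
  also have "\<dots> = (\<Sum>v\<in>?V. \<Sum>c\<in>?S. \<Sum>d\<in>?S. gm \<SS> g b c * mm v c d * w [v, d])"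
    by (rule sum.cong[OF HOL.refl], rule sum.swap)
  also have "\<dots> = (\<Sum>c\<in>?S. \<Sum>v\<in>?V. \<Sum>d\<in>?S. gm \<SS> g b c * mm v c d * w [v, d])"
    by (rule sum.swap)
  also have "\<dots> = act [\<SS>] g (ev Mu w) [b]"
    by (simp add: act_Cons act_Nil ev_Mu sum_distrib_left mult.assoc cong: sum.cong_simp)
  finally show ?thesis .
qed

lemma inc_diagram_homs:
  "wf_diagram d \<Longrightarrow> inc_diagram d \<in> module_homs GV (inc_obj (src d)) (inc_obj (tgt d))"
proof (induction d)
  case (Strand X)
  then show ?case using homs_one by simp
next
  case (Cap x)
  then show ?case
    using inc_diagram_mats[of "Cap x"] cap_equivariant
    by (subst equivariant_iff) (auto simp: act_Nil ev_def simp del: inc_diagram.simps inc_obj.simps)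
next
  case (Cup x)
  then show ?case
    using inc_diagram_mats[of "Cup x"] cup_equivariant ev_Cup[of _ x]
    by (subst equivariant_iff) (auto simp: act_Nil in_word_basis_Cons ev_def simp del: inc_diagram.simps inc_obj.simps)
next
  case (Cross x y)
  then show ?case
    using inc_diagram_mats[of "Cross x y"] cross_equivariant[of _ x _ y]
    by (subst equivariant_iff) (auto simp: in_word_basis_Cons ev_def simp del: inc_diagram.simps inc_obj.simps)
next
  case Mu
  then show ?case
    using inc_diagram_mats[of Mu] mu_equivariant
    by (subst equivariant_iff) (auto simp: in_word_basis_Cons ev_def simp del: inc_diagram.simps inc_obj.simps)
next
  case (Vert d d')
  then show ?case using homs_mul by simp
next
  case (Horiz d d')
  then show ?case using homs_tensor by simp
next
  case (ZeroD X Y)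
  then show ?case by (simp add: module_homs_def mats_zero mat_mul_def)
next
  case (PlusD d d')
  then show ?case using homs_add by simp
next
  case (ScaleD c d)
  then show ?case using homs_scale by simp
qed

subsection \<open>Functoriality\<close>

abbreviation cls :: "complex diagram \<Rightarrow> complex diagram set" where
  "cls \<equiv> sb_class (of_nat N) (\<sigma> * 2 ^ n) \<kappa>"

lemma inc_mor_cls: "wf_diagram d \<Longrightarrow> inc_mor X Y (cls d) = inc_diagram d"
proof -
  assume "wf_diagram d"
  then have "inc_diagram ` cls d = {inc_diagram d}"
    using sb_eq_sound sb_eq.refl by (fastforce simp: sb_class_def)
  then show ?thesis by (simp add: inc_mor_def)
qed

lemma cls_eqI: "sb_eq (of_nat N) (\<sigma> * 2 ^ n) \<kappa> f g \<Longrightarrow> cls f = cls g"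
  unfolding sb_class_def by (auto intro: sb_eq.trans sb_eq.sym)

lemma cls_self: "wf_diagram d \<Longrightarrow> d \<in> cls d"
  by (simp add: sb_class_def sb_eq.refl)

text \<open>The operations of the category take unions over representatives; by congruence all
  members of such a union coincide, and reflexivity makes the index class nonempty.\<close>

lemma UN_cls:
  assumes "wf_diagram f" "\<And>f'. sb_eq (of_nat N) (\<sigma> * 2 ^ n) \<kappa> f f' \<Longrightarrow> F f' = K"
  shows "(\<Union>f'\<in>cls f. F f') = K"
proof -
  have "(\<Union>f'\<in>cls f. F f') = (\<Union>f'\<in>cls f. K)"
    using assms(2) by (intro SUP_cong HOL.refl) (simp add: sb_class_def)
  then show ?thesis using cls_self[OF assms(1)] by auto
qed

lemma SB_simps:
  "Obj SB = UNIV" "Hom SB X Y = cls ` diagrams X Y" "Ident SB X = cls (Strand X)"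
  "Unit SB = []" "TObj SB X Y = X @ Y"
  by (simp_all add: SB_def spin_brauer_def)

lemma Comp_SB:
  assumes "f \<in> diagrams X Y" "g \<in> diagrams Y Z"
  shows "Comp SB X Y Z (cls g) (cls f) = cls (g \<circ>\<^sub>d f)"
  using assms unfolding SB_def spin_brauer_def lin_mon_cat.simps
  by (intro UN_cls cls_eqI[symmetric] sb_eq.vert_cong) (auto simp: diagrams_def)

lemma Plus_SB:
  assumes "f \<in> diagrams X Y" "g \<in> diagrams X Y"
  shows "Plus SB (cls f) (cls g) = cls (f +\<^sub>d g)"
  using assms unfolding SB_def spin_brauer_def lin_mon_cat.simps
  by (intro UN_cls cls_eqI[symmetric] sb_eq.plus_cong) (auto simp: diagrams_def)

lemma TMor_SB:
  assumes "f \<in> diagrams X Y" "g \<in> diagrams X' Y'"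
  shows "TMor SB X Y X' Y' (cls f) (cls g) = cls (f \<otimes>\<^sub>d g)"
  using assms unfolding SB_def spin_brauer_def lin_mon_cat.simps
  by (intro UN_cls cls_eqI[symmetric] sb_eq.horiz_cong) (auto simp: diagrams_def)

lemma Scale_SB:
  assumes "f \<in> diagrams X Y"
  shows "Scale SB c (cls f) = cls (c *\<^sub>d f)"
  using assms unfolding SB_def spin_brauer_def lin_mon_cat.simps
  by (intro UN_cls cls_eqI[symmetric] sb_eq.scale_cong) (auto simp: diagrams_def)

theorem incarnation_functor: "linear_monoidal_functor SB G_mod inc_obj inc_mor"
  unfolding linear_monoidal_functor_def SB_simps
proof (intro conjI ballI allI)
  fix X show "inc_obj X \<in> Obj G_mod" by (rule inc_obj_in)
next
  fix X Y f assume "f \<in> cls ` diagrams X Y"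
  then show "inc_mor X Y f \<in> Hom G_mod (inc_obj X) (inc_obj Y)"
    using inc_diagram_homs by (auto simp: diagrams_def inc_mor_cls G_mod_def module_category_def)
next
  fix X show "inc_mor X X (cls (Strand X)) = Ident G_mod (inc_obj X)"
    by (simp add: inc_mor_cls G_mod_def module_category_def listset_fst_inc_obj)
next
  fix X Y Z f g assume "f \<in> cls ` diagrams X Y" "g \<in> cls ` diagrams Y Z"
  then show "inc_mor X Z (Comp SB X Y Z g f) =
      Comp G_mod (inc_obj X) (inc_obj Y) (inc_obj Z) (inc_mor Y Z g) (inc_mor X Y f)"
    by (auto simp: Comp_SB) (simp add: diagrams_def inc_mor_cls G_mod_def module_category_def listset_fst_inc_obj)
next
  fix X Y f g assume "f \<in> cls ` diagrams X Y" "g \<in> cls ` diagrams X Y"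
  then show "inc_mor X Y (Plus SB f g) = Plus G_mod (inc_mor X Y f) (inc_mor X Y g)"
    by (auto simp: Plus_SB) (simp add: diagrams_def inc_mor_cls G_mod_def module_category_def)
next
  fix X Y f c assume "f \<in> cls ` diagrams X Y"
  then show "inc_mor X Y (Scale SB c f) = Scale G_mod c (inc_mor X Y f)"
    by (auto simp: Scale_SB) (simp add: diagrams_def inc_mor_cls G_mod_def module_category_def)
next
  show "inc_obj [] = Unit G_mod" by (simp add: G_mod_def module_category_def)
next
  fix X Y show "inc_obj (X @ Y) = TObj G_mod (inc_obj X) (inc_obj Y)"
    by (simp add: G_mod_def module_category_def inc_obj_append)
next
  fix X Y X' Y' f g assume "f \<in> cls ` diagrams X Y" "g \<in> cls ` diagrams X' Y'"
  then show "inc_mor (X @ X') (Y @ Y') (TMor SB X Y X' Y' f g) =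
      TMor G_mod (inc_obj X) (inc_obj Y) (inc_obj X') (inc_obj Y') (inc_mor X Y f) (inc_mor X' Y' g)"
    by (auto simp: TMor_SB) (simp add: diagrams_def inc_mor_cls G_mod_def module_category_def fst_inc_obj)
qed

end

section \<open>Invariants and realizable vectors\<close>

context spin_setup
begin

definition invariant :: "colour list \<Rightarrow> (label list \<Rightarrow> complex) \<Rightarrow> bool" where
  "invariant Y w \<longleftrightarrow> (\<forall>g\<in>GV. \<forall>u\<in>word_basis Y. act Y g w u = w u)"

text \<open>A diagram out of the empty word is a vector, the image of 1. The function
  \<open>\<lambda>_. 1\<close> stands for this scalar, as only its value at \<open>[]\<close> is
  read.\<close>

definition realizable :: "colour list \<Rightarrow> (label list \<Rightarrow> complex) \<Rightarrow> bool" where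
  "realizable Y w \<longleftrightarrow> (\<exists>d\<in>diagrams [] Y. \<forall>u\<in>word_basis Y. w u = ev d (\<lambda>_. 1) u)"

definition inv_full :: "colour list \<Rightarrow> bool" where
  "inv_full Y \<longleftrightarrow> (\<forall>w. invariant Y w \<longrightarrow> realizable Y w)"

lemma realizable_cong:
  "(\<And>u. u \<in> word_basis Y \<Longrightarrow> w u = w' u) \<Longrightarrow> realizable Y w \<longleftrightarrow> realizable Y w'"
  by (simp add: realizable_def)

lemma ev_act:
  assumes "d \<in> diagrams Y Z" "g \<in> GV" "u \<in> word_basis Z"
  shows "ev d (act Y g w) u = act Z g (ev d w) u"
  using assms inc_diagram_homs[of d] equivariant_iff[OF inc_diagram_mats[of d]]
  by (auto simp: diagrams_def ev_def)

lemma invariant_ev: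
  assumes "d \<in> diagrams Y Z" "invariant Y w"
  shows "invariant Z (ev d w)"
  unfolding invariant_def
proof (intro ballI)
  fix g u assume g: "g \<in> GV" and u: "u \<in> word_basis Z"
  have "ev d (act Y g w) = ev d w"
    using assms g by (intro ev_cong) (auto simp: invariant_def diagrams_def)
  then show "act Z g (ev d w) u = ev d w u" using ev_act[OF assms(1) g u, of w] by simp
qed

lemma realizable_ev:
  assumes "d \<in> diagrams Y Z" "realizable Y w"
  shows "realizable Z (ev d w)"
proof -
  obtain d' where d': "d' \<in> diagrams [] Y" "\<And>u. u \<in> word_basis Y \<Longrightarrow> w u = ev d' (\<lambda>_. 1) u"
    using assms(2) by (auto simp: realizable_def)
  have "ev d w = ev d (ev d' (\<lambda>_. 1))"
    using assms(1) d' by (intro ev_cong) (auto simp: diagrams_def)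
  moreover have "d \<circ>\<^sub>d d' \<in> diagrams [] Z" using assms(1) d'(1) by (auto simp: diagrams_def)
  moreover have "ev (d \<circ>\<^sub>d d') (\<lambda>_. 1) u = ev d (ev d' (\<lambda>_. 1)) u" for u
    using assms(1) d'(1) by (intro ev_comp) (auto simp: diagrams_def)
  ultimately show ?thesis unfolding realizable_def by (metis)
qed

lemma realizable_zero: "realizable Y (\<lambda>_. 0)"
  unfolding realizable_def by (intro bexI[of _ "ZeroD [] Y"]) (auto simp: diagrams_def ev_def app_def)

lemma realizable_lin:
  assumes "realizable Y w" "realizable Y w'"
  shows "realizable Y (\<lambda>u. a * w u + b * w' u)"
proof -
  obtain d d' where "d \<in> diagrams [] Y" "d' \<in> diagrams [] Y"
    "\<And>u. u \<in> word_basis Y \<Longrightarrow> w u = ev d (\<lambda>_. 1) u" "\<And>u. u \<in> word_basis Y \<Longrightarrow> w' u = ev d' (\<lambda>_. 1) u"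
    using assms by (auto simp: realizable_def)
  then show ?thesis
    unfolding realizable_def
    by (intro bexI[of _ "(a *\<^sub>d d) +\<^sub>d (b *\<^sub>d d')"]) (auto simp: diagrams_def ev_plus ev_scale)
qed

lemma realizable_scale: "realizable Y w \<Longrightarrow> realizable Y (\<lambda>u. c * w u)"
  using realizable_lin[of Y w w c 0] by simp

lemma realizable_sum:
  "(\<And>i. i \<in> A \<Longrightarrow> realizable Y (w i)) \<Longrightarrow> realizable Y (\<lambda>u. \<Sum>i\<in>A. w i u)"
proof (induction A rule: infinite_finite_induct)
  case (insert i A)
  then show ?case using realizable_lin[of Y "w i" "\<lambda>u. \<Sum>i\<in>A. w i u" 1 1] by simp
qed (auto intro: realizable_zero)

lemma invariant_lin:
  assumes "invariant Y w" "invariant Y w'"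
  shows "invariant Y (\<lambda>u. a * w u + b * w' u)"
  using assms by (simp add: invariant_def act_def app_lin)

lemma realizable_inv_full: "inv_full Y \<Longrightarrow> invariant Y w \<Longrightarrow> realizable Y w"
  by (simp add: inv_full_def)

subsection \<open>Permuting tensor factors\<close>

definition cross_at :: "colour list \<Rightarrow> colour \<Rightarrow> colour \<Rightarrow> colour list \<Rightarrow> complex diagram" where
  "cross_at A x y B = Strand A \<otimes>\<^sub>d Cross x y \<otimes>\<^sub>d Strand B"

lemma cross_at_in: "cross_at A x y B \<in> diagrams (A @ [x, y] @ B) (A @ [y, x] @ B)"
  by (simp add: cross_at_def diagrams_def)

lemma ev_cross_at:
  assumes "p \<in> word_basis A" "a \<in> basis x" "b \<in> basis y" "q \<in> word_basis B"
  shows "ev (cross_at A x y B) w (p @ [b, a] @ q) = sg x y * w (p @ [a, b] @ q)"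
  using assms length_word_basis[OF assms(1)]
  by (simp add: cross_at_def ev_tensor ev_Strand ev_Cross)

lemma word_basis_appendE:
  assumes "u \<in> word_basis (A @ B)"
  obtains p q where "u = p @ q" "p \<in> word_basis A" "q \<in> word_basis B"
  using assms word_basis_append[of u A B] by (metis append_take_drop_id)

text \<open>Crossings are invertible by diagrams: an invariant is moved to the swapped word,
  realized there, and moved back.\<close>

lemma inv_full_swap:
  assumes "inv_full (A @ [y, x] @ B)"
  shows "inv_full (A @ [x, y] @ B)"
  unfolding inv_full_def
proof (intro allI impI)
  fix w assume "invariant (A @ [x, y] @ B) w"
  then have "realizable (A @ [y, x] @ B) (ev (cross_at A x y B) w)"
    using assms invariant_ev[OF cross_at_in] by (simp add: inv_full_def)
  then have "realizable (A @ [x, y] @ B) (ev (cross_at A y x B) (ev (cross_at A x y B) w))"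
    by (rule realizable_ev[OF cross_at_in])
  moreover have "ev (cross_at A y x B) (ev (cross_at A x y B) w) u = w u"
    if u: "u \<in> word_basis (A @ [x, y] @ B)" for u
  proof -
    obtain p q where "u = p @ q" "p \<in> word_basis A" "q \<in> word_basis ([x, y] @ B)"
      using u by (rule word_basis_appendE)
    then obtain a b q' where "u = p @ [a, b] @ q'" "p \<in> word_basis A" "a \<in> basis x" "b \<in> basis y"
      "q' \<in> word_basis B"
      by (auto simp: in_word_basis_Cons)
    then show ?thesis using sg_commute[of x y] by (simp only: ev_cross_at sg_square)
  qed
  ultimately show "realizable (A @ [x, y] @ B) w" using realizable_cong by blast
qed

lemma inv_full_move: "inv_full (A @ [x] @ B @ C) \<Longrightarrow> inv_full (A @ B @ [x] @ C)"
proof (induction B arbitrary: A)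
  case (Cons b B)
  have "inv_full (A @ [x, b] @ (B @ C))" using Cons.prems by simp
  then have "inv_full ((A @ [b]) @ [x] @ B @ C)" using inv_full_swap[of A x b "B @ C"] by simp
  then show ?case using Cons.IH[of "A @ [b]"] by simp
qed simp

subsection \<open>The central element\<close>

lemma act_minus_one:
  "u \<in> word_basis Y \<Longrightarrow> act Y (cl_scalar (-1)) w u = (-1) ^ count_list Y \<SS> * w u"
proof (induction Y arbitrary: w u)
  case Nil
  then show ?case by (simp add: act_Nil)
next
  case (Cons x Y)
  then obtain a v where u: "u = a # v" "a \<in> basis x" "v \<in> word_basis Y" by (auto simp: in_word_basis_Cons)
  have gm: "gm x (cl_scalar (-1)) a b = (if b = a then (if x = \<SS> then -1 else 1) else 0)" if "b \<in> basis x" for b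
    using that u(2) minus_one_in_GV
    by (cases x) (auto simp: basis_simps gm_S[simplified] gm_V[simplified] form_e mat_scale_def mat_one_def mat_of_def)
  have "act (x # Y) (cl_scalar (-1)) w u =
    (\<Sum>b\<in>basis x. if b = a then (if x = \<SS> then -1 else 1) * ((-1) ^ count_list Y \<SS> * w (a # v)) else 0)"
    unfolding u(1) act_Cons using Cons.IH[OF u(3)] by (intro sum.cong HOL.refl) (simp add: gm)
  also have "\<dots> = (-1) ^ count_list (x # Y) \<SS> * w u"
    using u by (auto simp: power_add)
  finally show ?case .
qed

lemma inv_full_odd:
  assumes "odd (count_list Y \<SS>)"
  shows "inv_full Y"
  unfolding inv_full_def
proof (intro allI impI)
  fix w assume w: "invariant Y w"
  have "w u = 0" if "u \<in> word_basis Y" for u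
    using w act_minus_one[OF that, of w] minus_one_in_GV(1) that assms by (auto simp: invariant_def)
  then show "realizable Y w" using realizable_zero realizable_cong[of Y w "\<lambda>_. 0"] by simp
qed

end

subsection \<open>Sums over subsets\<close>

lemma flip_Pow: "i \<in> A \<Longrightarrow> flip {i} K \<in> Pow A \<longleftrightarrow> K \<in> Pow A"
  by (auto simp: flip_def)

lemma card_flip: "finite K \<Longrightarrow> card (flip {i} K) = (if i \<in> K then card K - 1 else card K + 1)"
proof -
  assume "finite K"
  moreover have "flip {i} K = (if i \<in> K then K - {i} else insert i K)" by (auto simp: flip_def)
  ultimately show ?thesis by simp
qed

lemma sum_flip: "i \<in> A \<Longrightarrow> (\<Sum>K\<in>Pow A. F (flip {i} K)) = (\<Sum>K\<in>Pow A. F K)"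
  by (rule sum.reindex_bij_witness[of _ "flip {i}" "flip {i}"]) (auto simp: flip_Pow simp del: Pow_iff)

text \<open>Toggling one element in the sets of size \<open>k\<close> reaches each set of size
  \<open>k + 1\<close> in \<open>k + 1\<close> ways and each set of size \<open>k - 1\<close> in
  \<open>card A - (k - 1)\<close> ways. The truncated difference is exact whenever a set with
  \<open>card K + 1 = k\<close> exists.\<close>

lemma sum_flip_layer:
  fixes t :: "nat set \<Rightarrow> complex"
  assumes A: "finite A"
  shows "(\<Sum>i\<in>A. \<Sum>K\<in>Pow A. if card K = k then t (flip {i} K) else 0) =
    of_nat (k + 1) * (\<Sum>K\<in>Pow A. if card K = k + 1 then t K else 0) +
    of_nat (card A + 1 - k) * (\<Sum>K\<in>Pow A. if card K + 1 = k then t K else 0)"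
proof -
  have "(\<Sum>i\<in>A. \<Sum>K\<in>Pow A. if card K = k then t (flip {i} K) else 0) =
    (\<Sum>i\<in>A. \<Sum>K\<in>Pow A. if card (flip {i} K) = k then t K else 0)"
  proof (rule sum.cong[OF HOL.refl])
    fix i assume "i \<in> A"
    from sum_flip[OF this, of "\<lambda>K. if card (flip {i} K) = k then t K else 0"]
    show "(\<Sum>K\<in>Pow A. if card K = k then t (flip {i} K) else 0) =
      (\<Sum>K\<in>Pow A. if card (flip {i} K) = k then t K else 0)" by simp
  qed
  also have "\<dots> = (\<Sum>K\<in>Pow A. \<Sum>i\<in>A. if card (flip {i} K) = k then t K else 0)"
    by (rule sum.swap)
  also have "\<dots> = (\<Sum>K\<in>Pow A. of_nat (k + 1) * (if card K = k + 1 then t K else 0) +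
      of_nat (card A + 1 - k) * (if card K + 1 = k then t K else 0))"
  proof (rule sum.cong[OF HOL.refl])
    fix K assume "K \<in> Pow A"
    then have K: "K \<subseteq> A" "finite K" using A finite_subset by auto
    have "(\<Sum>i\<in>A. if card (flip {i} K) = k then t K else 0) =
      (\<Sum>i\<in>K. if card (flip {i} K) = k then t K else 0) + (\<Sum>i\<in>A - K. if card (flip {i} K) = k then t K else 0)"
      by (subst sum.subset_diff[OF K(1) A]) (rule add.commute)
    also have "(\<Sum>i\<in>K. if card (flip {i} K) = k then t K else 0) = (\<Sum>i\<in>K. if card K = k + 1 then t K else 0)"
    proof (rule sum.cong[OF HOL.refl])
      fix i assume "i \<in> K"
      then have "card K > 0" using K(2) card_gt_0_iff by blast
      then show "(if card (flip {i} K) = k then t K else 0) = (if card K = k + 1 then t K else 0)"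
        using \<open>i \<in> K\<close> card_flip[OF K(2), of i] by auto
    qed
    also have "(\<Sum>i\<in>A - K. if card (flip {i} K) = k then t K else 0) = (\<Sum>i\<in>A - K. if card K + 1 = k then t K else 0)"
      by (intro sum.cong[OF HOL.refl]) (simp add: card_flip[OF K(2)])
    finally show "(\<Sum>i\<in>A. if card (flip {i} K) = k then t K else 0) =
      of_nat (k + 1) * (if card K = k + 1 then t K else 0) +
      of_nat (card A + 1 - k) * (if card K + 1 = k then t K else 0)"
      using K A card_mono[OF A K(1)] by (auto simp: card_Diff_subset)
  qed
  finally show ?thesis by (simp add: sum.distrib sum_distrib_left)
qed

section \<open>Conjugation by gamma matrices\<close>

context spin_setup
begin

text \<open>Being the identity outside \<open>{1..N}\<close> makes these maps commute for all
  indices, as the fold in \<open>conj_set\<close> requires.\<close>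

definition conj_gam :: "nat \<Rightarrow> (nat set, nat set) cmat \<Rightarrow> (nat set, nat set) cmat" where
  "conj_gam i X = (if i \<in> {1..N} then mat_mul P (gam i) (mat_mul P X (gam i)) else X)"

definition conj_set :: "nat set \<Rightarrow> (nat set, nat set) cmat \<Rightarrow> (nat set, nat set) cmat" where
  "conj_set K X = Finite_Set.fold conj_gam X K"

definition layer :: "nat \<Rightarrow> (nat set, nat set) cmat \<Rightarrow> (nat set, nat set) cmat" where
  "layer k X = (\<lambda>J J'. \<Sum>K\<in>Pow {1..N}. if card K = k then conj_set K X J J' else 0)"

text \<open>The sign from exchanging two gamma matrices appears once on each side of
  \<open>X\<close>. So conjugation by a product of distinct gamma matrices depends only on the set
  of its factors.\<close>

lemma conj_gam_commute: "conj_gam i (conj_gam j X) = conj_gam j (conj_gam i X)"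
proof (cases "i \<in> {1..N} \<and> j \<in> {1..N} \<and> i \<noteq> j")
  case True
  have "conj_gam i (conj_gam j X) = mat_mul P (mat_mul P (gam i) (gam j)) (mat_mul P X (mat_mul P (gam j) (gam i)))"
    using True by (simp add: conj_gam_def mat_mul_assoc)
  also have "\<dots> = mat_mul P (mat_mul P (gam j) (gam i)) (mat_mul P X (mat_mul P (gam i) (gam j)))"
    unfolding gam_anticommute[OF conjunct1[OF True] conjunct1[OF conjunct2[OF True]] conjunct2[OF conjunct2[OF True]]]
    by (simp only: mat_mul_scale_left mat_mul_scale_right)
  also have "\<dots> = conj_gam j (conj_gam i X)"
    using True by (simp add: conj_gam_def mat_mul_assoc)
  finally show ?thesis .
qed (auto simp: conj_gam_def)

interpretation T: comp_fun_commute conj_gam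
  by unfold_locales (simp add: fun_eq_iff conj_gam_commute)

lemma conj_gam_mats: "X \<in> mats P P \<Longrightarrow> conj_gam i X \<in> mats P P"
  unfolding conj_gam_def by (auto intro!: mats_mul gam_mats)

lemma conj_gam_involution:
  assumes "X \<in> mats P P"
  shows "conj_gam i (conj_gam i X) = X"
proof (cases "i \<in> {1..N}")
  case True
  then have "conj_gam i (conj_gam i X) = mat_mul P (mat_mul P (gam i) (gam i)) (mat_mul P X (mat_mul P (gam i) (gam i)))"
    by (simp add: conj_gam_def mat_mul_assoc)
  then show ?thesis using gam_square[OF True] assms by (simp add: mat_mul_one_left mat_mul_one_right)
qed (auto simp: conj_gam_def)

lemma conj_set_empty [simp]: "conj_set {} X = X"
  by (simp add: conj_set_def)

lemma conj_set_insert: "finite K \<Longrightarrow> i \<notin> K \<Longrightarrow> conj_set (insert i K) X = conj_gam i (conj_set K X)"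
  by (simp add: conj_set_def)

lemma conj_set_mats: "finite K \<Longrightarrow> X \<in> mats P P \<Longrightarrow> conj_set K X \<in> mats P P"
  by (induction K rule: finite_induct) (auto simp: conj_set_insert conj_gam_mats)

text \<open>As conjugation by one gamma matrix is an involution, it toggles membership in the index
  set.\<close>

lemma conj_gam_conj_set:
  assumes "finite K" "X \<in> mats P P"
  shows "conj_gam i (conj_set K X) = conj_set (flip {i} K) X"
proof (cases "i \<in> K")
  case True
  then have K: "K = insert i (K - {i})" "flip {i} K = K - {i}" by (auto simp: flip_def)
  have "conj_gam i (conj_set K X) = conj_gam i (conj_gam i (conj_set (K - {i}) X))"
    using K(1) assms(1) conj_set_insert[of "K - {i}" i X] by simp
  then show ?thesis using conj_gam_involution conj_set_mats assms K(2) by simp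
next
  case False
  then have "flip {i} K = insert i K" by (auto simp: flip_def)
  then show ?thesis using False assms by (simp add: conj_set_insert)
qed

lemma conj_gam_sum:
  assumes "finite A"
  shows "conj_gam i (\<lambda>J J'. \<Sum>k\<in>A. X k J J') = (\<lambda>J J'. \<Sum>k\<in>A. conj_gam i (X k) J J')"
proof (cases "i \<in> {1..N}")
  case True
  have r: "mat_mul P (\<lambda>J J'. \<Sum>k\<in>A. X k J J') B = (\<lambda>J J'. \<Sum>k\<in>A. mat_mul P (X k) B J J')" for X B
    unfolding mat_mul_def sum_distrib_right by (intro ext) (rule sum.swap)
  have l: "mat_mul P B (\<lambda>J J'. \<Sum>k\<in>A. X k J J') = (\<lambda>J J'. \<Sum>k\<in>A. mat_mul P B (X k) J J')" for X B
    unfolding mat_mul_def sum_distrib_left by (intro ext) (rule sum.swap)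
  show ?thesis using True by (simp add: conj_gam_def r l)
qed (auto simp: conj_gam_def)

lemma conj_gam_if: "conj_gam i (\<lambda>J J'. if Q then X J J' else 0) J J' = (if Q then conj_gam i X J J' else 0)"
  by (simp add: conj_gam_def mat_mul_def)

text \<open>A recursion between neighbouring layers: it can be solved for layer
  \<open>k + 1\<close>. The lower layer is selected by \<open>card K + 1 = k\<close>, so that it is
  empty for \<open>k = 0\<close>.\<close>

lemma conj_gam_layer:
  assumes "X \<in> mats P P"
  shows "(\<Sum>i=1..N. conj_gam i (layer k X) J J') =
    of_nat (k + 1) * layer (k + 1) X J J' +
    of_nat (N + 1 - k) * (\<Sum>K\<in>Pow {1..N}. if card K + 1 = k then conj_set K X J J' else 0)"
proof -
  have "conj_gam i (layer k X) J J' = (\<Sum>K\<in>Pow {1..N}. if card K = k then conj_set (flip {i} K) X J J' else 0)" for i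
  proof -
    have fin: "finite K" if "K \<in> Pow {1..N}" for K using that finite_subset by auto
    show ?thesis
      unfolding layer_def using conj_gam_conj_set[OF fin assms]
      by (subst conj_gam_sum) (auto simp: conj_gam_if intro!: sum.cong)
  qed
  then show ?thesis
    using sum_flip_layer[of "{1..N}" k "\<lambda>K. conj_set K X J J'"] by (simp add: layer_def)
qed

lemma trace_conj_gam:
  assumes "X \<in> mats P P"
  shows "trace (conj_gam i X) = trace X"
proof (cases "i \<in> {1..N}")
  case True
  have "trace (conj_gam i X) = trace (mat_mul P (mat_mul P X (gam i)) (gam i))"
    using True by (simp add: conj_gam_def trace_mul_commute)
  then show ?thesis using gam_square[OF True] assms by (simp add: mat_mul_assoc mat_mul_one_right)
qed (auto simp: conj_gam_def)

lemma trace_conj_set: "finite K \<Longrightarrow> X \<in> mats P P \<Longrightarrow> trace (conj_set K X) = trace X"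
  by (induction K rule: finite_induct) (auto simp: conj_set_insert trace_conj_gam conj_set_mats)

lemma sum_layers: "(\<Sum>k\<le>N. layer k X J J') = (\<Sum>K\<in>Pow {1..N}. conj_set K X J J')"
proof -
  have "(\<Sum>k\<le>N. layer k X J J') = (\<Sum>K\<in>Pow {1..N}. \<Sum>k\<le>N. if k = card K then conj_set K X J J' else 0)"
    unfolding layer_def by (subst sum.swap) (intro sum.cong HOL.refl, auto)
  also have "\<dots> = (\<Sum>K\<in>Pow {1..N}. conj_set K X J J')"
  proof (rule sum.cong[OF HOL.refl])
    fix K :: "nat set" assume "K \<in> Pow {1..N}"
    then have "card K \<le> N" using card_mono[of "{1..N}" K] by simp
    then show "(\<Sum>k\<le>N. if k = card K then conj_set K X J J' else 0) = conj_set K X J J'" by simp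
  qed
  finally show ?thesis .
qed

text \<open>Each conjugation permutes the summands, so the sum commutes with all gamma matrices.\<close>

lemma sum_conj_set:
  assumes X: "X \<in> mats P P"
  shows "(\<Sum>K\<in>Pow {1..N}. conj_set K X J J') = 2 ^ N / 2 ^ n * trace X * mat_one P J J'"
proof -
  define Y where "Y = (\<lambda>J J'. \<Sum>K\<in>Pow {1..N}. conj_set K X J J')"
  have fin: "finite K" if "K \<in> Pow {1..N}" for K using that finite_subset by auto
  have Y: "Y \<in> mats P P"
    unfolding mats_def mem_Collect_eq
  proof (intro allI impI)
    fix i j assume "Y i j \<noteq> 0"
    then obtain K where "K \<in> Pow {1..N}" "conj_set K X i j \<noteq> 0"
      unfolding Y_def by (rule sum.not_neutral_contains_not_neutral)
    then show "i \<in> P \<and> j \<in> P" using conj_set_mats[OF fin X] unfolding mats_def by blast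
  qed
  have comm: "mat_mul P (gam k) Y = mat_mul P Y (gam k)" if k: "k \<in> {1..N}" for k
  proof -
    have "conj_gam k Y = (\<lambda>J J'. \<Sum>K\<in>Pow {1..N}. conj_set (flip {k} K) X J J')"
      unfolding Y_def using fin X by (subst conj_gam_sum) (auto intro!: ext sum.cong simp: conj_gam_conj_set)
    also have "\<dots> = Y" unfolding Y_def using k sum_flip by (intro ext) (rule sum_flip)
    finally have "mat_mul P (gam k) Y = mat_mul P (mat_mul P (gam k) (gam k)) (mat_mul P Y (gam k))"
      using k by (simp add: conj_gam_def mat_mul_assoc)
    then show ?thesis using gam_square[OF k] Y gam_mats[OF k] by (simp add: mat_mul_one_left[OF _ mats_mul])
  qed
  have sc: "Y = mat_scale (Y {} {}) (mat_one P)" by (rule schur[OF Y comm])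
  \<comment> \<open>The trace fixes the scalar: \<open>2 ^ N\<close> conjugates of equal trace on a
    space of dimension \<open>2 ^ n\<close>.\<close>
  have "trace Y = (\<Sum>K\<in>Pow {1..N}. trace (conj_set K X))"
    unfolding trace_def Y_def by (rule sum.swap)
  also have "\<dots> = 2 ^ N * trace X" using trace_conj_set[OF fin X] by (simp add: card_Pow)
  finally have "trace Y = 2 ^ N * trace X" .
  moreover have "trace Y = Y {} {} * 2 ^ n"
    by (subst sc) (simp add: trace_def mat_scale_def sum_distrib_left[symmetric] trace_one[unfolded trace_def])
  ultimately have "Y {} {} = 2 ^ N / 2 ^ n * trace X" by (simp add: field_simps)
  then show ?thesis using fun_cong[OF fun_cong[OF sc, of J], of J'] by (simp add: Y_def mat_scale_def)
qed

end

section \<open>Eliminating pairs of spin factors\<close>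

context spin_setup
begin

lemma ev_delta:
  assumes "v \<in> word_basis (src d)"
  shows "ev d (\<lambda>x. of_bool (x = v)) u = inc_diagram d u v"
proof -
  have "ev d (\<lambda>x. of_bool (x = v)) u = (\<Sum>x\<in>word_basis (src d). if x = v then inc_diagram d u v else 0)"
    unfolding ev_def app_def by (intro sum.cong HOL.refl) auto
  then show ?thesis using assms by simp
qed

text \<open>The map that sends \<open>x\<close> to the sum of all
  \<open>e i \<otimes> e i x\<close>.\<close>

definition coact :: "complex diagram" where
  "coact = (Strand [\<VV>] \<otimes>\<^sub>d Mu) \<circ>\<^sub>d (Cup \<VV> \<otimes>\<^sub>d Strand [\<SS>])"

lemma coact_typed [simp]: "src coact = [\<SS>]" "tgt coact = [\<VV>, \<SS>]" "wf_diagram coact"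
  by (simp_all add: coact_def)

lemma ev_coact:
  assumes "i \<in> basis \<VV>" "b \<in> basis \<SS>"
  shows "ev coact w [i, b] = (\<Sum>c\<in>basis \<SS>. mm i b c * w [c])"
  using assms unfolding coact_def by (simp add: ev_simps bt_V cong: sum.cong_simp)

definition ent :: "complex diagram \<Rightarrow> nat set \<Rightarrow> nat set \<Rightarrow> nat set \<Rightarrow> nat set \<Rightarrow> complex" where
  "ent d = (\<lambda>I J I' J'. inc_diagram d [SpinL I, SpinL J] [SpinL I', SpinL J'])"

text \<open>The endomorphisms of \<open>S \<otimes> S\<close>, by their matrix entries, that are linear combinations of diagrams
  factoring through a power of \<open>V\<close>.\<close>

inductive factors :: "(nat set \<Rightarrow> nat set \<Rightarrow> nat set \<Rightarrow> nat set \<Rightarrow> complex) \<Rightarrow> bool" where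
  base: "p \<in> diagrams [\<SS>, \<SS>] (replicate k \<VV>) \<Longrightarrow> q \<in> diagrams (replicate k \<VV>) [\<SS>, \<SS>] \<Longrightarrow>
    factors (ent (q \<circ>\<^sub>d p))"
| lin: "factors F \<Longrightarrow> factors F' \<Longrightarrow> factors (\<lambda>I J I' J'. a * F I J I' J' + b * F' I J I' J')"

lemma SpinL_in [simp]: "SpinL I \<in> basis \<SS> \<longleftrightarrow> I \<in> P"
  by (auto simp: basis_simps)

lemma ent_outside:
  assumes "d \<in> diagrams [\<SS>, \<SS>] [\<SS>, \<SS>]" "\<not> (I \<in> P \<and> J \<in> P \<and> I' \<in> P \<and> J' \<in> P)"
  shows "ent d I J I' J' = 0"
proof (rule ccontr)
  assume nz: "ent d I J I' J' \<noteq> 0"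
  have "inc_diagram d \<in> mats (word_basis [\<SS>, \<SS>]) (word_basis [\<SS>, \<SS>])"
    using inc_diagram_mats[of d] assms(1) by (simp add: diagrams_def)
  then have "[SpinL I, SpinL J] \<in> word_basis [\<SS>, \<SS>]" "[SpinL I', SpinL J'] \<in> word_basis [\<SS>, \<SS>]"
    using nz unfolding mats_def ent_def by blast+
  then show False using assms(2) by simp
qed

lemma ev_ent:
  assumes "d \<in> diagrams [\<SS>, \<SS>] [\<SS>, \<SS>]"
  shows "ev d w [SpinL I, SpinL J] = (\<Sum>I'\<in>P. \<Sum>J'\<in>P. ent d I J I' J' * w [SpinL I', SpinL J'])"
  using assms by (simp add: ev_def app_def diagrams_def sum_word_basis_Cons sum_basis_S ent_def)

lemma conj_gam_lin:
  "conj_gam i (\<lambda>J J'. a * X J J' + b * Y J J') J J' = a * conj_gam i X J J' + b * conj_gam i Y J J'"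
proof -
  have "(\<lambda>J J'. a * X J J' + b * Y J J') = mat_add (mat_scale a X) (mat_scale b Y)"
    by (simp add: mat_add_def mat_scale_def)
  then show ?thesis
    by (auto simp: conj_gam_def mat_mul_add_left mat_mul_add_right mat_mul_scale_left mat_mul_scale_right)
      (auto simp: mat_add_def mat_scale_def)
qed

text \<open>Multiplying the second factor by \<open>e i\<close> both before \<open>p\<close> and
  after \<open>q\<close>, with \<open>i\<close> summed, is a diagram in which the index
  \<open>i\<close> travels along an additional strand \<open>V\<close> next to the middle
  power.\<close>

lemma factors_step:
  "factors F \<Longrightarrow> factors (\<lambda>I J I' J'. \<Sum>i=1..N. conj_gam i (\<lambda>J J'. F I J I' J') J J')"
proof (induction rule: factors.induct)
  case (lin F F' a b)
  have "(\<lambda>I J I' J'. \<Sum>i=1..N. conj_gam i (\<lambda>J J'. a * F I J I' J' + b * F' I J I' J') J J') =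
    (\<lambda>I J I' J'. a * (\<Sum>i=1..N. conj_gam i (\<lambda>J J'. F I J I' J') J J') + b * (\<Sum>i=1..N. conj_gam i (\<lambda>J J'. F' I J I' J') J J'))"
    unfolding conj_gam_lin sum.distrib sum_distrib_left ..
  then show ?case using factors.lin[OF lin.IH, of a b] by (simp only:)
next
  case (base p k q)
  \<comment> \<open>\<open>p'\<close> emits \<open>e i\<close> from the second spin strand and
    carries it across the first to the far left; \<open>q'\<close> takes it back across and lets it
    act on the second spin strand.\<close>
  define p' where "p' = (Strand [\<VV>] \<otimes>\<^sub>d p) \<circ>\<^sub>d (Cross \<SS> \<VV> \<otimes>\<^sub>d Strand [\<SS>]) \<circ>\<^sub>d (Strand [\<SS>] \<otimes>\<^sub>d coact)"
  define q' where "q' = (Strand [\<SS>] \<otimes>\<^sub>d Mu) \<circ>\<^sub>d (Cross \<VV> \<SS> \<otimes>\<^sub>d Strand [\<SS>]) \<circ>\<^sub>d (Strand [\<VV>] \<otimes>\<^sub>d q)"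
  have p: "src p = [\<SS>, \<SS>]" "tgt p = replicate k \<VV>" "wf_diagram p" using base by (auto simp: diagrams_def)
  have q: "src q = replicate k \<VV>" "tgt q = [\<SS>, \<SS>]" "wf_diagram q" using base by (auto simp: diagrams_def)
  have p'_in: "p' \<in> diagrams [\<SS>, \<SS>] (replicate (Suc k) \<VV>)" by (simp add: p'_def diagrams_def p)
  have q'_in: "q' \<in> diagrams (replicate (Suc k) \<VV>) [\<SS>, \<SS>]" by (simp add: q'_def diagrams_def q)
  have qp: "q \<circ>\<^sub>d p \<in> diagrams [\<SS>, \<SS>] [\<SS>, \<SS>]" using p q by (simp add: diagrams_def)
  have qp': "q' \<circ>\<^sub>d p' \<in> diagrams [\<SS>, \<SS>] [\<SS>, \<SS>]" using p'_in q'_in by (simp add: diagrams_def)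
  have ev_p': "ev p' w (i # u) = ev p (\<lambda>v. \<Sum>d\<in>basis \<SS>. mm i (v ! 1) d * w [v ! 0, d]) u"
    if i: "i \<in> basis \<VV>" for w i u
  proof -
    have "ev p' w (i # u) = ev p (\<lambda>v. ev ((Cross \<SS> \<VV> \<otimes>\<^sub>d Strand [\<SS>]) \<circ>\<^sub>d (Strand [\<SS>] \<otimes>\<^sub>d coact)) w (i # v)) u"
      unfolding p'_def using i p by (simp add: ev_comp ev_tensor ev_Strand)
    also have "ev p (\<lambda>v. ev ((Cross \<SS> \<VV> \<otimes>\<^sub>d Strand [\<SS>]) \<circ>\<^sub>d (Strand [\<SS>] \<otimes>\<^sub>d coact)) w (i # v)) =
      ev p (\<lambda>v. \<Sum>d\<in>basis \<SS>. mm i (v ! 1) d * w [v ! 0, d])"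
      using i by (intro ev_cong)
        (auto simp: p in_word_basis_Cons ev_comp ev_tensor ev_Strand ev_Cross ev_coact sg_def One_nat_def)
    finally show ?thesis .
  qed
  have ev_q': "ev q' h [a, b] = (\<Sum>i\<in>basis \<VV>. \<Sum>c\<in>basis \<SS>. mm i b c * ev q (\<lambda>x. h (i # x)) [a, c])"
    if "a \<in> basis \<SS>" "b \<in> basis \<SS>" for h a b
    unfolding q'_def using that q
    by (simp add: ev_comp ev_tensor ev_Strand ev_Cross ev_Mu sg_def cong: sum.cong_simp)
  have "ent (q' \<circ>\<^sub>d p') I J I' J' = (\<Sum>i=1..N. conj_gam i (\<lambda>J J'. ent (q \<circ>\<^sub>d p) I J I' J') J J')" for I J I' J'
  proof (cases "I \<in> P \<and> J \<in> P \<and> I' \<in> P \<and> J' \<in> P")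
    case True
    let ?w = "\<lambda>x. of_bool (x = [SpinL I', SpinL J']) :: complex"
    have "ent (q' \<circ>\<^sub>d p') I J I' J' = ev (q' \<circ>\<^sub>d p') ?w [SpinL I, SpinL J]"
      using True qp' by (subst ev_delta) (auto simp: diagrams_def ent_def)
    also have "\<dots> = ev q' (ev p' ?w) [SpinL I, SpinL J]"
      using p'_in q'_in by (intro ev_comp) (simp add: diagrams_def)
    also have "\<dots> = (\<Sum>i\<in>basis \<VV>. \<Sum>c\<in>basis \<SS>. mm i (SpinL J) c *
        ev (q \<circ>\<^sub>d p) (\<lambda>v. \<Sum>d\<in>basis \<SS>. mm i (v ! 1) d * ?w [v ! 0, d]) [SpinL I, c])"
      using True p q by (simp add: ev_q' ev_p' ev_comp cong: sum.cong_simp)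
    also have "\<dots> = (\<Sum>i=1..N. \<Sum>K\<in>P. gam i J K * (\<Sum>I''\<in>P. \<Sum>L\<in>P. ent (q \<circ>\<^sub>d p) I K I'' L *
        (\<Sum>L'\<in>P. gam i L L' * of_bool (I'' = I' \<and> L' = J'))))"
      unfolding sum_basis_V sum_basis_S ev_ent[OF qp] by (simp add: mm_def One_nat_def)
    also have "\<dots> = (\<Sum>i=1..N. \<Sum>K\<in>P. gam i J K * (\<Sum>L\<in>P. ent (q \<circ>\<^sub>d p) I K I' L * gam i L J'))"
    proof -
      have s: "(\<Sum>L'\<in>P. gam i L L' * of_bool (I'' = I' \<and> L' = J')) = (if I'' = I' then gam i L J' else 0)" for i L I''
        using True by (simp add: of_bool_def if_distrib[where f = "\<lambda>x. _ * x"] cong: if_cong)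
      have "(\<Sum>I''\<in>P. \<Sum>L\<in>P. ent (q \<circ>\<^sub>d p) I K I'' L * (if I'' = I' then gam i L J' else 0)) =
          (\<Sum>I''\<in>P. if I'' = I' then \<Sum>L\<in>P. ent (q \<circ>\<^sub>d p) I K I' L * gam i L J' else 0)" for i K
        by (intro sum.cong HOL.refl) auto
      then show ?thesis using True by (simp add: s)
    qed
    also have "\<dots> = (\<Sum>i=1..N. conj_gam i (\<lambda>J J'. ent (q \<circ>\<^sub>d p) I J I' J') J J')"
      by (intro sum.cong HOL.refl) (simp add: conj_gam_def mat_mul_def)
    finally show ?thesis .
  next
    case False
    have X: "(\<lambda>J J'. ent (q \<circ>\<^sub>d p) I J I' J') \<in> mats P P"
      using ent_outside[OF qp] unfolding mats_def by blast
    have "conj_gam i (\<lambda>J J'. ent (q \<circ>\<^sub>d p) I J I' J') J J' = 0" for i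
    proof (cases "J \<in> P \<and> J' \<in> P")
      case True
      then have "(\<lambda>J J'. ent (q \<circ>\<^sub>d p) I J I' J') = (\<lambda>J J'. 0)" using False ent_outside[OF qp] by blast
      then show ?thesis by (simp add: conj_gam_def mat_mul_def)
    next
      case False
      then show ?thesis using conj_gam_mats[OF X, of i] unfolding mats_def by blast
    qed
    then show ?thesis using False ent_outside[OF qp'] by simp
  qed
  then have "ent (q' \<circ>\<^sub>d p') = (\<lambda>I J I' J'. \<Sum>i=1..N. conj_gam i (\<lambda>J J'. ent (q \<circ>\<^sub>d p) I J I' J') J J')"
    by (intro ext)
  then show ?case using factors.base[OF p'_in q'_in] by simp
qed

text \<open>The value at \<open>VecL\<close> is a default: only the labels of spin factors
  matter.\<close>

fun label_set :: "label \<Rightarrow> nat set" where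
  "label_set (SpinL I) = I"
| "label_set (VecL i) = {}"

definition apply4 :: "(nat set \<Rightarrow> nat set \<Rightarrow> nat set \<Rightarrow> nat set \<Rightarrow> complex) \<Rightarrow> (label list \<Rightarrow> complex) \<Rightarrow> label list \<Rightarrow> complex" where
  "apply4 F w u = (\<Sum>I'\<in>P. \<Sum>J'\<in>P. F (label_set (u ! 0)) (label_set (u ! 1)) I' J' *
     w (SpinL I' # SpinL J' # drop 2 u))"

text \<open>The first half of the diagram carries \<open>w\<close> to an invariant of vector factors
  and \<open>Y\<close>, where realizability is assumed; the second half carries the realization
  back.\<close>

lemma factors_apply:
  assumes "factors F" and full: "\<And>k. inv_full (replicate k \<VV> @ Y)" and w: "invariant ([\<SS>, \<SS>] @ Y) w"
  shows "realizable ([\<SS>, \<SS>] @ Y) (apply4 F w)"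
  using assms(1)
proof (induction rule: factors.induct)
  case (lin F F' a b)
  have "apply4 (\<lambda>I J I' J'. a * F I J I' J' + b * F' I J I' J') w = (\<lambda>u. a * apply4 F w u + b * apply4 F' w u)"
    by (simp add: apply4_def fun_eq_iff sum.distrib sum_distrib_left algebra_simps)
  then show ?case using realizable_lin[OF lin.IH] by simp
next
  case (base p k q)
  have pY: "p \<otimes>\<^sub>d Strand Y \<in> diagrams ([\<SS>, \<SS>] @ Y) (replicate k \<VV> @ Y)"
    and qY: "q \<otimes>\<^sub>d Strand Y \<in> diagrams (replicate k \<VV> @ Y) ([\<SS>, \<SS>] @ Y)"
    and qp: "q \<circ>\<^sub>d p \<in> diagrams [\<SS>, \<SS>] [\<SS>, \<SS>]"
    using base by (simp_all add: diagrams_def)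
  have "realizable ([\<SS>, \<SS>] @ Y) (ev (q \<otimes>\<^sub>d Strand Y) (ev (p \<otimes>\<^sub>d Strand Y) w))"
    by (rule realizable_ev[OF qY realizable_inv_full[OF full invariant_ev[OF pY w]]])
  moreover have "ev (q \<otimes>\<^sub>d Strand Y) (ev (p \<otimes>\<^sub>d Strand Y) w) u = apply4 (ent (q \<circ>\<^sub>d p)) w u"
    if u: "u \<in> word_basis ([\<SS>, \<SS>] @ Y)" for u
  proof -
    obtain I J v where u: "u = SpinL I # SpinL J # v" "I \<in> P" "J \<in> P" "v \<in> word_basis Y"
      using u by (auto simp: in_word_basis_Cons basis_simps)
    have tp: "tgt p = replicate k \<VV>" "src q = tgt p" "tgt q = [\<SS>, \<SS>]"
      using base by (auto simp: diagrams_def)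
    have "ev (q \<otimes>\<^sub>d Strand Y) (ev (p \<otimes>\<^sub>d Strand Y) w) u =
        ev q (\<lambda>x. ev (p \<otimes>\<^sub>d Strand Y) w (x @ v)) [SpinL I, SpinL J]"
      using u tp by (simp add: ev_tensor ev_Strand)
    also have "ev q (\<lambda>x. ev (p \<otimes>\<^sub>d Strand Y) w (x @ v)) = ev q (ev p (\<lambda>x. w (x @ v)))"
      using u tp length_word_basis by (intro ev_cong) (auto simp: ev_tensor ev_Strand)
    also have "ev q (ev p (\<lambda>x. w (x @ v))) [SpinL I, SpinL J] = ev (q \<circ>\<^sub>d p) (\<lambda>x. w (x @ v)) [SpinL I, SpinL J]"
      using tp by (simp add: ev_comp)
    also have "\<dots> = apply4 (ent (q \<circ>\<^sub>d p)) w u"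
      by (simp add: ev_ent[OF qp] apply4_def u One_nat_def numeral_2_eq_2)
    finally show ?thesis .
  qed
  ultimately show ?case using realizable_cong by blast
qed

text \<open>The Fierz identity: the layers of \<open>cup \<circ> cap\<close> add up to a multiple of the identity of \<open>S \<otimes> S\<close>.\<close>

lemma inv_full_reduce:
  assumes full: "\<And>k. inv_full (replicate k \<VV> @ Y)"
  shows "inv_full ([\<SS>, \<SS>] @ Y)"
  unfolding inv_full_def
proof (intro allI impI)
  fix w assume w: "invariant ([\<SS>, \<SS>] @ Y) w"
  define F0 where "F0 = ent (Cup \<SS> \<circ>\<^sub>d Cap \<SS>)"
  have cc: "Cup \<SS> \<circ>\<^sub>d Cap \<SS> \<in> diagrams [\<SS>, \<SS>] [\<SS>, \<SS>]" by (simp add: diagrams_def)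
  define lay where "lay k = (\<lambda>I J I' J'. layer k (\<lambda>J J'. F0 I J I' J') J J')" for k
  have X: "(\<lambda>J J'. F0 I J I' J') \<in> mats P P" for I I'
    using ent_outside[OF cc] unfolding mats_def F0_def by blast
  \<comment> \<open>The cup after the cap factors through the empty word, the zeroth power of
    \<open>V\<close>.\<close>
  have F0: "factors F0"
    unfolding F0_def by (rule factors.base[of _ 0]) (simp_all add: diagrams_def)
  have F0_val: "F0 I J I' J' = (if J = {1..n} - I \<and> J' = {1..n} - I' then bb J * bb I' else 0)"
    if "I \<in> P" "J \<in> P" "I' \<in> P" "J' \<in> P" for I J I' J'
  proof -
    have "F0 I J I' J' = ev (Cup \<SS> \<circ>\<^sub>d Cap \<SS>) (\<lambda>x. of_bool (x = [SpinL I', SpinL J'])) [SpinL I, SpinL J]"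
      using that unfolding F0_def ent_def by (subst ev_delta) auto
    also have "\<dots> = (if J = {1..n} - I then bb J * (\<Sum>K\<in>P. bb K * of_bool (K = I' \<and> {1..n} - K = J')) else 0)"
      using that by (simp add: ev_comp ev_Cup ev_Cap sum_basis_S)
    also have "(\<Sum>K\<in>P. bb K * of_bool (K = I' \<and> {1..n} - K = J')) = (\<Sum>K\<in>P. if K = I' then if J' = {1..n} - I' then bb I' else 0 else 0)"
      by (intro sum.cong HOL.refl) auto
    finally show ?thesis using that by auto
  qed
  have fac: "factors (lay k)" for k
  proof (induction k rule: less_induct)
    case (less k)
    show ?case
    proof (cases k)
      case 0
      have "layer 0 X J J' = X J J'" for X J J'
      proof -
        have "layer 0 X J J' = (\<Sum>K\<in>Pow {1..N}. if K = {} then X J J' else 0)"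
          unfolding layer_def by (intro sum.cong HOL.refl) (auto simp: finite_subset)
        then show ?thesis by simp
      qed
      then show ?thesis using F0 0 by (simp add: lay_def)
    next
      case (Suc m)
      \<comment> \<open>The layer before \<open>m\<close>, zero for \<open>m = 0\<close>. The
        recursion is then solved for layer \<open>m + 1\<close>.\<close>
      define R where "R = (\<lambda>I J I' J'. \<Sum>K\<in>Pow {1..N}. if card K + 1 = m then conj_set K (\<lambda>J J'. F0 I J I' J') J J' else 0)"
      have R: "factors R"
      proof (cases m)
        case 0
        have "factors (\<lambda>I J I' J'. 0 * F0 I J I' J' + 0 * F0 I J I' J')" by (rule factors.lin[OF F0 F0])
        then show ?thesis by (simp add: R_def 0)
      next
        case (Suc m')
        then have "R = lay m'" by (simp add: R_def lay_def layer_def)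
        then show ?thesis using less.IH[of m'] Suc \<open>k = Suc m\<close> by simp
      qed
      have "factors (\<lambda>I J I' J'. \<Sum>i=1..N. conj_gam i (\<lambda>J J'. lay m I J I' J') J J')"
        using less.IH[of m] Suc by (intro factors_step) simp
      then have "factors (\<lambda>I J I' J'. (1 / of_nat (m + 1)) * (\<Sum>i=1..N. conj_gam i (\<lambda>J J'. lay m I J I' J') J J') +
          (- of_nat (N + 1 - m) / of_nat (m + 1)) * R I J I' J')"
        using R by (rule factors.lin)
      also have "(\<lambda>I J I' J'. (1 / of_nat (m + 1)) * (\<Sum>i=1..N. conj_gam i (\<lambda>J J'. lay m I J I' J') J J') +
          (- of_nat (N + 1 - m) / of_nat (m + 1)) * R I J I' J') = lay k"
      proof (intro ext)
        fix I J I' J'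
        have nz: "(of_nat (m + 1) :: complex) \<noteq> 0" by (metis of_nat_eq_0_iff add_is_0 one_neq_zero)
        have "(\<Sum>i=1..N. conj_gam i (\<lambda>J J'. lay m I J I' J') J J') =
            of_nat (m + 1) * lay k I J I' J' + of_nat (N + 1 - m) * R I J I' J'"
          using conj_gam_layer[OF X, of m I I' J J'] by (simp add: lay_def R_def Suc Suc_eq_plus1)
        then show "(1 / of_nat (m + 1)) * (\<Sum>i=1..N. conj_gam i (\<lambda>J J'. lay m I J I' J') J J') +
          (- of_nat (N + 1 - m) / of_nat (m + 1)) * R I J I' J' = lay k I J I' J'"
          using nz by (simp add: divide_simps del: of_nat_add of_nat_Suc)
      qed
      finally show ?thesis .
    qed
  qed
  define c where "c = (2 ^ N / 2 ^ n * \<sigma> :: complex)"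
  have c: "c \<noteq> 0" by (simp add: c_def \<sigma>_def)
  \<comment> \<open>For fixed indices of the first factor, the block of cup after cap on the second
    factor has trace \<open>\<sigma>\<close> on the diagonal and 0 off it. So the summed conjugates
    are \<open>c\<close> times the identity of the tensor square.\<close>
  have tr: "trace (\<lambda>J J'. F0 I J I' J') = (if I = I' then \<sigma> else 0)" if "I \<in> P" "I' \<in> P" for I I'
  proof -
    have "trace (\<lambda>J J'. F0 I J I' J') = (\<Sum>J\<in>P. if J = {1..n} - I then if I = I' then \<sigma> else 0 else 0)"
      unfolding trace_def
    proof (intro sum.cong HOL.refl)
      fix J assume "J \<in> P"
      have "{1..n} - I = {1..n} - I' \<longleftrightarrow> I = I'" using that by (auto simp: in_P_iff)
      then show "F0 I J I' J = (if J = {1..n} - I then if I = I' then \<sigma> else 0 else 0)"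
        using F0_val[OF that(1) \<open>J \<in> P\<close> that(2) \<open>J \<in> P\<close>] bb_complement[OF that(1)] by (auto simp: mult.commute)
    qed
    then show ?thesis by (simp add: compl_in_P)
  qed
  have real: "realizable ([\<SS>, \<SS>] @ Y) (\<lambda>u. inverse c * (\<Sum>k\<le>N. apply4 (lay k) w u))"
    by (intro realizable_scale realizable_sum factors_apply[OF fac full w])
  have eq: "inverse c * (\<Sum>k\<le>N. apply4 (lay k) w u) = w u" if u: "u \<in> word_basis ([\<SS>, \<SS>] @ Y)" for u
  proof -
    obtain I J v where u: "u = SpinL I # SpinL J # v" "I \<in> P" "J \<in> P" "v \<in> word_basis Y"
      using u by (auto simp: in_word_basis_Cons basis_simps)
    have "(\<Sum>k\<le>N. apply4 (lay k) w u) =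
        (\<Sum>k\<le>N. \<Sum>I'\<in>P. \<Sum>J'\<in>P. lay k I J I' J' * w (SpinL I' # SpinL J' # v))"
      by (simp add: apply4_def u One_nat_def numeral_2_eq_2)
    also have "\<dots> = (\<Sum>I'\<in>P. \<Sum>J'\<in>P. (\<Sum>k\<le>N. lay k I J I' J') * w (SpinL I' # SpinL J' # v))"
      unfolding sum_distrib_right
      by (subst sum.swap) (rule sum.cong[OF HOL.refl], rule sum.swap)
    also have "\<dots> = (\<Sum>I'\<in>P. \<Sum>J'\<in>P. if J' = J then if I' = I then c * w u else 0 else 0)"
    proof (intro sum.cong HOL.refl)
      fix I' J' assume "I' \<in> P" "J' \<in> P"
      then show "(\<Sum>k\<le>N. lay k I J I' J') * w (SpinL I' # SpinL J' # v) = (if J' = J then if I' = I then c * w u else 0 else 0)"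
        unfolding lay_def sum_layers sum_conj_set[OF X] using u
        by (auto simp: tr c_def mat_one_def mat_of_def)
    qed
    also have "\<dots> = c * w u" using u by simp
    finally show ?thesis using c by simp
  qed
  show "realizable ([\<SS>, \<SS>] @ Y) w" by (rule iffD1[OF realizable_cong real]) (rule eq)
qed

lemma inv_full_words:
  assumes V: "\<And>k. inv_full (replicate k \<VV>)"
  shows "inv_full Y"
proof (induction "count_list Y \<SS>" arbitrary: Y rule: less_induct)
  case less
  show ?case
  proof (cases "\<SS> \<in> set Y")
    case False
    then have "Y = replicate (length Y) \<VV>"
    proof (intro replicate_eqI HOL.refl)
      fix y assume "y \<in> set Y"
      then have "y \<noteq> \<SS>" using False by blast
      then show "y = \<VV>" by (cases y) simp_all
    qed
    then show ?thesis using V[of "length Y"] by simp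
  next
    case True
    then obtain A R where A: "Y = A @ \<SS> # R" by (meson split_list)
    show ?thesis
    proof (cases "\<SS> \<in> set (A @ R)")
      case False
      then have "count_list Y \<SS> = 1" unfolding A by (simp add: count_list_0_iff)
      then show ?thesis by (intro inv_full_odd) simp
    next
      case True
      then obtain B C where B: "A @ R = B @ \<SS> # C" by (meson split_list)
      have count: "count_list Y \<SS> = count_list (A @ R) \<SS> + 1" by (simp add: A)
      \<comment> \<open>Two spin factors are traded for vector factors, so the count drops whatever
        \<open>k\<close> is.\<close>
      have "count_list (replicate k \<VV> @ B @ C) \<SS> < count_list Y \<SS>" for k
      proof -
        have "count_list (replicate k \<VV>) \<SS> = 0" by (simp add: count_list_0_iff)
        then show ?thesis unfolding count B by simp
      qed
      then have "inv_full ([\<SS>, \<SS>] @ (B @ C))" by (intro inv_full_reduce less)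
      then have "inv_full ([\<SS>] @ B @ [\<SS>] @ C)" using inv_full_move[of "[\<SS>]" \<SS> B C] by simp
      then have "inv_full ([] @ [\<SS>] @ A @ R)" using B by simp
      then show ?thesis using inv_full_move[of "[]" \<SS> A R] A by simp
    qed
  qed
qed

subsection \<open>Bending\<close>

lemma homs_realized:
  assumes full: "\<And>Y. inv_full Y"
  shows "A \<in> module_homs GV (inc_obj X) (inc_obj Y) \<Longrightarrow> \<exists>d\<in>diagrams X Y. inc_diagram d = A"
proof (induction X arbitrary: Y A)
  case Nil
  note A = module_homs_mats[OF Nil]
  let ?w = "\<lambda>u. A u []"
  have "app (word_basis []) A w = (\<lambda>u. A u [] * w [])" for w
    by (simp add: app_def)
  then have "act Y g ?w u = ?w u" if "g \<in> GV" "u \<in> word_basis Y" for g u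
    using equivariant_iff[OF A] Nil that by (auto simp: act_Nil dest!: bspec spec[of _ "\<lambda>_. 1"])
  then have "realizable Y ?w" using full by (simp add: inv_full_def invariant_def)
  then obtain d where d: "d \<in> diagrams [] Y" "\<And>u. u \<in> word_basis Y \<Longrightarrow> A u [] = ev d (\<lambda>_. 1) u"
    by (auto simp: realizable_def)
  have "inc_diagram d = A"
    using d A inc_diagram_mats[of d]
    by (intro mat_eqI[of _ "word_basis Y" "word_basis []"]) (auto simp: diagrams_def ev_def app_def)
  then show ?case using d(1) by blast
next
  case (Cons x X)
  note A = Cons.prems
  have cup: "inc_diagram (Cup x) \<in> module_homs GV (inc_obj []) (inc_obj [x, x])"
    using inc_diagram_homs[of "Cup x"] by (simp del: inc_obj.simps inc_diagram.simps)
  define A' where "A' = mat_mul (word_basis ([x] @ x # X)) (mat_tensor (length [x]) (length [x]) (mat_one (word_basis [x])) A)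
    (mat_tensor (length [x, x]) (length ([] :: colour list)) (inc_diagram (Cup x)) (mat_one (word_basis X)))"
  have "mat_tensor (length [x, x]) (length ([] :: colour list)) (inc_diagram (Cup x)) (mat_one (word_basis X))
      \<in> module_homs GV (inc_obj ([] @ X)) (inc_obj ([x, x] @ X))"
    by (rule homs_tensor[OF cup homs_one])
  then have "A' \<in> module_homs GV (inc_obj X) (inc_obj ([x] @ Y))"
    unfolding A'_def using homs_tensor[OF homs_one[of "[x]"] A]
    by (intro homs_mul) (simp_all del: inc_obj.simps inc_diagram.simps)
  then obtain d' where d': "d' \<in> diagrams X ([x] @ Y)" "inc_diagram d' = A'" using Cons.IH by blast
  define d where "d = (Cap x \<otimes>\<^sub>d Strand Y) \<circ>\<^sub>d (Strand [x] \<otimes>\<^sub>d d')"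
  have d: "d \<in> diagrams (x # X) Y" using d'(1) by (simp add: d_def diagrams_def)
  \<comment> \<open>The bent-up output \<open>b\<close> is paired by the cup with the first input of
    \<open>A\<close>, which must then be \<open>co b\<close>; the sign is that of the dual
    basis.\<close>
  have ev_d': "ev d' w (b # u) = app (word_basis (x # X)) A (\<lambda>y. if hd y = co b then bt (co b) * w (tl y) else 0) u"
    if "b \<in> basis x" for w b u
  proof -
    let ?C = "mat_tensor (length [x, x]) (length ([] :: colour list)) (inc_diagram (Cup x)) (mat_one (word_basis X))"
    have C: "app (word_basis X) ?C w (b # y) = (if hd y = co b then bt (co b) * w (tl y) else 0)"
      if y: "y \<in> word_basis (x # X)" for y
    proof -
      obtain c v where y: "y = c # v" "c \<in> basis x" "v \<in> word_basis X" using y by (auto simp: in_word_basis_Cons)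
      have "app (word_basis X) ?C w (b # y) = ev (Cup x \<otimes>\<^sub>d Strand X) w (b # y)"
        by (simp add: ev_def)
      then show ?thesis
        using y \<open>b \<in> basis x\<close> by (simp add: ev_tensor ev_Strand ev_Cup)
    qed
    have "ev d' w (b # u) = app (word_basis X) A' w (b # u)"
      using d' by (simp add: ev_def diagrams_def)
    also have "\<dots> = app (listset (map basis [x] @ map basis (x # X))) (mat_tensor (length [x]) (length [x]) (mat_one (word_basis [x])) A)
        (app (word_basis X) ?C w) (b # u)"
      unfolding A'_def by (simp only: app_mul) (simp add: word_basis_def)
    also have "\<dots> = app (word_basis [x]) (mat_one (word_basis [x])) (\<lambda>z. app (word_basis (x # X)) A
        (\<lambda>y. app (word_basis X) ?C w (z @ y)) u) [b]"
      by (subst app_tensor) (simp_all add: word_basis_def)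
    also have "\<dots> = app (word_basis (x # X)) A (\<lambda>y. app (word_basis X) ?C w (b # y)) u"
      using that by (subst app_one) simp_all
    also have "\<dots> = app (word_basis (x # X)) A (\<lambda>y. if hd y = co b then bt (co b) * w (tl y) else 0) u"
      by (rule fun_cong[OF app_cong[OF C]])
    finally show ?thesis .
  qed
  have "inc_diagram d = A"
  proof (rule mat_eqI)
    show "inc_diagram d \<in> mats (word_basis Y) (word_basis (x # X))"
      using inc_diagram_mats[of d] d by (simp add: diagrams_def)
    show "A \<in> mats (word_basis Y) (word_basis (x # X))" by (rule module_homs_mats[OF A])
    fix w u assume u: "u \<in> word_basis Y"
    have "app (word_basis (x # X)) (inc_diagram d) w u = ev d w u" using d by (simp add: ev_def diagrams_def)
    also have "\<dots> = (\<Sum>a\<in>basis x. bt a * ev d' (\<lambda>y. w (a # y)) (co a # u))"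
      unfolding d_def using d'(1) u
      by (simp add: ev_comp ev_tensor ev_Cap ev_Strand diagrams_def cong: sum.cong_simp)
    also have "\<dots> = (\<Sum>a\<in>basis x. bt a * app (word_basis (x # X)) A (\<lambda>y. if hd y = a then bt a * w (a # tl y) else 0) u)"
      by (intro sum.cong HOL.refl) (simp add: ev_d' cong: if_cong)
    \<comment> \<open>The sign of the cap meets the equal sign left by the cup, and they cancel:
      this is the zigzag.\<close>
    also have "\<dots> = (\<Sum>a\<in>basis x. app (word_basis (x # X)) A (\<lambda>y. if hd y = a then w (a # tl y) else 0) u)"
      by (simp add: app_smult[symmetric] mult_if_zero cong: if_cong)
    also have "\<dots> = app (word_basis (x # X)) A (\<lambda>y. \<Sum>a\<in>basis x. if hd y = a then w (a # tl y) else 0) u"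
      by (rule app_sum[symmetric])
    also have "\<dots> = app (word_basis (x # X)) A w u"
      by (rule fun_cong[OF app_cong]) (auto simp: in_word_basis_Cons)
    finally show "app (word_basis (x # X)) (inc_diagram d) w u = app (word_basis (x # X)) A w u" .
  qed simp
  then show ?case using d by blast
qed

lemma full_if_inv_full:
  assumes "\<And>k. inv_full (replicate k \<VV>)"
  shows "full_functor SB G_mod inc_obj inc_mor"
  unfolding full_functor_def SB_simps
proof (intro ballI)
  fix X Y :: "colour list"
  have "inc_mor X Y ` cls ` diagrams X Y = inc_diagram ` diagrams X Y"
    unfolding image_image by (intro image_cong HOL.refl) (simp add: inc_mor_cls diagrams_def)
  also have "\<dots> = module_homs GV (inc_obj X) (inc_obj Y)"
    using homs_realized[OF inv_full_words[OF assms]] inc_diagram_homs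
    by (fastforce simp: diagrams_def)
  finally show "inc_mor X Y ` cls ` diagrams X Y = Hom G_mod (inc_obj X) (inc_obj Y)"
    by (simp add: G_mod_def module_category_def)
qed

end

section \<open>Invariants of tensor powers of the vector module\<close>

abbreviation tp :: "'a \<Rightarrow> 'a \<Rightarrow> 'a \<Rightarrow> 'a" where "tp \<equiv> Transposition.transpose"

text \<open>Every transposition arises from adjacent ones by repeated conjugation. Closure under
  \<open>s \<circ> t \<circ> s\<close> suits both uses: stability under permutations, and a sign
  change, since three changes amount to one.\<close>

lemma tp_adjacent_induct:
  fixes a b :: nat
  assumes "a < b" "b < m"
    and adj: "\<And>a. Suc a < m \<Longrightarrow> Q (tp a (Suc a))"
    and conj: "\<And>s t. Q s \<Longrightarrow> Q t \<Longrightarrow> Q (s \<circ> t \<circ> s)"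
  shows "Q (tp a b)"
  using assms(1,2)
proof (induction b)
  case (Suc b)
  show ?case
  proof (cases "a = b")
    case True
    then show ?thesis using adj Suc.prems by simp
  next
    case False
    then have "tp a (Suc b) = tp b (Suc b) \<circ> tp a b \<circ> tp b (Suc b)"
      using Suc.prems by (auto simp: fun_eq_iff Transposition.transpose_def)
    then show ?thesis using conj[OF adj[of b] Suc.IH] Suc.prems False by (simp only:)
  qed
qed simp

context spin_setup
begin

definition dom :: "nat \<Rightarrow> (nat \<Rightarrow> nat) set" where
  "dom m = {u. \<forall>a<m. u a \<in> {1..N}}"

definition lab :: "nat \<Rightarrow> (nat \<Rightarrow> nat) \<Rightarrow> label list" where
  "lab m u = map (\<lambda>a. VecL (u a)) [0..<m]"

text \<open>Tensors in \<open>V^m\<close> as functions of an index function \<open>u\<close>, of which only the values at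
  \<open>0, \<dots>, m - 1\<close> matter.\<close>

definition vinv :: "nat \<Rightarrow> ((nat \<Rightarrow> nat) \<Rightarrow> complex) \<Rightarrow> bool" where
  "vinv m W \<longleftrightarrow> (\<exists>w. invariant (replicate m \<VV>) w \<and> (\<forall>u\<in>dom m. W u = w (lab m u)))"

definition vreal :: "nat \<Rightarrow> ((nat \<Rightarrow> nat) \<Rightarrow> complex) \<Rightarrow> bool" where
  "vreal m W \<longleftrightarrow> (\<exists>w. realizable (replicate m \<VV>) w \<and> (\<forall>u\<in>dom m. W u = w (lab m u)))"

lemma lab_in: "u \<in> dom m \<Longrightarrow> lab m u \<in> word_basis (replicate m \<VV>)"
proof -
  have "map f xs \<in> word_basis (replicate (length xs) \<VV>) \<longleftrightarrow> (\<forall>x\<in>set xs. f x \<in> basis \<VV>)" for f and xs :: "nat list"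
    by (induction xs) auto
  from this[of "\<lambda>a. VecL (u a)" "[0..<m]"] show "u \<in> dom m \<Longrightarrow> lab m u \<in> word_basis (replicate m \<VV>)"
    by (auto simp: lab_def dom_def basis_simps)
qed

lemma word_basis_lab:
  assumes "l \<in> word_basis (replicate m \<VV>)"
  obtains u where "u \<in> dom m" "l = lab m u"
proof -
  have nth: "l ! a \<in> basis \<VV>" if "a < m" for a
    using assms that
  proof (induction m arbitrary: l a)
    case (Suc m)
    then show ?case by (cases a) (auto simp: in_word_basis_Cons)
  qed simp
  then have "\<forall>a<m. \<exists>i\<in>{1..N}. l ! a = VecL i" by (auto simp: basis_simps)
  then obtain u where u: "\<forall>a<m. u a \<in> {1..N} \<and> l ! a = VecL (u a)" by metis
  have "l = lab m u"
    unfolding lab_def using u length_word_basis[OF assms] by (intro nth_equalityI) auto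
  then show ?thesis using that u by (auto simp: dom_def)
qed

lemma vreal_cong: "(\<And>u. u \<in> dom m \<Longrightarrow> W u = W' u) \<Longrightarrow> vreal m W \<longleftrightarrow> vreal m W'"
  by (simp add: vreal_def)

lemma vreal_lin: "vreal m W \<Longrightarrow> vreal m W' \<Longrightarrow> vreal m (\<lambda>u. a * W u + b * W' u)"
  unfolding vreal_def by (metis (no_types, lifting) realizable_lin)

lemma vinv_lin: "vinv m W \<Longrightarrow> vinv m W' \<Longrightarrow> vinv m (\<lambda>u. a * W u + b * W' u)"
  unfolding vinv_def by (metis (no_types, lifting) invariant_lin)

lemma vreal_zero: "vreal m (\<lambda>_. 0)"
  unfolding vreal_def by (metis realizable_zero)

lemma vinv_zero: "vinv m (\<lambda>_. 0)"
  unfolding vinv_def invariant_def act_def by (intro exI[of _ "\<lambda>_. 0"]) (simp add: app_zero)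

lemma vreal_scale: "vreal m W \<Longrightarrow> vreal m (\<lambda>u. a * W u)"
  using vreal_lin[of m W W a 0] by simp

lemma vreal_add: "vreal m W \<Longrightarrow> vreal m W' \<Longrightarrow> vreal m (\<lambda>u. W u + W' u)"
  using vreal_lin[of m W W' 1 1] by simp

lemma vreal_diff: "vreal m W \<Longrightarrow> vreal m W' \<Longrightarrow> vreal m (\<lambda>u. W u - W' u)"
  using vreal_lin[of m W W' 1 "-1"] by simp

lemma vinv_diff: "vinv m W \<Longrightarrow> vinv m W' \<Longrightarrow> vinv m (\<lambda>u. W u - W' u)"
  using vinv_lin[of m W W' 1 "-1"] by simp

lemma vreal_sum: "(\<And>i. i \<in> A \<Longrightarrow> vreal m (W i)) \<Longrightarrow> vreal m (\<lambda>u. \<Sum>i\<in>A. W i u)"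
  by (induction A rule: infinite_finite_induct) (auto intro: vreal_zero vreal_add)

lemma vinv_sum: "(\<And>i. i \<in> A \<Longrightarrow> vinv m (W i)) \<Longrightarrow> vinv m (\<lambda>u. \<Sum>i\<in>A. W i u)"
proof (induction A rule: infinite_finite_induct)
  case (insert i A)
  then show ?case using vinv_lin[of m "W i" "\<lambda>u. \<Sum>i\<in>A. W i u" 1 1] by simp
qed (auto intro: vinv_zero)

lemma inv_full_V: "(\<And>W. vinv m W \<Longrightarrow> vreal m W) \<Longrightarrow> inv_full (replicate m \<VV>)"
  unfolding inv_full_def
proof (intro allI impI)
  fix w assume all: "\<And>W. vinv m W \<Longrightarrow> vreal m W" and w: "invariant (replicate m \<VV>) w"
  have "vinv m (\<lambda>u. w (lab m u))" unfolding vinv_def using w by blast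
  then obtain w' where w': "realizable (replicate m \<VV>) w'" "\<And>u. u \<in> dom m \<Longrightarrow> w (lab m u) = w' (lab m u)"
    using all unfolding vreal_def by blast
  have "w' l = w l" if "l \<in> word_basis (replicate m \<VV>)" for l
    using that w'(2) by (metis word_basis_lab)
  from iffD1[OF realizable_cong w'(1), OF this] show "realizable (replicate m \<VV>) w" .
qed

subsection \<open>Permutations\<close>

lemma dom_tp: "a < m \<Longrightarrow> b < m \<Longrightarrow> u \<in> dom m \<Longrightarrow> u \<circ> tp a b \<in> dom m"
  by (auto simp: dom_def Transposition.transpose_def)

lemma replicate_split:
  assumes "Suc a < m"
  shows "replicate m x = replicate a x @ [x, x] @ replicate (m - a - 2) x"
proof -
  have "m = a + (2 + (m - a - 2))" using assms by simp
  then show ?thesis by (metis replicate_add replicate_Suc numeral_2_eq_2 replicate_0 append_Cons append_Nil)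
qed

lemma lab_split:
  assumes "Suc a < m"
  shows "lab m u = lab a u @ [VecL (u a), VecL (u (Suc a))] @ map (\<lambda>a. VecL (u a)) [Suc (Suc a)..<m]"
proof -
  have "[0..<m] = [0..<a] @ a # Suc a # [Suc (Suc a)..<m]"
    using assms by (metis Suc_lessD less_imp_le_nat plus_nat.add_0 upt_add_eq_append upt_conv_Cons le_add_diff_inverse zero_le)
  then show ?thesis by (simp add: lab_def)
qed

definition cross_V :: "nat \<Rightarrow> nat \<Rightarrow> complex diagram" where
  "cross_V m a = cross_at (replicate a \<VV>) \<VV> \<VV> (replicate (m - a - 2) \<VV>)"

lemma lab_swap:
  assumes "Suc a < m" "u \<in> dom m"
  shows "ev (cross_V m a) w (lab m u) = w (lab m (u \<circ> tp a (Suc a)))"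
proof -
  let ?q = "map (\<lambda>a. VecL (u a)) [Suc (Suc a)..<m]"
  have "lab m u \<in> word_basis (replicate a \<VV> @ [\<VV>, \<VV>] @ replicate (m - a - 2) \<VV>)"
    using lab_in[OF assms(2)] replicate_split[OF assms(1), of \<VV>] by simp
  then have "lab a u \<in> word_basis (replicate a \<VV>)" "VecL (u a) \<in> basis \<VV>" "VecL (u (Suc a)) \<in> basis \<VV>"
    "?q \<in> word_basis (replicate (m - a - 2) \<VV>)"
    unfolding lab_split[OF assms(1)] by (simp_all add: append_in_word_basis lab_def)
  then have "ev (cross_at (replicate a \<VV>) \<VV> \<VV> (replicate (m - a - 2) \<VV>)) w (lab m u) =
      w (lab a u @ [VecL (u (Suc a)), VecL (u a)] @ ?q)"
    unfolding lab_split[OF assms(1)] by (simp add: ev_cross_at[simplified] sg_def)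
  moreover have "lab m (u \<circ> tp a (Suc a)) = lab a u @ [VecL (u (Suc a)), VecL (u a)] @ ?q"
    unfolding lab_split[OF assms(1)] by (auto simp: lab_def Transposition.transpose_def)
  ultimately show ?thesis unfolding cross_V_def by simp
qed

lemma cross_V_in:
  assumes "Suc a < m"
  shows "cross_V m a \<in> diagrams (replicate m \<VV>) (replicate m \<VV>)"
  unfolding cross_V_def using cross_at_in[of "replicate a \<VV>" \<VV> \<VV> "replicate (m - a - 2) \<VV>"] replicate_split[OF assms, of \<VV>] by simp

lemma vreal_adjacent: "Suc a < m \<Longrightarrow> vreal m W \<Longrightarrow> vreal m (\<lambda>u. W (u \<circ> tp a (Suc a)))"
proof -
  assume a: "Suc a < m" and "vreal m W"
  then obtain w where w: "realizable (replicate m \<VV>) w" "\<forall>u\<in>dom m. W u = w (lab m u)"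
    unfolding vreal_def by blast
  show ?thesis
    unfolding vreal_def using realizable_ev[OF cross_V_in[OF a] w(1)] w(2) dom_tp[of a m "Suc a"] a
    by (intro exI[of _ "ev (cross_V m a) w"]) (simp add: lab_swap)
qed

lemma vinv_adjacent: "Suc a < m \<Longrightarrow> vinv m W \<Longrightarrow> vinv m (\<lambda>u. W (u \<circ> tp a (Suc a)))"
proof -
  assume a: "Suc a < m" and "vinv m W"
  then obtain w where w: "invariant (replicate m \<VV>) w" "\<forall>u\<in>dom m. W u = w (lab m u)"
    unfolding vinv_def by blast
  show ?thesis
    unfolding vinv_def using invariant_ev[OF cross_V_in[OF a] w(1)] w(2) dom_tp[of a m "Suc a"] a
    by (intro exI[of _ "ev (cross_V m a) w"]) (simp add: lab_swap)
qed

lemma tp_closed: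
  assumes adj: "\<And>a W. Suc a < m \<Longrightarrow> Q W \<Longrightarrow> Q (\<lambda>u :: nat \<Rightarrow> nat. W (u \<circ> tp a (Suc a)))"
    and "a < m" "b < m" "Q W"
  shows "Q (\<lambda>u. W (u \<circ> tp a b))"
proof -
  have *: "\<forall>W. Q W \<longrightarrow> Q (\<lambda>u. W (u \<circ> tp a b))" if "a < b" "b < m" for a b
  proof (rule tp_adjacent_induct[OF that, where Q = "\<lambda>t. \<forall>W. Q W \<longrightarrow> Q (\<lambda>u. W (u \<circ> t))"])
    fix s t :: "nat \<Rightarrow> nat"
    assume s: "\<forall>W. Q W \<longrightarrow> Q (\<lambda>u. W (u \<circ> s))" and t: "\<forall>W. Q W \<longrightarrow> Q (\<lambda>u. W (u \<circ> t))"
    show "\<forall>W. Q W \<longrightarrow> Q (\<lambda>u. W (u \<circ> (s \<circ> t \<circ> s)))"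
    proof (intro allI impI)
      fix W assume "Q W"
      then have "Q (\<lambda>u. W (u \<circ> s))" using s by simp
      from t[rule_format, OF this] have "Q (\<lambda>u. W ((u \<circ> t) \<circ> s))" .
      from s[rule_format, OF this] have "Q (\<lambda>u. W (((u \<circ> s) \<circ> t) \<circ> s))" .
      then show "Q (\<lambda>u. W (u \<circ> (s \<circ> t \<circ> s)))" by (simp only: comp_assoc)
    qed
  qed (use adj in blast)
  consider "a < b" | "a = b" | "b < a" by linarith
  then show ?thesis
  proof cases
    case 3
    then show ?thesis using *[of b a] assms Transposition.transpose_commute[of a b] by simp
  qed (use * assms in \<open>auto simp: Transposition.transpose_same[of b, abs_def] comp_def\<close>)
qed

lemma vreal_tp: "a < m \<Longrightarrow> b < m \<Longrightarrow> vreal m W \<Longrightarrow> vreal m (\<lambda>u. W (u \<circ> tp a b))"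
  using tp_closed[of m "vreal m" a b W] vreal_adjacent by blast

lemma vinv_tp: "a < m \<Longrightarrow> b < m \<Longrightarrow> vinv m W \<Longrightarrow> vinv m (\<lambda>u. W (u \<circ> tp a b))"
  using tp_closed[of m "vinv m" a b W] vinv_adjacent by blast

subsection \<open>Contractions\<close>

text \<open>A cap on the slots \<open>c\<close> and \<open>a\<close> followed by a cup in the same
  slots, so that the number of slots is kept; the basis of \<open>V\<close> is orthonormal, so equal
  indices are paired.\<close>

definition contract :: "nat \<Rightarrow> nat \<Rightarrow> ((nat \<Rightarrow> nat) \<Rightarrow> complex) \<Rightarrow> (nat \<Rightarrow> nat) \<Rightarrow> complex" where
  "contract c a W u = (if u c = u a then \<Sum>j=1..N. W (u(c := j, a := j)) else 0)"

lemma contract_01: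
  assumes full: "inv_full (replicate m \<VV>)" and W: "vinv (Suc (Suc m)) W"
  shows "vreal (Suc (Suc m)) (contract 0 1 W)"
proof -
  let ?X = "replicate m \<VV>" and ?XX = "replicate (Suc (Suc m)) \<VV>"
  obtain w where w: "invariant ?XX w" "\<forall>u\<in>dom (Suc (Suc m)). W u = w (lab (Suc (Suc m)) u)"
    using W unfolding vinv_def by blast
  have cap: "Cap \<VV> \<otimes>\<^sub>d Strand ?X \<in> diagrams ?XX ?X" and cup: "Cup \<VV> \<otimes>\<^sub>d Strand ?X \<in> diagrams ?X ?XX"
    by (simp_all add: diagrams_def)
  let ?w = "ev (Cup \<VV> \<otimes>\<^sub>d Strand ?X) (ev (Cap \<VV> \<otimes>\<^sub>d Strand ?X) w)"
  have "realizable ?XX ?w"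
    by (rule realizable_ev[OF cup realizable_inv_full[OF full invariant_ev[OF cap w(1)]]])
  moreover have "contract 0 1 W u = ?w (lab (Suc (Suc m)) u)" if u: "u \<in> dom (Suc (Suc m))" for u
  proof -
    let ?l = "map (\<lambda>a. VecL (u a)) [Suc (Suc 0)..<Suc (Suc m)]"
    have lab: "lab (Suc (Suc m)) v = VecL (v 0) # VecL (v 1) # map (\<lambda>a. VecL (v a)) [Suc (Suc 0)..<Suc (Suc m)]" for v
      unfolding lab_def by (simp add: upt_conv_Cons One_nat_def del: upt_Suc)
    have in': "VecL (u 0) \<in> basis \<VV>" "VecL (u 1) \<in> basis \<VV>" "?l \<in> word_basis ?X"
      using lab_in[OF u] unfolding lab by simp_all
    have "?w (lab (Suc (Suc m)) u) = (if u 1 = u 0 then \<Sum>j=1..N. w (VecL j # VecL j # ?l) else 0)"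
      unfolding lab using in' by (simp add: ev_tensor ev_Cup ev_Cap ev_Strand sum_basis_V numeral_2_eq_2)
    also have "(\<Sum>j=1..N. w (VecL j # VecL j # ?l)) = (\<Sum>j=1..N. W (u(0 := j, 1 := j)))"
    proof (rule sum.cong[OF HOL.refl])
      fix j assume j: "j \<in> {1..N}"
      then have d: "u(0 := j, 1 := j) \<in> dom (Suc (Suc m))" using u by (auto simp: dom_def)
      have "map (\<lambda>a. VecL ((u(0 := j, 1 := j)) a)) [Suc (Suc 0)..<Suc (Suc m)] = ?l"
        by (rule map_cong[OF HOL.refl]) (auto simp: One_nat_def)
      then have "lab (Suc (Suc m)) (u(0 := j, 1 := j)) = VecL j # VecL j # ?l"
        unfolding lab[of "u(0 := j, 1 := j)"] by (simp only: fun_upd_apply) simp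
      then show "w (VecL j # VecL j # ?l) = W (u(0 := j, 1 := j))"
        using w(2) d by (simp only:)
    qed
    finally show ?thesis by (auto simp: contract_def)
  qed
  ultimately show ?thesis unfolding vreal_def by blast
qed

lemma contract_tp:
  "contract (tp x y c) (tp x y a) W = (\<lambda>u. contract c a (\<lambda>v. W (v \<circ> tp x y)) (u \<circ> tp x y))"
proof
  fix u :: "nat \<Rightarrow> nat"
  have "((u \<circ> tp x y)(c := j, a := j)) \<circ> tp x y = u(tp x y c := j, tp x y a := j)" for j
    by (auto simp: fun_eq_iff Transposition.transpose_def)
  then show "contract (tp x y c) (tp x y a) W u = contract c a (\<lambda>v. W (v \<circ> tp x y)) (u \<circ> tp x y)"
    by (simp add: contract_def)
qed

lemma vreal_contract:
  assumes full: "inv_full (replicate m \<VV>)" and W: "vinv (Suc (Suc m)) W"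
    and ca: "c < Suc (Suc m)" "a < Suc (Suc m)" "c \<noteq> a"
  shows "vreal (Suc (Suc m)) (contract c a W)"
proof -
  define M where "M = Suc (Suc m)"
  have step: "\<forall>W. vinv M W \<longrightarrow> vreal M (contract (tp x y c) (tp x y a) W)"
    if "\<forall>W. vinv M W \<longrightarrow> vreal M (contract c a W)" "x < M" "y < M" for x y c a
    unfolding contract_tp using that vinv_tp vreal_tp by simp
  \<comment> \<open>Exchanging 1 with \<open>x\<close> and then 0 with \<open>c\<close> carries the
    slots \<open>0, 1\<close> to \<open>c, a\<close>; so \<open>x\<close> has to be the slot that
    the second exchange moves to \<open>a\<close>.\<close>
  define x where "x = tp 0 c a"
  have x: "x \<noteq> 0" "x < M" using ca by (auto simp: x_def M_def Transposition.transpose_def)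
  have "\<forall>W. vinv M W \<longrightarrow> vreal M (contract 0 1 W)"
    using contract_01[OF full] by (simp add: M_def)
  from step[OF this, of 1 x] have "\<forall>W. vinv M W \<longrightarrow> vreal M (contract 0 x W)"
    using x by (simp add: M_def Transposition.transpose_def)
  from step[OF this, of 0 c] have "\<forall>W. vinv M W \<longrightarrow> vreal M (contract c a W)"
    using x ca by (simp add: x_def M_def)
  then show ?thesis using W by (simp add: M_def)
qed

subsection \<open>Infinitesimal invariance\<close>

text \<open>The parameter \<open>t\<close> is complex. The curve passes through the identity at
  \<open>t = 0\<close> and acts on \<open>V\<close> by rotation through the angle
  \<open>2 * t\<close> in the plane of \<open>e i\<close> and \<open>e j\<close>; hence the factor 2
  in \<open>so_gen\<close>.\<close>

definition rot :: "nat \<Rightarrow> nat \<Rightarrow> complex \<Rightarrow> ('v list \<Rightarrow> complex) set" where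
  "rot i j t = cl_vec (e i) \<odot> cl_vec (scale (cos t) (e i) + scale (sin t) (e j))"

lemma rot_in:
  assumes "i \<in> {1..N}" "j \<in> {1..N}" "i \<noteq> j"
  shows "rot i j t \<in> GV"
    and "vec_act (rot i j t) x = reflect (e i) (reflect (scale (cos t) (e i) + scale (sin t) (e j)) x)"
proof -
  have "\<Phi> (scale (cos t) (e i) + scale (sin t) (e j)) (scale (cos t) (e i) + scale (sin t) (e j)) = 1"
    using assms sin_cos_squared_add3[of t]
    by (simp add: form_add_left form_add_right form_scale_left form_scale_right form_e)
  moreover have "\<Phi> (e i) (e i) = 1" using assms by (simp add: form_e)
  ultimately show "rot i j t \<in> GV"
    and "vec_act (rot i j t) x = reflect (e i) (reflect (scale (cos t) (e i) + scale (sin t) (e j)) x)"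
    unfolding rot_def using product_in_GV by blast+
qed

lemma gm_rot:
  assumes "i \<in> {1..N}" "j \<in> {1..N}" "i \<noteq> j" "a \<in> {1..N}" "b \<in> {1..N}"
  shows "gm \<VV> (rot i j t) (VecL a) (VecL b) =
    (let y = (\<lambda>a. 2 * (cos t * of_bool (b = i) + sin t * of_bool (b = j)) *
      (cos t * of_bool (a = i) + sin t * of_bool (a = j)) - of_bool (a = b))
     in 2 * y i * of_bool (a = i) - y a)"
  unfolding gm_V[OF assms(4,5)] rot_in(2)[OF assms(1-3)] reflect_def Let_def
  using assms by (simp add: form_diff_right form_scale_right form_add_right form_add_left form_scale_left form_e)

lemma gm_rot_zero:
  assumes "i \<in> {1..N}" "j \<in> {1..N}" "i \<noteq> j" "a \<in> {1..N}" "b \<in> {1..N}"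
  shows "gm \<VV> (rot i j 0) (VecL a) (VecL b) = of_bool (a = b)"
  unfolding gm_rot[OF assms] by (auto simp: of_bool_def)

definition so_gen :: "nat \<Rightarrow> nat \<Rightarrow> nat \<Rightarrow> nat \<Rightarrow> complex" where
  "so_gen i j a b = 2 * (of_bool (a = i \<and> b = j) - of_bool (a = j \<and> b = i))"

lemma gm_rot_deriv:
  assumes "i \<in> {1..N}" "j \<in> {1..N}" "i \<noteq> j" "a \<in> {1..N}" "b \<in> {1..N}"
  shows "((\<lambda>t. gm \<VV> (rot i j t) (VecL a) (VecL b)) has_field_derivative so_gen i j a b) (at 0)"
  unfolding gm_rot[OF assms] Let_def so_gen_def using assms(3)
  by (auto intro!: derivative_eq_intros simp: of_bool_def)

lemma act_rot_zero:
  assumes ij: "i \<in> {1..N}" "j \<in> {1..N}" "i \<noteq> j"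
  shows "l \<in> word_basis (replicate m \<VV>) \<Longrightarrow> act (replicate m \<VV>) (rot i j 0) w l = w l"
proof (induction m arbitrary: l w)
  case 0
  then show ?case by (simp add: act_Nil)
next
  case (Suc m)
  then obtain a l' where l: "l = VecL a # l'" "a \<in> {1..N}" "l' \<in> word_basis (replicate m \<VV>)"
    by (auto simp: in_word_basis_Cons basis_simps)
  have "act (replicate (Suc m) \<VV>) (rot i j 0) w l = (\<Sum>b=1..N. if b = a then w l else 0)"
    unfolding replicate_Suc l(1) act_Cons sum_basis_V
    using Suc.IH[OF l(3)] gm_rot_zero[OF ij l(2)] l by (intro sum.cong HOL.refl) auto
  then show ?case using l by simp
qed

text \<open>Leibniz rule on a tensor power: at \<open>t = 0\<close> all slots but one carry the
  identity.\<close>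

lemma act_rot_deriv:
  assumes ij: "i \<in> {1..N}" "j \<in> {1..N}" "i \<noteq> j"
  shows "u \<in> dom m \<Longrightarrow> ((\<lambda>t. act (replicate m \<VV>) (rot i j t) w (lab m u)) has_field_derivative
    (\<Sum>a<m. \<Sum>b=1..N. so_gen i j (u a) b * w (lab m (u(a := b))))) (at 0)"
proof (induction m arbitrary: u w)
  case 0
  then show ?case by (simp add: act_Nil lab_def)
next
  case (Suc m)
  define u' where "u' = (\<lambda>a. u (Suc a))"
  have lab: "lab (Suc m) v = VecL (v 0) # lab m (\<lambda>a. v (Suc a))" for v
    unfolding lab_def by (simp add: upt_rec[of 0 "Suc m"] map_Suc_upt[symmetric] comp_def del: upt_Suc)
  have u': "u' \<in> dom m" and u0: "u 0 \<in> {1..N}" using Suc.prems by (auto simp: dom_def u'_def)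
  have "((\<lambda>t. \<Sum>b=1..N. gm \<VV> (rot i j t) (VecL (u 0)) (VecL b) * act (replicate m \<VV>) (rot i j t) (\<lambda>l. w (VecL b # l)) (lab m u'))
    has_field_derivative (\<Sum>b=1..N. so_gen i j (u 0) b * act (replicate m \<VV>) (rot i j 0) (\<lambda>l. w (VecL b # l)) (lab m u') +
      (\<Sum>a<m. \<Sum>b'=1..N. so_gen i j (u' a) b' * w (VecL b # lab m (u'(a := b')))) * gm \<VV> (rot i j 0) (VecL (u 0)) (VecL b))) (at 0)"
    by (intro DERIV_sum DERIV_mult gm_rot_deriv Suc.IH u' u0 ij) auto
  moreover have "(\<Sum>b=1..N. so_gen i j (u 0) b * act (replicate m \<VV>) (rot i j 0) (\<lambda>l. w (VecL b # l)) (lab m u') +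
      (\<Sum>a<m. \<Sum>b'=1..N. so_gen i j (u' a) b' * w (VecL b # lab m (u'(a := b')))) * gm \<VV> (rot i j 0) (VecL (u 0)) (VecL b)) =
    (\<Sum>a<Suc m. \<Sum>b=1..N. so_gen i j (u a) b * w (lab (Suc m) (u(a := b))))"
  proof -
    have "(\<Sum>b=1..N. (\<Sum>a<m. \<Sum>b'=1..N. so_gen i j (u' a) b' * w (VecL b # lab m (u'(a := b')))) * gm \<VV> (rot i j 0) (VecL (u 0)) (VecL b)) =
      (\<Sum>b=1..N. if b = u 0 then (\<Sum>a<m. \<Sum>b'=1..N. so_gen i j (u' a) b' * w (VecL b # lab m (u'(a := b')))) else 0)"
      using gm_rot_zero[OF ij u0] by (intro sum.cong HOL.refl) auto
    also have "\<dots> = (\<Sum>a<m. \<Sum>b'=1..N. so_gen i j (u' a) b' * w (VecL (u 0) # lab m (u'(a := b'))))"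
      using u0 by simp
    finally have r: "(\<Sum>b=1..N. (\<Sum>a<m. \<Sum>b'=1..N. so_gen i j (u' a) b' * w (VecL b # lab m (u'(a := b')))) * gm \<VV> (rot i j 0) (VecL (u 0)) (VecL b)) =
      (\<Sum>a<m. \<Sum>b=1..N. so_gen i j (u (Suc a)) b * w (lab (Suc m) (u(Suc a := b))))"
      by (simp add: lab u'_def fun_upd_def)
    have "lab (Suc m) (u(0 := b)) = VecL b # lab m u'" for b by (simp add: lab u'_def)
    then show ?thesis
      unfolding sum.distrib r sum.lessThan_Suc_shift
      using act_rot_zero[OF ij lab_in[OF u']] by simp
  qed
  ultimately show ?case
    unfolding lab[of u] replicate_Suc act_Cons sum_basis_V u'_def[symmetric] by (simp only:)
qed

text \<open>An invariant is constant along the curve, so its derivative at 0 vanishes; the common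
  factor 2 is divided out.\<close>

lemma vinv_infinitesimal:
  assumes W: "vinv m W" and u: "u \<in> dom m" and ij: "i \<in> {1..N}" "j \<in> {1..N}"
  shows "(\<Sum>a<m. of_bool (u a = i) * W (u(a := j)) - of_bool (u a = j) * W (u(a := i))) = 0"
proof (cases "i = j")
  case False
  obtain w where w: "invariant (replicate m \<VV>) w" "\<forall>u\<in>dom m. W u = w (lab m u)"
    using W unfolding vinv_def by blast
  have "(\<lambda>t. act (replicate m \<VV>) (rot i j t) w (lab m u)) = (\<lambda>t. w (lab m u))"
    using w(1) rot_in(1)[OF ij False] lab_in[OF u] by (simp add: invariant_def)
  then have "((\<lambda>t. w (lab m u)) has_field_derivative
      (\<Sum>a<m. \<Sum>b=1..N. so_gen i j (u a) b * w (lab m (u(a := b))))) (at (0 :: complex))"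
    using act_rot_deriv[OF ij False u, of w] by simp
  then have "(\<Sum>a<m. \<Sum>b=1..N. so_gen i j (u a) b * w (lab m (u(a := b)))) = 0"
    using DERIV_unique DERIV_const by blast
  moreover have "(\<Sum>b=1..N. so_gen i j (u a) b * w (lab m (u(a := b)))) =
    2 * (of_bool (u a = i) * W (u(a := j)) - of_bool (u a = j) * W (u(a := i)))" if "a < m" for a
  proof -
    have d: "u(a := b) \<in> dom m" if "b \<in> {1..N}" for b using u that by (auto simp: dom_def)
    have "(\<Sum>b=1..N. so_gen i j (u a) b * w (lab m (u(a := b)))) =
      (\<Sum>b=1..N. (if b = j then 2 * (of_bool (u a = i) * w (lab m (u(a := j)))) else 0) -
        (if b = i then 2 * (of_bool (u a = j) * w (lab m (u(a := i)))) else 0))"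
      using False by (intro sum.cong HOL.refl) (auto simp: so_gen_def)
    also have "\<dots> = 2 * (of_bool (u a = i) * w (lab m (u(a := j))) - of_bool (u a = j) * w (lab m (u(a := i))))"
      using ij by (simp add: sum_subtractf right_diff_distrib)
    finally show ?thesis using w(2) d ij by simp
  qed
  ultimately have "2 * (\<Sum>a<m. of_bool (u a = i) * W (u(a := j)) - of_bool (u a = j) * W (u(a := i))) = 0"
    by (simp add: sum_distrib_left)
  then show ?thesis by simp
qed simp

text \<open>Contracting the infinitesimal invariance with a generator acting on slot \<open>c\<close>.\<close>

lemma vinv_slot:
  assumes W: "vinv m W" and u: "u \<in> dom m" and c: "c < m"
  shows "(of_nat N - 1) * W u + (\<Sum>a\<in>{..<m} - {c}. W (u \<circ> tp c a)) = (\<Sum>a\<in>{..<m} - {c}. contract c a W u)"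
proof -
  define q where "q = u c"
  have q: "q \<in> {1..N}" using u c by (auto simp: dom_def q_def)
  have ua: "u a \<in> {1..N}" if "a < m" for a using u that by (auto simp: dom_def)
  \<comment> \<open>The generator for the plane of \<open>q\<close> and \<open>j\<close> is
    evaluated at \<open>u\<close> with slot \<open>c\<close> overwritten by \<open>j\<close>, and
    \<open>j\<close> is summed.\<close>
  let ?f = "\<lambda>j a. of_bool ((u(c := j)) a = q) * W ((u(c := j))(a := j)) - of_bool ((u(c := j)) a = j) * W ((u(c := j))(a := q))"
  have "(\<Sum>a<m. ?f j a) = 0" if "j \<in> {1..N}" for j
    using u that q by (intro vinv_infinitesimal[OF W]) (auto simp: dom_def)
  then have "0 = (\<Sum>j=1..N. \<Sum>a<m. ?f j a)" by simp
  also have "\<dots> = (\<Sum>a<m. \<Sum>j=1..N. ?f j a)" by (rule sum.swap)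
  also have "\<dots> = (\<Sum>j=1..N. ?f j c) + (\<Sum>a\<in>{..<m} - {c}. \<Sum>j=1..N. ?f j a)"
    using c by (simp add: sum.remove)
  \<comment> \<open>Slot \<open>c\<close> gives \<open>W u\<close> once, for \<open>j = q\<close>,
    and \<open>- W u\<close> for every \<open>j\<close>.\<close>
  also have "(\<Sum>j=1..N. ?f j c) = (1 - of_nat N) * W u"
  proof -
    have "(\<Sum>j=1..N. ?f j c) = (\<Sum>j=1..N. (if j = q then W u else 0) - W u)"
      by (intro sum.cong HOL.refl) (auto simp: q_def)
    then show ?thesis using q by (simp add: sum_subtractf algebra_simps)
  qed
  \<comment> \<open>In any other slot the first term sums to a contraction; the second is nonzero
    only for \<open>j = u a\<close> and is the exchange of the two slots.\<close>
  also have "(\<Sum>a\<in>{..<m} - {c}. \<Sum>j=1..N. ?f j a) = (\<Sum>a\<in>{..<m} - {c}. contract c a W u - W (u \<circ> tp c a))"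
  proof (rule sum.cong[OF HOL.refl])
    fix a assume a: "a \<in> {..<m} - {c}"
    have tp: "u \<circ> tp c a = u(c := u a, a := q)"
      by (auto simp: fun_eq_iff Transposition.transpose_def q_def)
    have "(\<Sum>j=1..N. ?f j a) = (\<Sum>j=1..N. (if u c = u a then W (u(c := j, a := j)) else 0) -
        (if j = u a then W (u(c := u a, a := q)) else 0))"
      using a by (intro sum.cong HOL.refl) (auto simp: q_def)
    also have "\<dots> = contract c a W u - W (u \<circ> tp c a)"
      using ua a by (simp add: sum_subtractf contract_def tp)
    finally show "(\<Sum>j=1..N. ?f j a) = contract c a W u - W (u \<circ> tp c a)" .
  qed
  finally show ?thesis by (simp add: sum_subtractf algebra_simps)
qed

end

context spin_setup
begin

subsection \<open>Alternating tensors\<close>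

definition alt :: "nat \<Rightarrow> nat \<Rightarrow> ((nat \<Rightarrow> nat) \<Rightarrow> complex) \<Rightarrow> bool" where
  "alt m k W \<longleftrightarrow> (\<forall>a<k. \<forall>b<k. a \<noteq> b \<longrightarrow> (\<forall>u\<in>dom m. W (u \<circ> tp a b) = - W u))"

lemma altD: "alt m k W \<Longrightarrow> a < k \<Longrightarrow> b < k \<Longrightarrow> a \<noteq> b \<Longrightarrow> u \<in> dom m \<Longrightarrow> W (u \<circ> tp a b) = - W u"
  by (simp add: alt_def)

text \<open>Antisymmetrization over coset representatives: the identity and the transpositions with
  slot \<open>k\<close> represent the cosets of the permutations of \<open>k\<close> slots in those
  of \<open>k + 1\<close>.\<close>

lemma alt_raise:
  assumes alt: "alt m k W" and k: "k < m"
  shows "alt m (Suc k) (\<lambda>u. W u - (\<Sum>d<k. W (u \<circ> tp d k)))"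
proof -
  let ?R = "\<lambda>u. W u - (\<Sum>d<k. W (u \<circ> tp d k))"
  have d': "u \<circ> tp d k \<in> dom m" if "u \<in> dom m" "d < k" for u d
    using that k by (intro dom_tp) auto
  \<comment> \<open>A transposition below \<open>k\<close> permutes the summands, and alternation of
    \<open>W\<close> supplies the sign.\<close>
  have low: "?R (u \<circ> tp b c) = - ?R u" if bc: "b < k" "c < k" "b \<noteq> c" and u: "u \<in> dom m" for b c u
  proof -
    have "W (u \<circ> tp b c \<circ> tp d k) = - W (u \<circ> tp (tp b c d) k)" if d: "d < k" for d
    proof -
      have "tp b c \<circ> tp d k = tp (tp b c d) k \<circ> tp b c"
        using bc d by (auto simp: fun_eq_iff Transposition.transpose_def)
      then have "u \<circ> tp b c \<circ> tp d k = (u \<circ> tp (tp b c d) k) \<circ> tp b c"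
        by (metis comp_assoc)
      moreover have "tp b c d < k" using bc d by (auto simp: Transposition.transpose_def)
      ultimately show ?thesis using altD[OF alt bc d'[OF u]] by simp
    qed
    then have "(\<Sum>d<k. W (u \<circ> tp b c \<circ> tp d k)) = - (\<Sum>d<k. W (u \<circ> tp (tp b c d) k))"
      by (simp add: sum_negf)
    also have "(\<Sum>d<k. W (u \<circ> tp (tp b c d) k)) = (\<Sum>d<k. W (u \<circ> tp d k))"
      by (rule sum.reindex_bij_witness[of _ "tp b c" "tp b c"])
        (use bc in \<open>auto simp: Transposition.transpose_def\<close>)
    finally have S: "(\<Sum>d<k. W (u \<circ> tp b c \<circ> tp d k)) = - (\<Sum>d<k. W (u \<circ> tp d k))" .
    show ?thesis unfolding S altD[OF alt bc u] by simp
  qed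
  \<comment> \<open>The exchange of \<open>b\<close> and \<open>k\<close> swaps the leading term
    with the summand \<open>d = b\<close>; in the others it moves past \<open>tp d k\<close> and
    becomes \<open>tp b d\<close>.\<close>
  have top: "?R (u \<circ> tp b k) = - ?R u" if b: "b < k" and u: "u \<in> dom m" for b u
  proof -
    have "W (u \<circ> tp b k \<circ> tp d k) = - W (u \<circ> tp d k)" if d: "d < k" "d \<noteq> b" for d
    proof -
      have "tp b k \<circ> tp d k = tp d k \<circ> tp b d"
        using b d by (auto simp: fun_eq_iff Transposition.transpose_def)
      then have "u \<circ> tp b k \<circ> tp d k = (u \<circ> tp d k) \<circ> tp b d" by (metis comp_assoc)
      then show ?thesis using altD[OF alt b d(1) _ d'[OF u d(1)]] d by simp
    qed
    then have S: "(\<Sum>d\<in>{..<k} - {b}. W (u \<circ> tp b k \<circ> tp d k)) = - (\<Sum>d\<in>{..<k} - {b}. W (u \<circ> tp d k))"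
      unfolding sum_negf[symmetric] by (intro sum.cong HOL.refl) auto
    have rem: "(\<Sum>d<k. F d) = F b + (\<Sum>d\<in>{..<k} - {b}. F d)" for F :: "nat \<Rightarrow> complex"
      using b by (intro sum.remove) auto
    have sq: "u \<circ> tp b k \<circ> tp b k = u" by (simp add: comp_assoc)
    show ?thesis unfolding rem S sq by simp
  qed
  show ?thesis
    unfolding alt_def
  proof (intro allI impI ballI)
    fix a b u assume ab: "a < Suc k" "b < Suc k" "a \<noteq> b" "u \<in> dom m"
    then consider "a < k" "b < k" | "a < k" "b = k" | "a = k" "b < k" by linarith
    then show "?R (u \<circ> tp a b) = - ?R u"
    proof cases
      case 3
      then show ?thesis using top[of b u] ab Transposition.transpose_commute[of a b] by simp
    qed (use low top ab in auto)
  qed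
qed

lemma tp_square: "u \<circ> tp a b \<circ> tp a b = u"
  by (simp add: comp_assoc)

text \<open>Slot \<open>a\<close> is exchanged into position \<open>k\<close>, alternation is raised
  there, the result is realized by assumption, and the exchange is undone.\<close>

lemma alt_remainder:
  assumes alt: "alt m k W" and W: "vinv m W" and a: "k \<le> a" "a < m"
    and ok: "\<And>W. vinv m W \<Longrightarrow> alt m (Suc k) W \<Longrightarrow> vreal m W"
  shows "vreal m (\<lambda>u. W u - (\<Sum>d<k. W (u \<circ> tp d a)))"
proof -
  let ?V = "\<lambda>u. W (u \<circ> tp k a)"
  have km: "k < m" using a by simp
  have V: "vinv m ?V" using W a by (intro vinv_tp) auto
  have "alt m k ?V"
    unfolding alt_def
  proof (intro allI impI ballI)
    fix b c u assume bc: "b < k" "c < k" "b \<noteq> c" and u: "u \<in> dom m"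
    have "tp b c \<circ> tp k a = tp k a \<circ> tp b c"
      using bc a by (auto simp: fun_eq_iff Transposition.transpose_def)
    then have "u \<circ> tp b c \<circ> tp k a = (u \<circ> tp k a) \<circ> tp b c" by (metis comp_assoc)
    then show "?V (u \<circ> tp b c) = - ?V u"
      using altD[OF alt bc dom_tp[OF km a(2) u]] by simp
  qed
  then have "alt m (Suc k) (\<lambda>u. ?V u - (\<Sum>d<k. ?V (u \<circ> tp d k)))" by (rule alt_raise[OF _ km])
  moreover have "vinv m (\<lambda>u. ?V u - (\<Sum>d<k. ?V (u \<circ> tp d k)))"
    using km by (intro vinv_diff V vinv_sum vinv_tp[OF _ _ V]) auto
  ultimately have "vreal m (\<lambda>u. ?V u - (\<Sum>d<k. ?V (u \<circ> tp d k)))" by (intro ok)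
  from vreal_tp[OF km a(2) this]
  have "vreal m (\<lambda>u. W (u \<circ> tp k a \<circ> tp k a) - (\<Sum>d<k. W (u \<circ> tp k a \<circ> tp d k \<circ> tp k a)))" .
  moreover have "u \<circ> tp k a \<circ> tp d k \<circ> tp k a = u \<circ> tp d a" if "d < k" for u :: "nat \<Rightarrow> nat" and d
    using that a by (auto simp: fun_eq_iff Transposition.transpose_def)
  ultimately show ?thesis by (simp add: tp_square)
qed

lemma vinv_extensional:
  assumes "vinv m W" "u \<in> dom m" "\<And>a. a < m \<Longrightarrow> u a = u' a"
  shows "W u = W u'"
proof -
  have "u' \<in> dom m" "lab m u = lab m u'" using assms by (auto simp: dom_def lab_def)
  then show ?thesis using assms(1,2) unfolding vinv_def by metis
qed

lemma alt_not_inj: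
  assumes "alt m k W" "k \<le> m" "u \<in> dom m" "\<not> inj_on u {..<k}"
  shows "W u = 0"
proof -
  obtain a b where ab: "a < k" "b < k" "a \<noteq> b" "u a = u b" using assms(4) by (auto simp: inj_on_def)
  then have "u \<circ> tp a b = u" by (auto simp: fun_eq_iff Transposition.transpose_def)
  then have "W u = - W u" using altD[OF assms(1) ab(1-3) assms(3)] by simp
  then show ?thesis by simp
qed

text \<open>Slots are numbered from 0 and basis vectors from 1, so \<open>Suc\<close> is the
  arrangement \<open>1, \<dots>, N\<close>. An injective index function is a permutation of it and
  gives the same value up to sign; any other gives zero.\<close>

lemma alt_top_zero:
  assumes alt: "alt N N W" and ext: "\<And>u u'. u \<in> dom N \<Longrightarrow> (\<And>a. a < N \<Longrightarrow> u a = u' a) \<Longrightarrow> W u = W u'"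
    and z: "W Suc = 0" and u: "u \<in> dom N"
  shows "W u = 0"
proof (cases "inj_on u {..<N}")
  case True
  define p where "p = (\<lambda>a. if a < N then u a - 1 else a)"
  have ua: "1 \<le> u a" "u a \<le> N" if "a < N" for a using u that by (auto simp: dom_def)
  have "inj_on p {..<N}"
  proof (rule inj_onI)
    fix a b assume ab: "a \<in> {..<N}" "b \<in> {..<N}" "p a = p b"
    then have "u a = u b" using ua[of a] ua[of b] by (simp add: p_def)
    then show "a = b" using True ab by (auto simp: inj_on_def)
  qed
  moreover have "p ` {..<N} \<subseteq> {..<N}" using ua by (fastforce simp: p_def)
  ultimately have "p ` {..<N} = {..<N}" by (intro endo_inj_surj) auto
  then have "bij_betw p {..<N} {..<N}" using \<open>inj_on p {..<N}\<close> by (simp add: bij_betw_def)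
  then have p: "p permutes {..<N}" by (rule bij_imp_permutes) (simp add: p_def)
  have sd: "Suc \<circ> q \<in> dom N" if "q permutes {..<N}" for q
    using permutes_in_image[OF that] by (auto simp: dom_def Suc_le_eq)
  have "W (Suc \<circ> p) = 0"
    using finite_lessThan p
  proof (induction rule: permutes_rev_induct)
    case id
    then show ?case using z by simp
  next
    case (swap a b p)
    then have "W (Suc \<circ> p \<circ> tp a b) = - W (Suc \<circ> p)"
      by (intro altD[OF alt _ _ _ sd]) auto
    also have "W (Suc \<circ> p) = 0" by (rule swap.IH)
    finally show ?case by (simp only: comp_assoc minus_zero)
  qed
  moreover have "W (Suc \<circ> p) = W u"
  proof (rule ext[OF sd[OF p]])
    fix a assume "a < N"
    then show "(Suc \<circ> p) a = u a" using ua(1)[of a] by (simp add: p_def)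
  qed
  ultimately show ?thesis by simp
next
  case False
  then show ?thesis using alt_not_inj[OF alt _ u] by simp
qed

subsection \<open>The volume form\<close>

text \<open>\<open>e 1\<close> acts on \<open>V\<close> by fixing itself and negating the other
  basis vectors, so the coefficient at \<open>e 1 \<otimes> \<dots> \<otimes> e N\<close> is
  multiplied by \<open>(-1) ^ (N - 1)\<close>, which is -1.\<close>

lemma pinor_volume:
  assumes "even N" "N > 0" and W: "vinv N W"
  shows "W Suc = 0"
proof -
  obtain w where w: "invariant (replicate N \<VV>) w" "\<forall>u\<in>dom N. W u = w (lab N u)"
    using W unfolding vinv_def by blast
  have one: "(1 :: nat) \<in> {1..N}" using assms by simp
  have g: "cl_vec (e 1) \<in> GV" "vec_act (cl_vec (e 1)) v = reflect (e 1) v" for v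
    using unit_vector_in_GV[of "e 1"] form_e[OF one one] assms(1) by auto
  have gm: "gm \<VV> (cl_vec (e 1)) (VecL a) (VecL b) = (if b = a then if a = 1 then 1 else -1 else 0)"
    if "a \<in> {1..N}" "b \<in> {1..N}" for a b
    using that one by (auto simp: gm_V[simplified] g reflect_def form_diff_right form_scale_right form_e)
  have act: "act (replicate m \<VV>) (cl_vec (e 1)) w' (lab m u) = (\<Prod>a<m. if u a = 1 then 1 else -1) * w' (lab m u)"
    if "u \<in> dom m" for m u w'
    using that
  proof (induction m arbitrary: u w')
    case 0
    then show ?case by (simp add: act_Nil lab_def)
  next
    case (Suc m)
    define u' where "u' = (\<lambda>a. u (Suc a))"
    have lab: "lab (Suc m) u = VecL (u 0) # lab m u'"
      unfolding lab_def u'_def by (simp add: upt_rec[of 0 "Suc m"] map_Suc_upt[symmetric] comp_def del: upt_Suc)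
    have u': "u' \<in> dom m" and u0: "u 0 \<in> {1..N}" using Suc.prems by (auto simp: dom_def u'_def)
    have "act (replicate (Suc m) \<VV>) (cl_vec (e 1)) w' (lab (Suc m) u) =
      (\<Sum>b=1..N. if b = u 0 then (if u 0 = 1 then 1 else -1) * ((\<Prod>a<m. if u' a = 1 then 1 else -1) * w' (lab (Suc m) u)) else 0)"
      unfolding lab replicate_Suc act_Cons sum_basis_V using Suc.IH[OF u'] u0
      by (intro sum.cong HOL.refl) (auto simp: gm[simplified])
    also have "\<dots> = (\<Prod>a<Suc m. if u a = 1 then 1 else -1) * w' (lab (Suc m) u)"
      using u0 unfolding prod.lessThan_Suc_shift u'_def by simp
    finally show ?case .
  qed
  have S: "Suc \<in> dom N" by (auto simp: dom_def)
  obtain m where m: "N = Suc m" using assms(2) by (cases N) auto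
  have "(\<Prod>a<N. if Suc a = 1 then 1 else -1 :: complex) = (-1) ^ m"
    unfolding m prod.lessThan_Suc_shift by (simp add: One_nat_def)
  also have "\<dots> = -1" using assms(1) m by simp
  finally have "- w (lab N Suc) = w (lab N Suc)"
    using act[OF S, of w] w(1) g(1) lab_in[OF S] by (auto simp: invariant_def)
  then show ?thesis using w(2) S by simp
qed

lemma spin_word_e_mul:
  "k \<in> {1..N} \<Longrightarrow> spin_word (e k # w) = mat_mul P (gam k) (spin_word w)"
  by (simp add: spin_vec_e flip: P_def)

text \<open>The tensor \<open>u \<mapsto> trace (e (u (m - 1)) \<cdots> e (u 0))\<close> is obtained from the cup of \<open>S\<close> by
  letting \<open>V\<close> act \<open>m\<close> times on the first factor and closing the loop.\<close>

definition loop :: "nat \<Rightarrow> (nat \<Rightarrow> nat) \<Rightarrow> complex" where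
  "loop m u = trace (spin_word (map (\<lambda>a. e (u a)) (rev [0..<m])))"

lemma vreal_loop: "vreal m (loop m)"
proof -
  let ?X = "\<lambda>k. replicate k \<VV>"
  \<comment> \<open>After \<open>k\<close> steps the first spin factor has been multiplied by
    \<open>k\<close> gamma matrices; the complement and \<open>bb J\<close> come from the dual basis
    in the initial cup.\<close>
  have "\<exists>z. realizable (?X k @ [\<SS>, \<SS>]) z \<and> (\<forall>u\<in>dom k. \<forall>I\<in>P. \<forall>J\<in>P. z (lab k u @ [SpinL I, SpinL J]) =
      spin_word (map (\<lambda>a. e (u a)) (rev [0..<k])) I ({1..n} - J) * bb J)" for k
  proof (induction k)
    case 0
    have "realizable ([] @ [\<SS>, \<SS>]) (ev (Cup \<SS>) (\<lambda>_. 1))"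
      unfolding realizable_def by (intro bexI[of _ "Cup \<SS>"]) (auto simp: diagrams_def)
    moreover have "ev (Cup \<SS>) (\<lambda>_. 1) [SpinL I, SpinL J] = mat_one P I ({1..n} - J) * bb J"
      if "I \<in> P" "J \<in> P" for I J
    proof -
      have "J = {1..n} - I \<longleftrightarrow> I = {1..n} - J" using that by (auto simp: in_P_iff)
      then show ?thesis using that by (simp add: ev_Cup mat_one_def mat_of_def compl_in_P)
    qed
    ultimately show ?case by (intro exI[of _ "ev (Cup \<SS>) (\<lambda>_. 1)"]) (simp add: lab_def flip: P_def)
  next
    case (Suc k)
    then obtain z where z: "realizable (?X k @ [\<SS>, \<SS>]) z"
      "\<And>u I J. u \<in> dom k \<Longrightarrow> I \<in> P \<Longrightarrow> J \<in> P \<Longrightarrow> z (lab k u @ [SpinL I, SpinL J]) =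
        spin_word (map (\<lambda>a. e (u a)) (rev [0..<k])) I ({1..n} - J) * bb J" by blast
    let ?d = "Strand (?X k) \<otimes>\<^sub>d coact \<otimes>\<^sub>d Strand [\<SS>]"
    have rep: "?X (Suc k) @ [\<SS>, \<SS>] = ?X k @ [\<VV>, \<SS>] @ [\<SS>]"
      by (metis append_Cons append_Nil append_assoc replicate_app_Cons_same replicate_Suc)
    have "?d \<in> diagrams (?X k @ [\<SS>, \<SS>]) (?X (Suc k) @ [\<SS>, \<SS>])"
      unfolding rep by (simp add: diagrams_def)
    then have "realizable (?X (Suc k) @ [\<SS>, \<SS>]) (ev ?d z)" using z(1) by (rule realizable_ev)
    moreover have "ev ?d z (lab (Suc k) u @ [SpinL I, SpinL J]) =
      spin_word (map (\<lambda>a. e (u a)) (rev [0..<Suc k])) I ({1..n} - J) * bb J"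
      if u: "u \<in> dom (Suc k)" and IJ: "I \<in> P" "J \<in> P" for u I J
    proof -
      have uk: "u \<in> dom k" "u k \<in> {1..N}" using u by (auto simp: dom_def)
      then have V: "VecL (u k) \<in> basis \<VV>" by (simp add: basis_simps)
      have "lab (Suc k) u @ [SpinL I, SpinL J] = lab k u @ [VecL (u k), SpinL I, SpinL J]"
        by (simp add: lab_def)
      then have "ev ?d z (lab (Suc k) u @ [SpinL I, SpinL J]) =
          ev (Strand (?X k)) (\<lambda>x. ev (coact \<otimes>\<^sub>d Strand [\<SS>]) (\<lambda>y. z (x @ y)) [VecL (u k), SpinL I, SpinL J]) (lab k u)"
        by (simp add: ev_tensor[of "Strand (?X k)"] lab_def)
      also have "\<dots> = ev (coact \<otimes>\<^sub>d Strand [\<SS>]) (\<lambda>y. z (lab k u @ y)) [VecL (u k), SpinL I, SpinL J]"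
        by (rule ev_Strand[OF lab_in[OF uk(1)]])
      also have "\<dots> = (\<Sum>K\<in>P. gam (u k) I K * z (lab k u @ [SpinL K, SpinL J]))"
        using V IJ by (simp add: ev_tensor ev_coact ev_Strand sum_basis_S mm_def)
      also have "\<dots> = (\<Sum>K\<in>P. gam (u k) I K * (spin_word (map (\<lambda>a. e (u a)) (rev [0..<k])) K ({1..n} - J) * bb J))"
        using z(2)[OF uk(1) _ IJ(2)] by (intro sum.cong HOL.refl) simp
      also have "\<dots> = spin_word (map (\<lambda>a. e (u a)) (rev [0..<Suc k])) I ({1..n} - J) * bb J"
        using uk by (simp add: spin_word_e_mul del: spin_word.simps) (simp add: mat_mul_def sum_distrib_right mult.assoc)
      finally show ?thesis .
    qed
    ultimately show ?case by blast
  qed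
  then obtain z where z: "realizable (?X m @ [\<SS>, \<SS>]) z"
    "\<And>u I J. u \<in> dom m \<Longrightarrow> I \<in> P \<Longrightarrow> J \<in> P \<Longrightarrow> z (lab m u @ [SpinL I, SpinL J]) =
      spin_word (map (\<lambda>a. e (u a)) (rev [0..<m])) I ({1..n} - J) * bb J" by blast
  let ?d = "Strand (?X m) \<otimes>\<^sub>d Cap \<SS>"
  have "?d \<in> diagrams (?X m @ [\<SS>, \<SS>]) (?X m)" by (simp add: diagrams_def)
  then have real: "realizable (?X m) (ev ?d z)" using z(1) by (rule realizable_ev)
  \<comment> \<open>Closing the loop pairs the sign of the cap with that of the cup at the
    complement, which leaves \<open>\<sigma>\<close>; it is its own inverse.\<close>
  have "ev ?d z (lab m u) = \<sigma> * loop m u" if u: "u \<in> dom m" for u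
  proof -
    have "ev ?d z (lab m u) = (\<Sum>I\<in>P. bb I * z (lab m u @ [SpinL I, SpinL ({1..n} - I)]))"
      using ev_Strand[OF lab_in[OF u]] by (simp add: ev_tensor ev_Cap sum_basis_S lab_def)
    also have "\<dots> = (\<Sum>I\<in>P. \<sigma> * spin_word (map (\<lambda>a. e (u a)) (rev [0..<m])) I I)"
    proof (intro sum.cong HOL.refl)
      fix I assume I: "I \<in> P"
      have "{1..n} - ({1..n} - I) = I" using I by (simp add: in_P_iff double_diff)
      then show "bb I * z (lab m u @ [SpinL I, SpinL ({1..n} - I)]) = \<sigma> * spin_word (map (\<lambda>a. e (u a)) (rev [0..<m])) I I"
        using z(2)[OF u I compl_in_P, of I] bb_complement[OF I] by (simp add: ac_simps)
    qed
    finally show ?thesis by (simp add: loop_def trace_def sum_distrib_left)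
  qed
  then have "vreal m (\<lambda>u. \<sigma> * loop m u)" unfolding vreal_def using real by metis
  moreover have "\<sigma> * \<sigma> = 1" using sg_square(1)[of \<SS> \<SS>] by (simp add: sg_def)
  ultimately show ?thesis using vreal_scale[of m "\<lambda>u. \<sigma> * loop m u" \<sigma>] by (simp flip: mult.assoc)
qed

text \<open>Only injective index functions are considered because equal gamma matrices do not
  anticommute; so the loop need not be alternating and is antisymmetrized afterwards.\<close>

definition anti :: "nat \<Rightarrow> ((nat \<Rightarrow> nat) \<Rightarrow> complex) \<Rightarrow> bool" where
  "anti m W \<longleftrightarrow> (\<forall>a<m. \<forall>b<m. a \<noteq> b \<longrightarrow> (\<forall>u\<in>dom m. inj_on u {..<m} \<longrightarrow> W (u \<circ> tp a b) = - W u))"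

lemma inj_tp: "a < m \<Longrightarrow> b < m \<Longrightarrow> inj_on u {..<m} \<Longrightarrow> inj_on (u \<circ> tp a b) {..<m}"
proof (rule inj_onI)
  fix x y
  assume ab: "a < m" "b < m" and u: "inj_on u {..<m}"
    and xy: "x \<in> {..<m}" "y \<in> {..<m}" "(u \<circ> tp a b) x = (u \<circ> tp a b) y"
  have "tp a b x \<in> {..<m}" "tp a b y \<in> {..<m}" using ab xy by (auto simp: Transposition.transpose_def)
  then have "tp a b x = tp a b y" using u xy(3) by (auto dest: inj_onD)
  then show "x = y" by (metis Transposition.transpose_involutory)
qed

text \<open>Adjacent distinct gamma matrices anticommute, and conjugates of adjacent transpositions
  combine an odd number of sign changes.\<close>

lemma anti_loop: "anti m (loop m)"
proof -
  have adj: "loop m (u \<circ> tp a (Suc a)) = - loop m u" if a: "Suc a < m" and u: "u \<in> dom m" "inj_on u {..<m}" for a u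
  proof -
    let ?A = "map (\<lambda>a. e (u a)) (rev [Suc (Suc a)..<m])" and ?B = "map (\<lambda>a. e (u a)) (rev [0..<a])"
    have "[0..<m] = [0..<a] @ a # Suc a # [Suc (Suc a)..<m]"
      using a by (metis Suc_lessD less_imp_le_nat plus_nat.add_0 upt_add_eq_append upt_conv_Cons le_add_diff_inverse zero_le)
    then have l: "map f (rev [0..<m]) = map f (rev [Suc (Suc a)..<m]) @ [f (Suc a), f a] @ map f (rev [0..<a])" for f :: "nat \<Rightarrow> 'v"
      by simp
    have ua: "u a \<in> {1..N}" "u (Suc a) \<in> {1..N}" "u (Suc a) \<noteq> u a"
      using u a inj_onD[OF u(2), of "Suc a" a] by (auto simp: dom_def)
    have A: "map (\<lambda>b. e ((u \<circ> tp a (Suc a)) b)) (rev [Suc (Suc a)..<m]) = ?A"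
      and B: "map (\<lambda>b. e ((u \<circ> tp a (Suc a)) b)) (rev [0..<a]) = ?B"
      by (auto simp: Transposition.transpose_def)
    have two: "spin_word [e k, e k'] = mat_mul P (gam k) (gam k')" if "k \<in> {1..N}" "k' \<in> {1..N}" for k k'
      using that mat_mul_one_right[OF _ gam_mats[OF that(2)]] by (simp add: spin_vec_e flip: P_def)
    have "spin_word (?A @ [e (u a), e (u (Suc a))] @ ?B) = mat_scale (-1) (spin_word (?A @ [e (u (Suc a)), e (u a)] @ ?B))"
      unfolding spin_word_append two[OF ua(1,2)] two[OF ua(2,1)] gam_anticommute[OF ua(1,2) ua(3)[symmetric]]
      by (simp only: mat_mul_scale_left mat_mul_scale_right)
    then show ?thesis
      unfolding loop_def l A B by (simp add: trace_def mat_scale_def sum_negf del: spin_word.simps append.simps)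
  qed
  have lt: "\<forall>u\<in>dom m. inj_on u {..<m} \<longrightarrow> loop m (u \<circ> tp a b) = - loop m u" if "a < b" "b < m" for a b
  proof -
    have "\<forall>u\<in>dom m. inj_on u {..<m} \<longrightarrow> u \<circ> tp a b \<in> dom m \<and> inj_on (u \<circ> tp a b) {..<m} \<and> loop m (u \<circ> tp a b) = - loop m u"
    proof (rule tp_adjacent_induct[OF that, where Q = "\<lambda>t. \<forall>u\<in>dom m. inj_on u {..<m} \<longrightarrow>
        u \<circ> t \<in> dom m \<and> inj_on (u \<circ> t) {..<m} \<and> loop m (u \<circ> t) = - loop m u"])
      fix a assume a: "Suc a < m"
      show "\<forall>u\<in>dom m. inj_on u {..<m} \<longrightarrow> u \<circ> tp a (Suc a) \<in> dom m \<and> inj_on (u \<circ> tp a (Suc a)) {..<m} \<and>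
          loop m (u \<circ> tp a (Suc a)) = - loop m u"
        using adj[OF a] dom_tp[OF Suc_lessD[OF a] a] inj_tp[OF Suc_lessD[OF a] a] by blast
    next
      fix s t :: "nat \<Rightarrow> nat"
      assume s: "\<forall>u\<in>dom m. inj_on u {..<m} \<longrightarrow> u \<circ> s \<in> dom m \<and> inj_on (u \<circ> s) {..<m} \<and> loop m (u \<circ> s) = - loop m u"
        and t: "\<forall>u\<in>dom m. inj_on u {..<m} \<longrightarrow> u \<circ> t \<in> dom m \<and> inj_on (u \<circ> t) {..<m} \<and> loop m (u \<circ> t) = - loop m u"
      show "\<forall>u\<in>dom m. inj_on u {..<m} \<longrightarrow> u \<circ> (s \<circ> t \<circ> s) \<in> dom m \<and> inj_on (u \<circ> (s \<circ> t \<circ> s)) {..<m} \<and>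
          loop m (u \<circ> (s \<circ> t \<circ> s)) = - loop m u"
      proof (intro ballI impI)
        fix u assume u: "u \<in> dom m" "inj_on u {..<m}"
        have 1: "u \<circ> s \<in> dom m" "inj_on (u \<circ> s) {..<m}" "loop m (u \<circ> s) = - loop m u" using s u by auto
        have 2: "u \<circ> s \<circ> t \<in> dom m" "inj_on (u \<circ> s \<circ> t) {..<m}" "loop m (u \<circ> s \<circ> t) = - loop m (u \<circ> s)" using t 1 by auto
        have 3: "u \<circ> s \<circ> t \<circ> s \<in> dom m" "inj_on (u \<circ> s \<circ> t \<circ> s) {..<m}" "loop m (u \<circ> s \<circ> t \<circ> s) = - loop m (u \<circ> s \<circ> t)" using s 2 by auto
        show "u \<circ> (s \<circ> t \<circ> s) \<in> dom m \<and> inj_on (u \<circ> (s \<circ> t \<circ> s)) {..<m} \<and> loop m (u \<circ> (s \<circ> t \<circ> s)) = - loop m u"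
          using 3 2(3) 1(3) by (simp only: comp_assoc) simp
      qed
    qed
    then show ?thesis by blast
  qed
  show ?thesis
    unfolding anti_def
  proof (intro allI impI)
    fix a b assume "a < m" "b < m" "a \<noteq> b"
    then consider "a < b" | "b < a" by linarith
    then show "\<forall>u\<in>dom m. inj_on u {..<m} \<longrightarrow> loop m (u \<circ> tp a b) = - loop m u"
    proof cases
      case 2
      then show ?thesis using lt[of b a] \<open>a < m\<close> Transposition.transpose_commute[of a b] by simp
    qed (use lt \<open>b < m\<close> in blast)
  qed
qed

text \<open>On injective index functions the loop already changes sign, so raising alternation from
  \<open>k\<close> to \<open>k + 1\<close> slots multiplies it by \<open>k + 1\<close>; this
  produces the factorial.\<close>

lemma antisymmetrized_loop:
  "k \<le> m \<Longrightarrow> \<exists>R. vreal m R \<and> alt m k R \<and> (\<forall>u\<in>dom m. inj_on u {..<m} \<longrightarrow> R u = fact k * loop m u)"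
proof (induction k)
  case 0
  then show ?case using vreal_loop by (intro exI[of _ "loop m"]) (simp add: alt_def)
next
  case (Suc k)
  then obtain R where R: "vreal m R" "alt m k R" "\<And>u. u \<in> dom m \<Longrightarrow> inj_on u {..<m} \<Longrightarrow> R u = fact k * loop m u"
    by auto
  let ?R = "\<lambda>u. R u - (\<Sum>d<k. R (u \<circ> tp d k))"
  have "vreal m ?R" using R(1) Suc.prems by (intro vreal_diff vreal_sum vreal_tp) auto
  moreover have "alt m (Suc k) ?R" using R(2) Suc.prems by (intro alt_raise) auto
  moreover have "?R u = fact (Suc k) * loop m u" if u: "u \<in> dom m" "inj_on u {..<m}" for u
  proof -
    have "R (u \<circ> tp d k) = - (fact k * loop m u)" if "d < k" for d
      using R(3)[of "u \<circ> tp d k"] u anti_loop[of m] that Suc.prems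
      by (simp add: dom_tp inj_tp anti_def)
    then have "?R u = fact k * loop m u + of_nat k * (fact k * loop m u)"
      using R(3)[OF u] by simp
    then show ?thesis by (simp add: algebra_simps)
  qed
  ultimately show ?case by blast
qed

text \<open>\<open>e (2 * j)\<close> times \<open>e (2 * j - 1)\<close> is diagonal, with value
  \<open>- \<i>\<close> times the sign that tells whether \<open>j\<close> is in \<open>I\<close>;
  over consecutive pairs these signs multiply to \<open>par {..j} I\<close>.\<close>

lemma spin_word_initial:
  assumes "j \<le> n" "I \<in> P"
  shows "spin_word (map e (rev [1..<2 * j + 1])) J I = (if J = I then (- \<i>) ^ j * par {..j} I else 0)"
  using assms
proof (induction j arbitrary: J I)
  case 0
  have "I \<inter> {..0} = {}" using 0 by (auto simp: in_P_iff)
  then have "par {..0} I = 1" by (simp add: par_def)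
  then show ?case using 0 by (simp add: mat_one_def mat_of_def flip: P_def)
next
  case (Suc j)
  let ?a = "2 * j + 1" and ?b = "2 * j + 2"
  have ab: "?a \<in> {1..N}" "?b \<in> {1..N}" using Suc.prems by auto
  have I: "finite I" using Suc.prems by simp
  have fl: "fl ?a = {Suc j}" "fl ?b = {Suc j}" using Suc.prems by (auto simp: fl_def)
  have cf: "cf ?a K = par {..j} K" "cf ?b K = \<i> * par {..Suc j} K" for K
    using Suc.prems lessThan_Suc_atMost[of j] by (auto simp: cf_def)
  have rev: "rev [1..<2 * Suc j + 1] = ?b # ?a # rev [1..<2 * j + 1]" by (simp add: One_nat_def)
  have "spin_word (map e (rev [1..<2 * Suc j + 1])) =
      mat_mul P (mat_mul P (gam ?b) (gam ?a)) (spin_word (map e (rev [1..<2 * j + 1])))"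
    unfolding rev list.map spin_word_e_mul[OF ab(1)] spin_word_e_mul[OF ab(2)] mat_mul_assoc ..
  then have "spin_word (map e (rev [1..<2 * Suc j + 1])) J I =
      (\<Sum>K\<in>P. mat_mul P (gam ?b) (gam ?a) J K * (if K = I then (- \<i>) ^ j * par {..j} I else 0))"
    using Suc.IH[OF _ Suc.prems(2)] Suc.prems(1) by (simp add: mat_mul_def)
  also have "\<dots> = (\<Sum>K\<in>P. if K = I then mat_mul P (gam ?b) (gam ?a) J I * ((- \<i>) ^ j * par {..j} I) else 0)"
    by (intro sum.cong HOL.refl) auto
  also have "\<dots> = mat_mul P (gam ?b) (gam ?a) J I * ((- \<i>) ^ j * par {..j} I)"
    using Suc.prems by simp
  also have "mat_mul P (gam ?b) (gam ?a) J I = (if J = I then (- \<i>) * par {..Suc j} I * par {..j} I else 0)"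
    unfolding gam_mul[OF ab(2,1)] fl cf using Suc.prems I by (simp add: par_flip_single)
  also have "\<dots> * ((- \<i>) ^ j * par {..j} I) = (if J = I then (- \<i>) ^ Suc j * par {..Suc j} I * (par {..j} I * par {..j} I) else 0)"
    by (simp add: ac_simps)
  finally show ?case by (simp add: par_square)
qed

text \<open>The first \<open>2 * n\<close> gamma matrices multiply to a multiple of the parity, and
  the parity operator of \<open>e N\<close> cancels it. What remains is the scalar
  \<open>\<epsilon> * (- \<i>) ^ n\<close>, with trace \<open>2 ^ n\<close> times as large.\<close>

lemma loop_volume:
  assumes "odd N"
  shows "loop N Suc \<noteq> 0"
proof -
  have N: "2 * n + 1 = N" using assms by (rule odd_two_times_div_two_succ)
  have lt: "\<not> N \<le> 2 * n" "2 * n < N" using N by linarith+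
  have NN: "N \<in> {1..N}" using lt by simp
  have rev: "rev [1..<N + 1] = N # rev [1..<N]"
  proof -
    have "[1..<Suc N] = [1..<N] @ [N]" using NN by (intro upt_Suc_append) simp
    then show ?thesis by (simp only: rev_append rev.simps append.simps Suc_eq_plus1)
  qed
  have map: "map (\<lambda>a. e (Suc a)) (rev [0..<N]) = map e (rev [1..<N + 1])"
  proof -
    have S: "map Suc [0..<N] = [1..<N + 1]" using map_Suc_upt[of 0 N] by (simp add: One_nat_def)
    show ?thesis unfolding S[symmetric] rev_map[symmetric] map_map comp_def ..
  qed
  have "spin_word (map (\<lambda>a. e (Suc a)) (rev [0..<N])) I I = \<epsilon> * (- \<i>) ^ n" if I: "I \<in> P" for I
  proof -
    have fl: "fl N = {}" "cf N K = \<epsilon> * par UNIV K" for K using lt by (simp_all only: fl_def cf_def if_True if_False)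
    have "I \<inter> {..n} = I \<inter> UNIV" using I by (auto simp: in_P_iff)
    then have p: "par {..n} I = par UNIV I" by (simp add: par_def)
    have "spin_word (map (\<lambda>a. e (Suc a)) (rev [0..<N])) I I = (\<Sum>K\<in>P. gam N I K * spin_word (map e (rev [1..<N])) K I)"
      unfolding map rev list.map spin_word_e_mul[OF NN] by (simp add: mat_mul_def)
    also have "\<dots> = (\<Sum>K\<in>P. if K = I then gam N I I * ((- \<i>) ^ n * par {..n} I) else 0)"
      using spin_word_initial[OF order.refl I, unfolded N] by (intro sum.cong HOL.refl) auto
    also have "\<dots> = \<epsilon> * (- \<i>) ^ n * (par UNIV I * par UNIV I)"
      using I by (simp add: gam_def fl p)
    finally show ?thesis by (simp add: par_square)
  qed
  then have "loop N Suc = 2 ^ n * (\<epsilon> * (- \<i>) ^ n)"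
    by (simp add: loop_def trace_def P_def card_Pow)
  then show ?thesis using eps by auto
qed

lemma vreal_volume:
  assumes N: "N > 0" and W: "vinv N W" and alt: "alt N N W"
  shows "vreal N W"
proof (cases "even N")
  case True
  have "W u = 0" if "u \<in> dom N" for u
    using alt_top_zero[OF alt vinv_extensional[OF W] pinor_volume[OF True N W] that] .
  then show ?thesis using vreal_zero vreal_cong[of N W "\<lambda>_. 0"] by simp
next
  case False
  obtain R where R: "vreal N R" "alt N N R" "\<And>u. u \<in> dom N \<Longrightarrow> inj_on u {..<N} \<Longrightarrow> R u = fact N * loop N u"
    using antisymmetrized_loop[of N N] by blast
  obtain w where w: "\<And>u. u \<in> dom N \<Longrightarrow> R u = w (lab N u)" using R(1) unfolding vreal_def by blast
  have S: "Suc \<in> dom N" by (auto simp: dom_def)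
  have nz: "R Suc \<noteq> 0" using R(3)[OF S] loop_volume[OF False] by simp
  define c where "c = W Suc / R Suc"
  let ?Z = "\<lambda>u. W u - c * R u"
  have "?Z u = 0" if "u \<in> dom N" for u
  proof (rule alt_top_zero[OF _ _ _ that])
    show "alt N N ?Z" using alt R(2) by (simp add: alt_def)
    show "?Z Suc = 0" using nz by (simp add: c_def)
    fix v v' assume v: "v \<in> dom N" "\<And>a. a < N \<Longrightarrow> v a = v' a"
    then have "v' \<in> dom N" "lab N v = lab N v'" by (auto simp: dom_def lab_def)
    then show "?Z v = ?Z v'" using vinv_extensional[OF W v] w v(1) by simp
  qed
  then show ?thesis using vreal_scale[OF R(1), of c] vreal_cong[of N W "\<lambda>u. c * R u"] by simp
qed

subsection \<open>The first fundamental theorem\<close>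

text \<open>Sum \<open>vinv_slot\<close> over the first \<open>k\<close> slots. Transpositions within these slots act by \<open>-1\<close>, the
  others add up to \<open>(m - k) W\<close> by \<open>alt_remainder\<close>, all modulo realizable tensors, and the
  contractions are realizable by induction on \<open>m\<close>. Hence \<open>(m - k (k + 1 - N)) W\<close> is realizable; for
  \<open>0 < k \<le> N\<close> and \<open>k \<le> m\<close> the coefficient vanishes only if \<open>m = k = N\<close>.\<close>

lemma vreal_alt_step:
  assumes k: "0 < k" "k \<le> m" and W: "vinv m W" and alt: "alt m k W"
    and ok: "\<And>W. k < m \<Longrightarrow> vinv m W \<Longrightarrow> alt m (Suc k) W \<Longrightarrow> vreal m W"
    and full: "\<And>j. j < m \<Longrightarrow> inv_full (replicate j \<VV>)"
  shows "vreal m W"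
proof (cases "k \<le> N")
  case False
  have "W u = 0" if u: "u \<in> dom m" for u
  proof (rule alt_not_inj[OF alt k(2) u])
    have "u ` {..<k} \<subseteq> {1..N}" using u k by (auto simp: dom_def)
    then show "\<not> inj_on u {..<k}" using card_inj_on_le[of u "{..<k}" "{1..N}"] False by auto
  qed
  then show ?thesis using vreal_zero vreal_cong[of m W "\<lambda>_. 0"] by simp
next
  case True
  \<comment> \<open>Taken in the integers, so that its sign can be discussed without truncated
    differences.\<close>
  define coef where "coef = int k * (int N - 1) - int k * (int k - 1) + (int m - int k)"
  have con: "vreal m (contract c a W)" if ca: "c < m" "a \<in> {..<m} - {c}" for c a
  proof -
    have "2 \<le> m" using ca by auto
    then obtain j where j: "m = Suc (Suc j)" by (metis add_2_eq_Suc le_Suc_ex)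
    show ?thesis unfolding j using full[of j] W ca j by (intro vreal_contract) auto
  qed
  have A: "vreal m (\<lambda>u. (\<Sum>c<k. \<Sum>a\<in>{..<m} - {c}. contract c a W u) + (\<Sum>a=k..<m. W u - (\<Sum>d<k. W (u \<circ> tp d a))))"
  proof (rule vreal_add)
    show "vreal m (\<lambda>u. \<Sum>c<k. \<Sum>a\<in>{..<m} - {c}. contract c a W u)"
      using k by (intro vreal_sum con) auto
    show "vreal m (\<lambda>u. \<Sum>a=k..<m. W u - (\<Sum>d<k. W (u \<circ> tp d a)))"
    proof (rule vreal_sum)
      fix a assume a: "a \<in> {k..<m}"
      then have "k < m" by simp
      with a show "vreal m (\<lambda>u. W u - (\<Sum>d<k. W (u \<circ> tp d a)))"
        by (intro alt_remainder[OF alt W] ok) auto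
    qed
  qed
  have eq: "(\<Sum>c<k. \<Sum>a\<in>{..<m} - {c}. contract c a W u) + (\<Sum>a=k..<m. W u - (\<Sum>d<k. W (u \<circ> tp d a))) = of_int coef * W u"
    if u: "u \<in> dom m" for u
  proof -
    have "(\<Sum>a\<in>{..<m} - {c}. W (u \<circ> tp c a)) = - (of_nat k - 1) * W u + (\<Sum>a=k..<m. W (u \<circ> tp c a))" if c: "c < k" for c
    proof -
      have "{..<m} - {c} = ({..<k} - {c}) \<union> {k..<m}" "({..<k} - {c}) \<inter> {k..<m} = {}" using c k by auto
      then have "(\<Sum>a\<in>{..<m} - {c}. W (u \<circ> tp c a)) = (\<Sum>a\<in>{..<k} - {c}. W (u \<circ> tp c a)) + (\<Sum>a=k..<m. W (u \<circ> tp c a))"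
        by (simp add: sum.union_disjoint)
      also have "(\<Sum>a\<in>{..<k} - {c}. W (u \<circ> tp c a)) = (\<Sum>a\<in>{..<k} - {c}. - W u)"
        using altD[OF alt c _ _ u] by (intro sum.cong HOL.refl) auto
      also have "\<dots> = - (of_nat k - 1) * W u"
        using c by (simp add: card_Diff_singleton of_nat_diff algebra_simps)
      finally show ?thesis .
    qed
    then have "(\<Sum>c<k. \<Sum>a\<in>{..<m} - {c}. contract c a W u) =
        (\<Sum>c<k. (of_nat N - 1) * W u + (- (of_nat k - 1) * W u + (\<Sum>a=k..<m. W (u \<circ> tp c a))))"
      using vinv_slot[OF W u] k by (intro sum.cong HOL.refl) (simp flip: vinv_slot[OF W u])
    also have "\<dots> = of_nat k * ((of_nat N - 1) * W u - (of_nat k - 1) * W u) + (\<Sum>a=k..<m. \<Sum>c<k. W (u \<circ> tp c a))"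
      unfolding sum.swap[of _ "{..<k}" "{k..<m}"] by (simp add: sum.distrib sum_subtractf algebra_simps)
    finally have "(\<Sum>c<k. \<Sum>a\<in>{..<m} - {c}. contract c a W u) =
      of_nat k * ((of_nat N - 1) * W u - (of_nat k - 1) * W u) + (\<Sum>a=k..<m. \<Sum>c<k. W (u \<circ> tp c a))" .
    then show ?thesis
      using k by (simp add: sum_subtractf coef_def of_nat_diff algebra_simps)
  qed
  have real: "vreal m (\<lambda>u. of_int coef * W u)"
    by (rule iffD1[OF vreal_cong A]) (rule eq)
  show ?thesis
  proof (cases "coef = 0")
    case False
    then show ?thesis using vreal_scale[OF real, of "1 / of_int coef"] by simp
  next
    case zero: True
    \<comment> \<open>For \<open>k < N\<close> the coefficient is \<open>k (N - 1 - k)\<close>,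
      which is nonnegative, plus the positive number \<open>m\<close>.\<close>
    have "k = N"
    proof (rule ccontr)
      assume "k \<noteq> N"
      then have "int k * (int N - 1 - int k) \<ge> 0" using True by (intro mult_nonneg_nonneg) auto
      moreover have "coef = int k * (int N - 1 - int k) + int m" by (simp add: coef_def algebra_simps)
      ultimately show False using zero k by simp
    qed
    moreover have "m = k" using zero \<open>k = N\<close> by (simp add: coef_def)
    ultimately show ?thesis using vreal_volume W alt k by simp
  qed
qed

text \<open>The outer induction is on the number of slots, since contractions pass through two slots
  fewer. The inner one runs downwards in the number of alternating slots, from \<open>m\<close> to
  1, where alternation is no condition.\<close>

lemma inv_full_V_power: "inv_full (replicate m \<VV>)"
proof (induction m rule: less_induct)
  case (less m)
  show ?case
  proof (rule inv_full_V)
    fix W assume W: "vinv m W"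
    show "vreal m W"
    proof (cases "m = 0")
      case True
      have "realizable [] (\<lambda>_. 1)"
        unfolding realizable_def by (intro bexI[of _ "Strand []"]) (auto simp: diagrams_def ev_Strand)
      then have "vreal 0 (\<lambda>_. 1)" unfolding vreal_def by (intro exI[of _ "\<lambda>_. 1"]) simp
      \<comment> \<open>Without slots a tensor is a scalar; \<open>Suc\<close> is an arbitrary index
        function at which to read it.\<close>
      from vreal_scale[OF this, of "W Suc"] have "vreal 0 (\<lambda>_. W Suc)" by simp
      moreover have "W u = W Suc" for u
        using vinv_extensional[OF W, of u Suc] True by (simp add: dom_def)
      ultimately show ?thesis using True vreal_cong[of 0 W "\<lambda>_. W Suc"] by simp
    next
      case False
      have "\<forall>W. vinv m W \<longrightarrow> alt m k W \<longrightarrow> vreal m W" if "1 \<le> k" "k \<le> m" for k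
        using that(2,1)
      proof (induction k rule: inc_induct)
        case base
        then show ?case using vreal_alt_step[of m m] less.IH by auto
      next
        case (step k)
        then show ?case using vreal_alt_step[of k m] less.IH by auto
      qed
      moreover have "alt m 1 W" by (simp add: alt_def)
      ultimately show ?thesis using W False by (metis One_nat_def Suc_leI bot_nat_0.not_eq_extremum order.refl)
    qed
  qed
qed

end

theorem theorem7p9:
  fixes scale :: "complex \<Rightarrow> 'v::ab_group_add \<Rightarrow> 'v"
    and \<Phi> :: "'v \<Rightarrow> 'v \<Rightarrow> complex"
    and N :: nat
    and e :: "nat \<Rightarrow> 'v"
    and \<epsilon> :: complex
  assumes "quadratic_space scale \<Phi>"
    and "vector_space.dim scale UNIV = N"
    and "quadratic_space.orthonormal_basis scale \<Phi> N e"
    and "\<epsilon> \<in> {1, -1}"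
  shows "linear_monoidal_functor (spin_data.SB N) (spin_data.G_mod scale \<Phi> N)
      (spin_data.inc_obj scale \<Phi> N e \<epsilon>) (spin_data.inc_mor scale \<Phi> N e \<epsilon>)
    \<and> full_functor (spin_data.SB N) (spin_data.G_mod scale \<Phi> N)
      (spin_data.inc_obj scale \<Phi> N e \<epsilon>) (spin_data.inc_mor scale \<Phi> N e \<epsilon>)"
proof -
  interpret spin_setup scale \<Phi> N e \<epsilon>
    using assms by (intro spin_setup.intro spin_setup_axioms.intro)
  show ?thesis using incarnation_functor full_if_inv_full[OF inv_full_V_power] by simp
qed

end
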